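(* Let $d\ge 2$, $N\ge 1$, and consider the control system $$\begin{cases}\dot x_i = K_i(x_i-x_{N+1})+F_i(x), & 1\le i\le N,\\ \dot x_{N+1}=F_{N+1}(x)+\zeta,\\ x(0)=x_{\mathfrak{in}},\end{cases}$$ for $x=(x_1,\dots,x_{N+1})$ with values in $\Delta_{N+1}^{\complement}$, where $K_1,\dots,K_N,F_1,\dots,F_{N+1}$ satisfy the structural assumptions listed in the context. Then: (i) for every $T_{\mathfrak{f}}>0$ the system is exactly controllable in time $T_{\mathfrak{f}}$; (ii) for every $x_{\mathfrak{in}}\in\Delta_{N+1}^{\complement}$ and every $T_{\mathfrak{f}}>0$ the system is solidly controllable from $x_{\mathfrak{in}}$ in time $T_{\mathfrak{f}}$.
   Context: Notation: $\mathcal M=\mathbb R^d$ and, for $n\ge1$, $\Delta_n=\{x\in\mathcal M^n : \exists\, i\ne j,\ x_i=x_j\}$, $\Delta_n^{\complement}=\mathcal M^n\setminus\Delta_n$. $|\cdot|$ is the Euclidean norm. "Ball" always means a ball of positive radius. Structural assumptions: $F_1,\dots,F_{N+1}\colon\Delta_{N+1}^{\complement}\to\mathbb R^d$ and $K_1,\dots,K_N\colon\mathcal M\setminus\{0\}\to\mathbb R^d$ are continuous. For $1\le i\le N$, $$F_i(x_1,\dots,x_{N+1})=\widetilde F_i(x_1,\dots,x_N)+\widehat F_i(x_1,\dots,x_{N+1}),\qquad K_i(z)=f_i(|z|)\frac{A_iz}{|z|^{p_i}},$$ where $\widetilde F_i$ is locally Lipschitz on $\Delta_N^{\complement}$, $\widehat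 F_i$ is locally Lipschitz on $\mathcal M^{N+1}$, $A_i$ is an invertible real $d\times d$ matrix, $f_i\colon[0,\infty)\to\mathbb R$ is bounded and Lipschitz with $f_i(0)\ne0$, and $p_i>1$. Moreover $F_{N+1}$ is locally Lipschitz on $\Delta_{N+1}^{\complement}$. Exact controllability in time $T_{\mathfrak f}$: for every $x_{\mathfrak{in}}\in\Delta_{N+1}^{\complement}$ and every $x_{\mathfrak f}\in\Delta_{N+1}^{\complement}$ there exists a control $\zeta\in C^0([0,T_{\mathfrak f}];\mathbb R^d)$ such that the corresponding solution $x$ (with values in $\Delta_{N+1}^{\complement}$) is defined on $[0,T_{\mathfrak f}]$ and satisfies $x(T_{\mathfrak f})=x_{\mathfrak f}$. Solid controllability: For $x_{\mathfrak{in}}\in\Delta_{N+1}^{\complement}$ let $\mathcal Q(T_{\mathfrak f},x_{\mathfrak{in}})\subset C^0([0,T_{\mathfrak f}];\mathbb R^d)$ be the set of controls $\zeta$ for which the solution $x$ of the system with $x(0)=x_{\mathfrak{in}}$ is defined on $[0,T_{\mathfrak f}]$, endowed with the topology of $C^0([0,T_{\mathfrak f}];\mathbb R^d)$ (supremum norm), and write $x(T_{\mathfrak f};x_{\mathfrak{in}},\zeta)=x(T_{\mathfrak f})$. The system is solidly controllable from $x_{\mathfrak{in}}$ in time $T_{\mathfrak f}$ if there exist $\delta>0$, a ball $B\subset\Delta_{N+1}^{\complement}$, and a compact set $\mathcal C\subset\mathcal Q(T_{\mathfrak f},x_{\mathfrak{in}})$ such that for any continuous map $\Phi\colon\mathcal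 C\to\mathcal M^{N+1}$ satisfying $\sup_{\zeta\in\mathcal C}|\Phi(\zeta)-x(T_{\mathfrak f};x_{\mathfrak{in}},\zeta)|\le\delta$ one has $B\subset\Phi(\mathcal C)$. *)

theory Defs
  imports "HOL-Analysis.Analysis"
begin

text \<open>
  A configuration of points of $R^d$ labelled by a finite type \<open>'k\<close> is an element of
  \<open>(real^'d)^'k\<close>, which carries the Euclidean norm. For the system below, the labels are
  \<open>'n option\<close> with \<open>CARD('n)\<close> equal to $N$: \<open>Some i\<close> labels the $i$-th of the first $N$ particles,
  and \<open>None\<close> labels particle $N+1$, the controlled one.
\<close>

definition diagonals :: "((real^'d)^'k) set" where
  "diagonals = {x. \<exists>i j. i \<noteq> j \<and> x $ i = x $ j}"

definition locally_lipschitz_on :: "'a::metric_space set \<Rightarrow> ('a \<Rightarrow> 'b::metric_space) \<Rightarrow> bool" where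
  "locally_lipschitz_on S g \<longleftrightarrow> (\<forall>x\<in>S. \<exists>r>0. \<exists>L. L-lipschitz_on (cball x r \<inter> S) g)"

text \<open>
  The space $C^0([0,T];R^d)$ with the supremum distance. Its points are the functions that are
  continuous on \<open>{0..T}\<close> and \<open>undefined\<close> outside; boundedness is automatic.
\<close>

definition control_space :: "real \<Rightarrow> (real \<Rightarrow> real^'d) metric" where
  "control_space T = cfunspace (top_of_set {0..T}) euclidean_metric"

definition is_solution ::
  "('n::finite \<Rightarrow> real^'d \<Rightarrow> real^'d) \<Rightarrow> ('n option \<Rightarrow> (real^'d)^('n option) \<Rightarrow> real^'d) \<Rightarrow> real \<Rightarrow>
   (real^'d)^('n option) \<Rightarrow> (real \<Rightarrow> real^'d) \<Rightarrow> (real \<Rightarrow> (real^'d)^('n option)) \<Rightarrow> bool" where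
  "is_solution K F T x\<^sub>i\<^sub>n \<zeta> x \<longleftrightarrow>
     x 0 = x\<^sub>i\<^sub>n \<and>
     (\<forall>t\<in>{0..T}.
        x t \<in> - diagonals \<and>
        (\<forall>i. ((\<lambda>s. x s $ Some i) has_vector_derivative
               K i (x t $ Some i - x t $ None) + F (Some i) (x t)) (at t within {0..T})) \<and>
        ((\<lambda>s. x s $ None) has_vector_derivative F None (x t) + \<zeta> t) (at t within {0..T}))"

definition exactly_controllable ::
  "('n::finite \<Rightarrow> real^'d \<Rightarrow> real^'d) \<Rightarrow> ('n option \<Rightarrow> (real^'d)^('n option) \<Rightarrow> real^'d) \<Rightarrow>
   real \<Rightarrow> bool" where
  "exactly_controllable K F T \<longleftrightarrow>
     (\<forall>x\<^sub>i\<^sub>n \<in> - diagonals. \<forall>x\<^sub>f \<in> - diagonals.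
        \<exists>\<zeta> \<in> mspace (control_space T). \<exists>x. is_solution K F T x\<^sub>i\<^sub>n \<zeta> x \<and> x T = x\<^sub>f)"

definition admissible_controls ::
  "('n::finite \<Rightarrow> real^'d \<Rightarrow> real^'d) \<Rightarrow> ('n option \<Rightarrow> (real^'d)^('n option) \<Rightarrow> real^'d) \<Rightarrow> real \<Rightarrow>
   (real^'d)^('n option) \<Rightarrow> (real \<Rightarrow> real^'d) set" where
  "admissible_controls K F T x\<^sub>i\<^sub>n =
     {\<zeta> \<in> mspace (control_space T). \<exists>x. is_solution K F T x\<^sub>i\<^sub>n \<zeta> x}"

text \<open>
  The final state of the solution driven by \<open>\<zeta>\<close>. The description denotes this state when
  \<open>\<zeta>\<close> is admissible and the right-hand side is locally Lipschitz in the state, since the solution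
  on \<open>{0..T}\<close> is then unique.
\<close>

definition final_state ::
  "('n::finite \<Rightarrow> real^'d \<Rightarrow> real^'d) \<Rightarrow> ('n option \<Rightarrow> (real^'d)^('n option) \<Rightarrow> real^'d) \<Rightarrow> real \<Rightarrow>
   (real^'d)^('n option) \<Rightarrow> (real \<Rightarrow> real^'d) \<Rightarrow> (real^'d)^('n option)" where
  "final_state K F T x\<^sub>i\<^sub>n \<zeta> = (THE y. \<exists>x. is_solution K F T x\<^sub>i\<^sub>n \<zeta> x \<and> x T = y)"

definition solidly_controllable ::
  "('n::finite \<Rightarrow> real^'d \<Rightarrow> real^'d) \<Rightarrow> ('n option \<Rightarrow> (real^'d)^('n option) \<Rightarrow> real^'d) \<Rightarrow> real \<Rightarrow>
   (real^'d)^('n option) \<Rightarrow> bool" where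
  "solidly_controllable K F T x\<^sub>i\<^sub>n \<longleftrightarrow>
     (\<exists>\<delta>>0. \<exists>c. \<exists>r>0. \<exists>C.
        ball c r \<subseteq> - diagonals \<and>
        C \<subseteq> admissible_controls K F T x\<^sub>i\<^sub>n \<and>
        compactin (mtopology_of (control_space T)) C \<and>
        (\<forall>\<Phi>. continuous_map (subtopology (mtopology_of (control_space T)) C) euclidean \<Phi> \<and>
              (\<forall>\<zeta>\<in>C. norm (\<Phi> \<zeta> - final_state K F T x\<^sub>i\<^sub>n \<zeta>) \<le> \<delta>)
          \<longrightarrow> ball c r \<subseteq> \<Phi> ` C))"

end

theory Submission
  imports Defs
begin

text \<open>
  The control \<open>\<zeta>\<close> enters only the equation of the last particle, and with \<open>\<zeta> = y' - F None\<close> every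
  continuously differentiable path \<open>y\<close> of that particle can be realised. So the path \<open>y\<close> is the true
  control of the other particles, and they depend continuously on it in the supremum norm. The proof
  therefore works with continuous paths (\<open>is_family\<close>) and smooths them at the very end
  (\<open>smooth_family\<close>).

  Since \<open>p i > 1\<close>, the force \<open>K i\<close> is unbounded near \<open>0\<close>, and since \<open>A i\<close> is invertible it takes every
  direction there. When \<open>y\<close> is very close to particle \<open>i\<close>, this particle is thus pushed at any wanted
  speed in any wanted direction, while all other terms stay bounded: \<open>Ft i\<close> does not depend on \<open>y\<close>,
  \<open>Fh i\<close> is locally Lipschitz across collisions, and the other particles are far away. In a time
  \<open>h\<close>, a push moves particle \<open>i\<close> by a prescribed vector up to an error that vanishes as \<open>h\<close> tends to
  \<open>0\<close> (\<open>push_particle\<close>), and the other particles are hardly moved. The pushing offset has to run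
  continuously through directions whose mean is the wanted one without passing through \<open>0\<close>: it follows
  a circle shifted by the wanted mean, which needs dimension at least two. Between two pushes, \<open>y\<close>
  travels around the other particles in a short time (\<open>travel_stage\<close>).

  Pushing the particles in turn, with the target \<open>u\<close> as a parameter in a ball, gives a continuous
  family of motions whose final state is uniformly close to \<open>u\<close> (\<open>local_steering\<close>). By Brouwer's theorem
  such a family attains the centre of the ball exactly, even after a small continuous perturbation
  of the final states (\<open>brouwer_covering\<close>); this is the source of both exact and solid
  controllability. Exactness makes short motions composable: every state can be kept for any time
  by returning to it often, and nearby states can be joined in any time. As the set of
  configurations without collision is connected, any two of them can be joined in any time
  (\<open>reaches_all\<close>), and a final local family provides the ball of targets (\<open>steering_family\<close>).
\<close>

section \<open>Integral equations depending on a parameter\<close>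

lemma integral_upto_eq_unit_interval:
  fixes f :: "real \<Rightarrow> 'b::banach"
  assumes "continuous_on {0..t} f" "0 \<le> t"
  shows "integral {0..t} f = t *\<^sub>R integral {0..1} (\<lambda>s. f (t * s))"
proof (cases "t = 0")
  case False
  with assms have "t > 0" by simp
  have "((\<lambda>s. f (t * s + 0)) has_integral (1 / \<bar>t\<bar>) *\<^sub>R integral {0..t} f) ((\<lambda>s. (1 / t) *\<^sub>R s + - ((1 / t) *\<^sub>R 0)) ` {0..t})"
    using has_integral_affinity'[of f "integral {0..t} f" 0 t t 0] \<open>t > 0\<close>
      integrable_integral[OF integrable_continuous_real[OF assms(1)]]
    by (simp add: image_mult_atLeastAtMost field_simps)
  moreover have "(\<lambda>s. (1 / t) *\<^sub>R s + - ((1 / t) *\<^sub>R 0)) ` {0..t} = {0..1}"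
    using \<open>t > 0\<close> by (simp add: image_mult_atLeastAtMost)
  ultimately have "((\<lambda>s. f (t * s)) has_integral (1 / t) *\<^sub>R integral {0..t} f) {0..1}"
    using \<open>t > 0\<close> by simp
  then show ?thesis
    using \<open>t > 0\<close> by (simp add: integral_unique)
qed simp

lemma continuous_on_integral_upto:
  fixes f :: "'u::topological_space \<Rightarrow> real \<Rightarrow> 'b::banach"
  assumes "continuous_on (U \<times> {0..T}) (\<lambda>(u, t). f u t)"
  shows "continuous_on (U \<times> {0..T}) (\<lambda>(u, t). integral {0..t} (f u))"
proof -
  have "continuous_on ((U \<times> {0..T}) \<times> cbox 0 1) (\<lambda>(p, s). f (fst p) (snd p * s))"
  proof -
    have "continuous_on ((U \<times> {0..T}) \<times> cbox 0 1)
        ((\<lambda>(u, t). f u t) \<circ> (\<lambda>q. (fst (fst q), snd (fst q) * snd q)))"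
    proof (rule continuous_on_compose)
      show "continuous_on ((U \<times> {0..T}) \<times> cbox 0 1) (\<lambda>q::('u \<times> real) \<times> real. (fst (fst q), snd (fst q) * snd q))"
        by (intro continuous_intros)
      have "t * s \<le> T" "0 \<le> t * s" if "0 \<le> t" "t \<le> T" "0 \<le> s" "s \<le> 1" for t s :: real
        using that mult_left_le[of s t] by auto
      then show "continuous_on ((\<lambda>q. (fst (fst q), snd (fst q) * snd q)) ` ((U \<times> {0..T}) \<times> cbox 0 1)) (\<lambda>(u, t). f u t)"
        by (intro continuous_on_subset[OF assms]) auto
    qed
    then show ?thesis by (simp add: o_def case_prod_beta)
  qed
  then have "continuous_on (U \<times> {0..T}) (\<lambda>p. integral (cbox 0 1) (\<lambda>s. f (fst p) (snd p * s)))"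
    by (rule integral_continuous_on_param)
  then have "continuous_on (U \<times> {0..T}) (\<lambda>p. snd p *\<^sub>R integral {0..1} (\<lambda>s. f (fst p) (snd p * s)))"
    by (intro continuous_intros) simp
  moreover have "snd p *\<^sub>R integral {0..1} (\<lambda>s. f (fst p) (snd p * s)) = integral {0..snd p} (f (fst p))"
    if "p \<in> U \<times> {0..T}" for p
  proof -
    obtain u t where p: "p = (u, t)" "u \<in> U" "0 \<le> t" "t \<le> T"
      using \<open>p \<in> U \<times> {0..T}\<close> by auto
    have "continuous_on {0..t} ((\<lambda>(u, t). f u t) \<circ> (\<lambda>s. (u, s)))"
      using p by (intro continuous_on_compose continuous_intros continuous_on_subset[OF assms]) auto
    then show ?thesis
      using integral_upto_eq_unit_interval[of t "f u"] p by (simp add: o_def)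
  qed
  ultimately show ?thesis
    by (auto simp: case_prod_beta cong: continuous_on_cong)
qed

lemma continuous_on_slice:
  assumes "continuous_on (U \<times> S) (\<lambda>(u, t). f u t)" "u \<in> U"
  shows "continuous_on S (f u)"
proof -
  have "continuous_on S ((\<lambda>(u, t). f u t) \<circ> (\<lambda>s. (u, s)))"
    using assms(2) by (intro continuous_on_compose continuous_intros continuous_on_subset[OF assms(1)]) auto
  then show ?thesis by (simp add: o_def)
qed

lemma gronwall_integral:
  fixes v :: "real \<Rightarrow> real"
  assumes cont: "continuous_on {0..T} v" and "0 \<le> L" "0 \<le> c"
    and le: "\<And>t. t \<in> {0..T} \<Longrightarrow> v t \<le> integral {0..t} (\<lambda>s. L * (v s + c))"
    and t: "t \<in> {0..T}"
  shows "v t \<le> c * exp (L * t)"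
proof -
  define \<psi> where "\<psi> s = integral {0..s} (\<lambda>s. L * (v s + c)) + c" for s
  have d: "(\<psi> has_vector_derivative L * (v s + c)) (at s within {0..T})" if "s \<in> {0..T}" for s
    unfolding \<psi>_def
    by (auto intro!: derivative_eq_intros integral_has_vector_derivative continuous_intros cont that)
  have "exp (- (L * t)) * \<psi> t \<le> exp (- (L * 0)) * \<psi> 0"
  proof (rule DERIV_nonpos_imp_decreasing_open[of 0 t "\<lambda>s. exp (- (L * s)) * \<psi> s"])
    show "0 \<le> t" using t by simp
    have "continuous_on {0..T} \<psi>"
      by (meson d continuous_on_eq_continuous_within has_vector_derivative_continuous)
    then show "continuous_on {0..t} (\<lambda>s. exp (- (L * s)) * \<psi> s)"
      using t by (intro continuous_intros) (auto elim: continuous_on_subset)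
    fix s assume s: "0 < s" "s < t"
    then have "at s within {0..T} = at s"
      using t by (intro at_within_interior) auto
    then have "(\<psi> has_real_derivative L * (v s + c)) (at s)"
      using d[of s] s t by (auto simp: has_real_derivative_iff_has_vector_derivative)
    then have "((\<lambda>s. exp (- (L * s)) * \<psi> s) has_real_derivative
        (exp (- (L * s)) * (L * (v s + c)) + - (L * exp (- (L * s))) * \<psi> s)) (at s)"
      by (auto intro!: derivative_eq_intros)
    moreover have "exp (- (L * s)) * (L * (v s + c)) + - (L * exp (- (L * s))) * \<psi> s \<le> 0"
    proof -
      have "v s + c \<le> \<psi> s" using le[of s] s t by (simp add: \<psi>_def)
      then have "L * exp (- (L * s)) * (v s + c) \<le> L * exp (- (L * s)) * \<psi> s"
        using \<open>0 \<le> L\<close> by (intro mult_left_mono) auto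
      then show ?thesis by (simp add: mult_ac)
    qed
    ultimately show "\<exists>y. ((\<lambda>s. exp (- (L * s)) * \<psi> s) has_real_derivative y) (at s) \<and> y \<le> 0"
      by blast
  qed
  then have "\<psi> t \<le> c * exp (L * t)"
    by (simp add: \<psi>_def exp_minus field_simps)
  then show ?thesis using le[OF t] \<open>0 \<le> c\<close> by (simp add: \<psi>_def)
qed

text \<open>
  Picard iteration on functions of \<open>(u, t)\<close>: all iterates are jointly continuous, so continuous
  dependence on the parameter comes with the construction. Relative to the weight \<open>exp (2 * M * t)\<close>,
  where \<open>M\<close> exceeds the Lipschitz constant, each step halves the distance of successive iterates.
\<close>

lemma picard_family:
  fixes \<phi> :: "'u::topological_space \<Rightarrow> real \<Rightarrow> 'a::euclidean_space \<Rightarrow> 'a"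
  assumes "compact U" and "0 \<le> T"
    and cont: "continuous_on (U \<times> {0..T} \<times> UNIV) (\<lambda>(u, t, x). \<phi> u t x)"
    and lip: "\<And>u t. u \<in> U \<Longrightarrow> t \<in> {0..T} \<Longrightarrow> L-lipschitz_on UNIV (\<phi> u t)"
    and x0: "continuous_on U x0"
  obtains x where "continuous_on (U \<times> {0..T}) (\<lambda>(u, t). x u t)"
    and "\<And>u t. u \<in> U \<Longrightarrow> t \<in> {0..T} \<Longrightarrow> x u t = x0 u + integral {0..t} (\<lambda>s. \<phi> u s (x u s))"
proof (cases "U = {}")
  case True
  then show ?thesis using that by auto
next
  case False
  define M where "M = \<bar>L\<bar> + 1"
  have "M > 0" by (simp add: M_def)
  have lipM: "norm (\<phi> u t x - \<phi> u t y) \<le> M * norm (x - y)" if "u \<in> U" "t \<in> {0..T}" for u t x y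
  proof -
    have "norm (\<phi> u t x - \<phi> u t y) \<le> L * norm (x - y)"
      using lipschitz_onD[OF lip[OF that], of x y] by (simp add: dist_norm)
    also have "\<dots> \<le> M * norm (x - y)"
      by (intro mult_right_mono) (auto simp: M_def)
    finally show ?thesis .
  qed
  define X where "X = rec_nat (\<lambda>u t. x0 u) (\<lambda>_ Z u t. x0 u + integral {0..t} (\<lambda>s. \<phi> u s (Z u s)))"
  have X0: "X 0 = (\<lambda>u t. x0 u)"
    and XS: "X (Suc k) = (\<lambda>u t. x0 u + integral {0..t} (\<lambda>s. \<phi> u s (X k u s)))" for k
    by (auto simp: X_def)
  have contstep: "continuous_on (U \<times> {0..T}) (\<lambda>(u, t). \<phi> u t (Z u t))"
    if "continuous_on (U \<times> {0..T}) (\<lambda>(u, t). Z u t)" for Z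
  proof -
    have "continuous_on (U \<times> {0..T}) ((\<lambda>(u, t, x). \<phi> u t x) \<circ> (\<lambda>p. (fst p, snd p, Z (fst p) (snd p))))"
      using that
      by (intro continuous_on_compose continuous_intros continuous_on_subset[OF cont])
        (auto simp: case_prod_beta)
    then show ?thesis by (simp add: o_def case_prod_beta)
  qed
  have x0': "continuous_on (U \<times> {0..T}) (\<lambda>p. x0 (fst p))"
    by (rule continuous_on_compose2[OF x0 continuous_on_fst]) auto
  have Xcont: "continuous_on (U \<times> {0..T}) (\<lambda>(u, t). X k u t)" for k
  proof (induction k)
    case 0
    then show ?case using x0' by (simp add: X0 case_prod_beta)
  next
    case (Suc k)
    then show ?case
      using continuous_on_add[OF x0' continuous_on_integral_upto[OF contstep[OF Suc]]]
      by (simp add: XS case_prod_beta)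
  qed
  have cont1: "continuous_on {0..t} (\<lambda>s. \<phi> u s (Z u s))"
    if "continuous_on (U \<times> {0..T}) (\<lambda>(u, t). Z u t)" "u \<in> U" "t \<in> {0..T}" for Z u t
    by (rule continuous_on_subset[OF continuous_on_slice[OF contstep[OF that(1)] that(2)]]) (use that in auto)
  have "compact (U \<times> {0..T})" using \<open>compact U\<close> by (intro compact_Times) auto
  then have "bounded ((\<lambda>(u, t). X 1 u t - X 0 u t) ` (U \<times> {0..T}))"
    using continuous_on_diff[OF Xcont[of 1] Xcont[of 0]]
    by (intro compact_imp_bounded compact_continuous_image) (auto simp: case_prod_beta)
  then obtain B where B: "norm (X 1 u t - X 0 u t) \<le> B" if "u \<in> U" "t \<in> {0..T}" for u t
    by (force simp: bounded_iff)
  have "B \<ge> 0" using B[of "SOME u. u \<in> U" 0] False \<open>0 \<le> T\<close> norm_ge_zero order_trans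
    by (metis atLeastAtMost_iff order_refl some_in_eq)
  have iexp: "integral {0..t} (\<lambda>s. exp (2 * M * s)) \<le> exp (2 * M * t) / (2 * M)"
    and iexp': "(\<lambda>s. exp (2 * M * s)) integrable_on {0..t}" if "0 \<le> t" for t
  proof -
    have "((\<lambda>s. exp (2 * M * s)) has_integral exp (2 * M * t) / (2 * M) - exp (2 * M * 0) / (2 * M)) {0..t}"
      using that \<open>M > 0\<close>
      by (intro fundamental_theorem_of_calculus)
        (auto intro!: derivative_eq_intros simp flip: has_real_derivative_iff_has_vector_derivative)
    then show "integral {0..t} (\<lambda>s. exp (2 * M * s)) \<le> exp (2 * M * t) / (2 * M)"
      "(\<lambda>s. exp (2 * M * s)) integrable_on {0..t}"
      using \<open>M > 0\<close> by (auto simp: integral_unique)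
  qed
  have step: "norm (X (Suc k) u t - X k u t) \<le> B * (1/2)^k * exp (2 * M * t)"
    if "u \<in> U" "t \<in> {0..T}" for k u t
    using that
  proof (induction k arbitrary: t)
    case 0
    have "B * 1 \<le> B * exp (2 * M * t)"
      using 0 \<open>B \<ge> 0\<close> \<open>M > 0\<close> by (intro mult_left_mono) auto
    then show ?case using B[of u t] 0 by simp
  next
    case (Suc k)
    have "X (Suc (Suc k)) u t - X (Suc k) u t
        = integral {0..t} (\<lambda>s. \<phi> u s (X (Suc k) u s) - \<phi> u s (X k u s))"
      using Suc.prems cont1[OF Xcont Suc.prems]
      by (subst integral_diff) (simp_all add: XS[of "Suc k"] integrable_continuous_real, simp add: XS[of k])
    also have "norm \<dots> \<le> integral {0..t} (\<lambda>s. M * (B * (1/2)^k) * exp (2 * M * s))"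
    proof (rule integral_norm_bound_integral)
      show "(\<lambda>s. \<phi> u s (X (Suc k) u s) - \<phi> u s (X k u s)) integrable_on {0..t}"
        by (intro integrable_continuous_real continuous_intros cont1 Xcont Suc.prems)
      show "(\<lambda>s. M * (B * (1/2)^k) * exp (2 * M * s)) integrable_on {0..t}"
        using iexp'[of t] Suc.prems by (intro integrable_on_mult_right) auto
      fix s assume s: "s \<in> {0..t}"
      then have "s \<in> {0..T}" using Suc.prems by auto
      then have "norm (\<phi> u s (X (Suc k) u s) - \<phi> u s (X k u s)) \<le> M * norm (X (Suc k) u s - X k u s)"
        by (intro lipM Suc.prems)
      also have "\<dots> \<le> M * (B * (1/2)^k * exp (2 * M * s))"
        using \<open>s \<in> {0..T}\<close> Suc.prems \<open>M > 0\<close> by (intro mult_left_mono Suc.IH) auto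
      finally show "norm (\<phi> u s (X (Suc k) u s) - \<phi> u s (X k u s)) \<le> M * (B * (1/2)^k) * exp (2 * M * s)"
        by (simp add: mult_ac)
    qed
    also have "\<dots> = M * (B * (1/2)^k) * integral {0..t} (\<lambda>s. exp (2 * M * s))"
      by simp
    also have "\<dots> \<le> M * (B * (1/2)^k) * (exp (2 * M * t) / (2 * M))"
      using iexp[of t] Suc.prems \<open>B \<ge> 0\<close> \<open>M > 0\<close> by (intro mult_left_mono) auto
    also have "\<dots> = B * (1/2)^Suc k * exp (2 * M * t)"
      using \<open>M > 0\<close> by (simp add: field_simps)
    finally show ?case .
  qed
  define E where "E = B * exp (2 * M * T)"
  have stepE: "norm (X (Suc k) u t - X k u t) \<le> E * (1/2)^k" if "u \<in> U" "t \<in> {0..T}" for k u t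
  proof -
    have "B * (1/2)^k * exp (2 * M * t) \<le> B * (1/2)^k * exp (2 * M * T)"
      using that \<open>M > 0\<close> \<open>B \<ge> 0\<close> by (intro mult_left_mono) auto
    then show ?thesis using step[OF that, of k] by (simp add: E_def mult_ac)
  qed
  have "uniformly_convergent_on (U \<times> {0..T}) (\<lambda>n p. \<Sum>k<n. X (Suc k) (fst p) (snd p) - X k (fst p) (snd p))"
    by (rule Weierstrass_m_test'[where M = "\<lambda>k. E * (1/2)^k"])
      (auto intro!: stepE summable_mult)
  then obtain l where "uniform_limit (U \<times> {0..T}) (\<lambda>n p. \<Sum>k<n. X (Suc k) (fst p) (snd p) - X k (fst p) (snd p)) l sequentially"
    by (auto simp: uniformly_convergent_on_def)
  moreover have "(\<Sum>k<n. X (Suc k) u t - X k u t) = X n u t - x0 u" for n u t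
    by (subst sum_lessThan_telescope) (simp add: X0)
  ultimately have lim0: "uniform_limit (U \<times> {0..T}) (\<lambda>n p. X n (fst p) (snd p) - x0 (fst p)) l sequentially"
    by simp
  define x where "x u t = l (u, t) + x0 u" for u t
  have lim: "uniform_limit (U \<times> {0..T}) (\<lambda>n p. X n (fst p) (snd p)) (\<lambda>p. x (fst p) (snd p)) sequentially"
    using uniform_limit_add[OF lim0 uniform_limit_const, of "\<lambda>p. x0 (fst p)"] by (simp add: x_def)
  have xcont: "continuous_on (U \<times> {0..T}) (\<lambda>(u, t). x u t)"
    using uniform_limit_theorem[OF _ lim] Xcont by (simp add: case_prod_beta)
  show ?thesis
  proof (rule that[OF xcont])
    fix u t assume ut: "u \<in> U" "t \<in> {0..T}"
    have limu: "(\<lambda>n. X n u t) \<longlonglongrightarrow> x u t"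
      using tendsto_uniform_limitI[OF lim, of "(u, t)"] ut by simp
    have "uniform_limit {0..t} (\<lambda>n s. \<phi> u s (X n u s)) (\<lambda>s. \<phi> u s (x u s)) sequentially"
    proof (rule uniform_limitI)
      fix e :: real assume "e > 0"
      then have "\<forall>\<^sub>F n in sequentially. \<forall>p\<in>U \<times> {0..T}. dist (X n (fst p) (snd p)) (x (fst p) (snd p)) < e / M"
        using lim \<open>M > 0\<close> unfolding uniform_limit_iff by simp
      then show "\<forall>\<^sub>F n in sequentially. \<forall>s\<in>{0..t}. dist (\<phi> u s (X n u s)) (\<phi> u s (x u s)) < e"
      proof eventually_elim
        case (elim n)
        show ?case
        proof
          fix s assume "s \<in> {0..t}"
          then have s: "s \<in> {0..T}" using ut by auto
          have "norm (X n u s - x u s) < e / M"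
            using elim s ut by (force simp: dist_norm)
          then have "M * norm (X n u s - x u s) < e" using \<open>M > 0\<close> by (simp add: field_simps)
          then show "dist (\<phi> u s (X n u s)) (\<phi> u s (x u s)) < e"
            using lipM[OF ut(1) s, of "X n u s" "x u s"] by (simp add: dist_norm)
        qed
      qed
    qed
    then obtain I J where I: "\<And>n. ((\<lambda>s. \<phi> u s (X n u s)) has_integral I n) {0..t}"
      and J: "((\<lambda>s. \<phi> u s (x u s)) has_integral J) {0..t}" and "I \<longlonglongrightarrow> J"
      using uniform_limit_integral_cbox[where a = 0 and b = t and f = "\<lambda>n s. \<phi> u s (X n u s)"] cont1[OF Xcont ut]
      by (metis box_real(2) sequentially_bot)
    then have "(\<lambda>n. X (Suc n) u t) \<longlonglongrightarrow> x0 u + integral {0..t} (\<lambda>s. \<phi> u s (x u s))"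
      using integral_unique[OF I] integral_unique[OF J] by (auto simp: XS intro!: tendsto_intros)
    then show "x u t = x0 u + integral {0..t} (\<lambda>s. \<phi> u s (x u s))"
      using LIMSEQ_unique[OF LIMSEQ_Suc[OF limu]] by simp
  qed
qed

section \<open>Coverings by Brouwer's theorem and the space of configurations\<close>

text \<open>
  A fixed point of \<open>u \<mapsto> v + (u - \<phi> u)\<close> is a preimage of \<open>v\<close>, and the bound on \<open>\<phi> u - u\<close> lets this map
  send the ball into itself.
\<close>

lemma brouwer_covering:
  fixes \<phi> :: "'a::euclidean_space \<Rightarrow> 'a"
  assumes "0 < R" and cont: "continuous_on (cball c R) \<phi>"
    and near: "\<And>u. u \<in> cball c R \<Longrightarrow> norm (\<phi> u - u) \<le> s"
    and v: "norm (v - c) + s \<le> R"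
  shows "v \<in> \<phi> ` cball c R"
proof -
  obtain u where "u \<in> cball c R" "v + (u - \<phi> u) = u"
  proof (rule brouwer_ball[OF \<open>0 < R\<close>, of c "\<lambda>u. v + (u - \<phi> u)"])
    show "continuous_on (cball c R) (\<lambda>u. v + (u - \<phi> u))"
      by (intro continuous_intros cont)
    show "(\<lambda>u. v + (u - \<phi> u)) \<in> cball c R \<rightarrow> cball c R"
    proof
      fix u assume "u \<in> cball c R"
      then have "norm (\<phi> u - u) \<le> s" by (rule near)
      moreover have "norm ((v + (u - \<phi> u)) - c) \<le> norm (v - c) + norm (\<phi> u - u)"
        using norm_triangle_ineq4[of "v - c" "\<phi> u - u"] by (simp add: algebra_simps)
      ultimately have "norm ((v + (u - \<phi> u)) - c) \<le> R"
        using v by linarith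
      then show "v + (u - \<phi> u) \<in> cball c R"
        by (simp add: dist_norm norm_minus_commute)
    qed
  qed blast
  then show ?thesis by (force simp: image_iff)
qed

lemma open_off_diagonals: "open (- diagonals :: ((real^'d)^'k) set)"
proof -
  have "- diagonals = (\<Inter>i. \<Inter>j\<in>-{i}. {x :: (real^'d)^'k. x $ i \<noteq> x $ j})"
    by (auto simp: diagonals_def) metis
  moreover have "open {x :: (real^'d)^'k. x $ i \<noteq> x $ j}" for i j
    by (intro open_Collect_neq continuous_intros)
  ultimately show ?thesis by (auto intro!: open_INT)
qed

lemma off_diagonalsI: "(\<And>i j. i \<noteq> j \<Longrightarrow> x $ i \<noteq> x $ j) \<Longrightarrow> x \<in> - diagonals"
  unfolding diagonals_def by blast

lemma off_diagonalsD: "x \<in> - diagonals \<Longrightarrow> i \<noteq> j \<Longrightarrow> x $ i \<noteq> x $ j"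
  unfolding diagonals_def by blast

lemma connected_component_move_one_point:
  fixes x :: "(real^'d)^'k"
  assumes "CARD('d) \<ge> 2" "x \<in> - diagonals" "\<And>j. j \<noteq> k \<Longrightarrow> z \<noteq> x $ j"
  shows "connected_component (- diagonals) x (\<chi> j. if j = k then z else x $ j)"
proof -
  define S where "S = - ((\<lambda>j. x $ j) ` (UNIV - {k}))"
  let ?f = "\<lambda>v. (\<chi> j. if j = k then v else x $ j) :: (real^'d)^'k"
  have "connected S"
    unfolding S_def using assms(1)
    by (intro path_connected_imp_connected path_connected_complement_countable)
      (auto intro: countable_finite)
  moreover have "continuous_on S ?f"
  proof (intro continuous_on_vec_lambda)
    show "continuous_on S (\<lambda>v. if j = k then v else x $ j)" for j
      by (cases "j = k") (auto intro!: continuous_intros)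
  qed
  ultimately have "connected (?f ` S)" by (rule connected_continuous_image[rotated])
  moreover have "?f ` S \<subseteq> - diagonals"
  proof
    fix w assume "w \<in> ?f ` S"
    then obtain v where v: "v \<in> S" "w = ?f v" by blast
    show "w \<in> - diagonals"
    proof (rule off_diagonalsI)
      fix i j :: 'k assume "i \<noteq> j"
      moreover from this have "x $ i \<noteq> x $ j" by (rule off_diagonalsD[OF assms(2)])
      moreover have "v \<noteq> x $ l" if "l \<noteq> k" for l using v(1) that by (auto simp: S_def)
      ultimately show "w $ i \<noteq> w $ j"
        by (cases "i = k"; cases "j = k") (simp_all add: v(2) not_sym)
    qed
  qed
  moreover have "x $ k \<noteq> x $ j" if "j \<noteq> k" for j
    by (rule off_diagonalsD[OF assms(2) not_sym[OF that]])
  then have "x $ k \<in> S" by (auto simp: S_def)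
  then have "x \<in> ?f ` S" by (intro image_eqI[of _ _ "x $ k"]) (auto simp: vec_eq_iff)
  moreover have "?f z \<in> ?f ` S" using assms(3) by (auto simp: S_def)
  ultimately show ?thesis by (meson connected_component_def)
qed

lemma connected_component_move_all_points:
  fixes x c :: "(real^'d)^'k"
  assumes "CARD('d) \<ge> 2" "x \<in> - diagonals" "c \<in> - diagonals" "\<And>i j. x $ i \<noteq> c $ j"
  shows "connected_component (- diagonals) x c"
proof -
  let ?m = "\<lambda>Z. (\<chi> j. if j \<in> Z then c $ j else x $ j) :: (real^'d)^'k"
  have "connected_component (- diagonals) x (?m Z)" if "finite Z" for Z
    using that
  proof induction
    case empty
    have "?m {} = x" by (simp add: vec_eq_iff)
    then show ?case using assms(2) by (simp add: connected_component_refl)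
  next
    case (insert k Z)
    have "?m (insert k Z) = (\<chi> j. if j = k then c $ k else ?m Z $ j)"
      by (simp add: vec_eq_iff)
    moreover have "connected_component (- diagonals) (?m Z) (\<chi> j. if j = k then c $ k else ?m Z $ j)"
    proof (rule connected_component_move_one_point[OF assms(1)])
      show "?m Z \<in> - diagonals"
      proof (rule off_diagonalsI)
        fix i j :: 'k assume "i \<noteq> j"
        then have "x $ i \<noteq> x $ j" "c $ i \<noteq> c $ j"
          by (rule off_diagonalsD[OF assms(2)], rule off_diagonalsD[OF assms(3)])
        then show "?m Z $ i \<noteq> ?m Z $ j"
          by (cases "i \<in> Z"; cases "j \<in> Z") (simp_all add: assms(4) not_sym[OF assms(4)])
      qed
      show "c $ k \<noteq> ?m Z $ j" if "j \<noteq> k" for j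
      proof (cases "j \<in> Z")
        case True
        have "c $ k \<noteq> c $ j" by (rule off_diagonalsD[OF assms(3) not_sym[OF that]])
        with True show ?thesis by simp
      next
        case False
        then show ?thesis by (simp add: not_sym[OF assms(4)])
      qed
    qed
    ultimately show ?case using connected_component_trans[OF insert.IH] by simp
  qed
  from this[of UNIV] show ?thesis by simp
qed

text \<open>
  Two configurations can be joined through a third one that shares no position with either, by
  moving the points one at a time; each such move takes place in the complement of a finite set,
  which is path connected because the dimension is at least two.
\<close>

lemma connected_off_diagonals:
  assumes "CARD('d) \<ge> 2"
  shows "connected (- diagonals :: ((real^'d)^'k) set)"
  unfolding connected_iff_connected_component
proof (intro ballI)
  fix a b :: "(real^'d)^'k" assume ab: "a \<in> - diagonals" "b \<in> - diagonals"
  \<comment> \<open>The intermediate configuration \<open>c\<close> only uses positions that occur neither in \<open>a\<close> nor in \<open>b\<close>.\<close>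
  define S where "S = - (range (($) a) \<union> range (($) b))"
  have "infinite S"
    unfolding S_def by (simp add: infinite_UNIV_char_0 Compl_eq_Diff_UNIV flip: finite_UnI)
  then obtain Q where Q: "Q \<subseteq> S" "finite Q" "card Q = CARD('k)"
    using infinite_arbitrarily_large by metis
  then obtain g :: "'k \<Rightarrow> real^'d" where g: "bij_betw g UNIV Q"
    by (metis finite_class.finite_UNIV finite_same_card_bij)
  define c where "c = (\<chi> k. g k)"
  have c: "c $ k \<in> S" for k using g Q by (auto simp: c_def bij_betw_def)
  have cd: "c \<in> - diagonals"
    using g by (auto simp: c_def diagonals_def bij_betw_def dest: injD)
  have ac: "c $ j \<noteq> a $ i" and bc: "c $ j \<noteq> b $ i" for i j
    using c[of j] by (auto simp: S_def image_iff)
  have "connected_component (- diagonals) a c" "connected_component (- diagonals) b c"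
    by (rule connected_component_move_all_points[OF assms ab(1) cd not_sym[OF ac]],
        rule connected_component_move_all_points[OF assms ab(2) cd not_sym[OF bc]])
  then show "connected_component (- diagonals) a b"
    by (blast intro: connected_component_sym connected_component_trans)
qed

section \<open>Smoothing a family of curves\<close>

text \<open>
  The average of a curve over a short window that ends at the current time is continuously
  differentiable. Extending the curve by its initial value to the left keeps the starting point.
\<close>

lemma smooth_approximation:
  fixes y :: "'u::metric_space \<Rightarrow> real \<Rightarrow> 'b::euclidean_space"
  assumes "compact U" "0 < T" "0 < \<epsilon>"
    and cont: "continuous_on (U \<times> {0..T}) (\<lambda>(u, t). y u t)"
  obtains z z' where "continuous_on (U \<times> {0..T}) (\<lambda>(u, t). z u t)"
    and "continuous_on (U \<times> {0..T}) (\<lambda>(u, t). z' u t)"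
    and "\<And>u t. u \<in> U \<Longrightarrow> t \<in> {0..T} \<Longrightarrow> (z u has_vector_derivative z' u t) (at t within {0..T})"
    and "\<And>u. u \<in> U \<Longrightarrow> z u 0 = y u 0"
    and "\<And>u t. u \<in> U \<Longrightarrow> t \<in> {0..T} \<Longrightarrow> norm (z u t - y u t) \<le> \<epsilon>"
proof -
  define Y where "Y u s = y u (max 0 (min T s))" for u s
  have contY: "continuous_on (U \<times> UNIV) (\<lambda>(u, t). Y u t)"
  proof -
    have "continuous_on (U \<times> UNIV) ((\<lambda>(u, t). y u t) \<circ> (\<lambda>p. (fst p, max 0 (min T (snd p)))))"
      using \<open>0 < T\<close> by (intro continuous_on_compose continuous_intros continuous_on_subset[OF cont]) auto
    then show ?thesis by (simp add: Y_def o_def case_prod_beta)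
  qed
  have contYu: "continuous_on S (Y u)" if "u \<in> U" for u S
    by (rule continuous_on_subset[OF continuous_on_slice[OF contY that]]) auto
  have Yy: "Y u t = y u t" if "t \<in> {0..T}" for u t using that by (simp add: Y_def)
  have "uniformly_continuous_on (U \<times> {0..T}) (\<lambda>(u, t). y u t)"
    using cont \<open>compact U\<close> by (intro compact_uniformly_continuous compact_Times) auto
  then obtain d where "d > 0" and d: "\<And>p q. p \<in> U \<times> {0..T} \<Longrightarrow> q \<in> U \<times> {0..T} \<Longrightarrow> dist p q < d
      \<Longrightarrow> dist ((\<lambda>(u, t). y u t) p) ((\<lambda>(u, t). y u t) q) < \<epsilon>"
    unfolding uniformly_continuous_on_def using \<open>0 < \<epsilon>\<close> by (metis dist_commute)
  define h where "h = d / 2"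
  have "h > 0" using \<open>d > 0\<close> by (simp add: h_def)
  have close: "norm (Y u s - Y u t) \<le> \<epsilon>" if "u \<in> U" "t \<in> {0..T}" "s \<in> {t - h..t}" for u s t
  proof -
    have "\<bar>max 0 (min T s) - t\<bar> \<le> h" using that \<open>h > 0\<close> by (auto simp: max_def min_def)
    then have "dist (u, max 0 (min T s)) (u, t) < d"
      using \<open>d > 0\<close> by (auto simp: dist_Pair_Pair dist_real_def h_def)
    then show ?thesis
      using d[of "(u, max 0 (min T s))" "(u, t)"] that \<open>0 < T\<close> by (auto simp: Y_def dist_norm)
  qed
  \<comment> \<open>This is the mean of \<open>Y u\<close> over \<open>{t - h..t}\<close> (\<open>aavg\<close>), written so that its derivative is evident.\<close>
  define a where "a u t = y u 0 + (1 / h) *\<^sub>R integral {0..t} (\<lambda>s. Y u s - Y u (s - h))" for u t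
  have contD: "continuous_on (U \<times> {0..T}) (\<lambda>(u, s). Y u s - Y u (s - h))"
  proof -
    have "continuous_on (U \<times> {0..T}) ((\<lambda>(u, t). Y u t) \<circ> (\<lambda>p. (fst p, snd p - h)))"
      by (intro continuous_on_compose continuous_intros continuous_on_subset[OF contY]) auto
    then show ?thesis
      using continuous_on_diff[OF continuous_on_subset[OF contY, of "U \<times> {0..T}"]]
      by (fastforce simp: o_def case_prod_beta)
  qed
  have cont0: "continuous_on (U \<times> {0..T}) (\<lambda>p. y (fst p) 0)"
  proof -
    have "continuous_on (U \<times> {0..T}) ((\<lambda>(u, t). y u t) \<circ> (\<lambda>p. (fst p, 0)))"
      using \<open>0 < T\<close> by (intro continuous_on_compose continuous_intros continuous_on_subset[OF cont]) auto
    then show ?thesis by (simp add: o_def)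
  qed
  have conta: "continuous_on (U \<times> {0..T}) (\<lambda>(u, t). a u t)"
    using cont0 continuous_on_integral_upto[OF contD]
    by (auto simp: a_def case_prod_beta intro!: continuous_intros)
  have dera: "(a u has_vector_derivative (1 / h) *\<^sub>R (Y u t - Y u (t - h))) (at t within {0..T})"
    if "u \<in> U" "t \<in> {0..T}" for u t
    unfolding a_def
    using integral_has_vector_derivative[OF continuous_on_slice[OF contD that(1)] that(2)]
    by (auto intro!: derivative_eq_intros)
  have aavg: "h *\<^sub>R a u t = integral {t - h..t} (Y u)" if "u \<in> U" "t \<in> {0..T}" for u t
  proof -
    have int: "Y u integrable_on {p..q}" for p q
      by (intro integrable_continuous_real contYu that)
    have "integral {0..t} (\<lambda>s. Y u s - Y u (s - h)) = integral {0..t} (Y u) - integral {0..t} (\<lambda>s. Y u (s - h))"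
      by (intro integral_diff integrable_continuous_real contYu that
          continuous_on_compose2[OF contYu[OF that(1), of UNIV]] continuous_intros) auto
    also have "integral {0..t} (\<lambda>s. Y u (s - h)) = integral {- h..t - h} (Y u)"
      using integral_shift_real_ivl[of "- h" "- h" "t - h" "Y u"] by simp
    finally have 1: "integral {0..t} (\<lambda>s. Y u s - Y u (s - h)) = integral {0..t} (Y u) - integral {- h..t - h} (Y u)" .
    have "integral {- h..0} (Y u) = integral {- h..0} (\<lambda>s. y u 0)"
      using \<open>0 < T\<close> by (intro integral_cong) (auto simp: Y_def max_def min_def)
    then have 2: "integral {- h..0} (Y u) = h *\<^sub>R y u 0" using \<open>h > 0\<close> by simp
    have 3: "integral {- h..0} (Y u) + integral {0..t} (Y u) = integral {- h..t} (Y u)"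
      using that \<open>h > 0\<close> by (intro Henstock_Kurzweil_Integration.integral_combine int) auto
    have 4: "integral {- h..t - h} (Y u) + integral {t - h..t} (Y u) = integral {- h..t} (Y u)"
      using that \<open>h > 0\<close> by (intro Henstock_Kurzweil_Integration.integral_combine int) auto
    have "h *\<^sub>R a u t = h *\<^sub>R y u 0 + integral {0..t} (\<lambda>s. Y u s - Y u (s - h))"
      using \<open>h > 0\<close> by (simp add: a_def algebra_simps)
    then have "h *\<^sub>R a u t + integral {- h..t - h} (Y u) = integral {t - h..t} (Y u) + integral {- h..t - h} (Y u)"
      using 1 2 3 4 by (simp add: algebra_simps)
    then show ?thesis by simp
  qed
  have erra: "norm (a u t - y u t) \<le> \<epsilon>" if "u \<in> U" "t \<in> {0..T}" for u t
  proof -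
    have "h *\<^sub>R (a u t - y u t) = integral {t - h..t} (Y u) - integral {t - h..t} (\<lambda>s. Y u t)"
      using aavg[OF that] Yy[OF that(2)] \<open>h > 0\<close> by (simp add: algebra_simps)
    also have "\<dots> = integral {t - h..t} (\<lambda>s. Y u s - Y u t)"
      by (intro integral_diff[symmetric] integrable_continuous_real contYu that continuous_intros)
    also have "norm \<dots> \<le> \<epsilon> * (t - (t - h))"
      using \<open>h > 0\<close> that close by (intro integral_bound continuous_intros contYu) auto
    finally have "h * norm (a u t - y u t) \<le> h * \<epsilon>" using \<open>h > 0\<close> by (simp add: mult_ac)
    then show ?thesis using \<open>h > 0\<close> by (simp add: mult_le_cancel_left)
  qed
  show ?thesis
  proof (rule that[of a "\<lambda>u t. (1 / h) *\<^sub>R (Y u t - Y u (t - h))"])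
    show "continuous_on (U \<times> {0..T}) (\<lambda>(u, t). (1 / h) *\<^sub>R (Y u t - Y u (t - h)))"
      using contD by (auto simp: case_prod_beta intro!: continuous_intros)
    show "a u 0 = y u 0" for u by (simp add: a_def)
  qed (use conta dera erra in auto)
qed

section \<open>Lipschitz maps\<close>

lemma locally_lipschitz_on_compact:
  assumes "locally_lipschitz_on S g" "compact Q" "Q \<subseteq> S"
  obtains L where "L-lipschitz_on Q g"
proof -
  have "local_lipschitz {0::real} Q (\<lambda>_. g)"
  proof (rule local_lipschitzI)
    fix t :: real and x assume "x \<in> Q"
    then obtain r L where rL: "r > 0" "L-lipschitz_on (cball x r \<inter> S) g"
      using assms(1,3) unfolding locally_lipschitz_on_def by blast
    then have "L-lipschitz_on (cball x r \<inter> Q) g"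
      by (rule_tac lipschitz_on_subset) (use assms(3) in auto)
    with rL(1) show "\<exists>u>0. \<exists>L. \<forall>t\<in>cball t u \<inter> {0}. L-lipschitz_on (cball x u \<inter> Q) g"
      by blast
  qed
  then obtain L where "\<And>t. t \<in> {0::real} \<Longrightarrow> L-lipschitz_on Q g"
    by (rule local_lipschitz_compact_implies_lipschitz[OF _ assms(2)]) auto
  then show ?thesis using that by blast
qed

lemma lipschitz_on_bounded_scaleR:
  fixes g :: "'a::metric_space \<Rightarrow> real" and h :: "'a \<Rightarrow> 'b::real_normed_vector"
  assumes g: "L-lipschitz_on S g" "\<And>x. x \<in> S \<Longrightarrow> \<bar>g x\<bar> \<le> B"
    and h: "M-lipschitz_on S h" "\<And>x. x \<in> S \<Longrightarrow> norm (h x) \<le> C"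
    and "0 \<le> B" "0 \<le> C"
  shows "(L * C + B * M)-lipschitz_on S (\<lambda>x. g x *\<^sub>R h x)"
proof (rule lipschitz_onI)
  have "0 \<le> L" "0 \<le> M" using g h by (auto dest: lipschitz_on_nonneg)
  then show "0 \<le> L * C + B * M" using assms by simp
  fix x y assume xy: "x \<in> S" "y \<in> S"
  have "g x *\<^sub>R h x - g y *\<^sub>R h y = (g x - g y) *\<^sub>R h x + g y *\<^sub>R (h x - h y)"
    by (simp add: algebra_simps)
  also have "norm \<dots> \<le> \<bar>g x - g y\<bar> * norm (h x) + \<bar>g y\<bar> * norm (h x - h y)"
    by (metis norm_scaleR norm_triangle_ineq)
  also have "\<dots> \<le> (L * dist x y) * C + B * (M * dist x y)"
    using lipschitz_onD[OF g(1) xy] lipschitz_onD[OF h(1) xy] g(2)[OF xy(2)] h(2)[OF xy(1)]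
      \<open>0 \<le> B\<close> \<open>0 \<le> L\<close>
    by (intro add_mono mult_mono) (auto simp: dist_norm)
  finally show "dist (g x *\<^sub>R h x) (g y *\<^sub>R h y) \<le> (L * C + B * M) * dist x y"
    by (simp add: dist_norm algebra_simps)
qed

lemma norm_le_sum_components:
  fixes x :: "('a::real_normed_vector)^'n"
  shows "norm x \<le> (\<Sum>i\<in>UNIV. norm (x $ i))"
  by (simp add: norm_vec_def L2_set_le_sum)

lemma lipschitz_on_vec:
  fixes g :: "'a::metric_space \<Rightarrow> ('b::real_normed_vector)^'n"
  assumes "\<And>i. (L i)-lipschitz_on S (\<lambda>x. g x $ i)"
  shows "(\<Sum>i\<in>UNIV. L i)-lipschitz_on S g"
proof (rule lipschitz_onI)
  show "0 \<le> (\<Sum>i\<in>UNIV. L i)"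
    using assms by (auto intro!: sum_nonneg dest: lipschitz_on_nonneg)
  fix x y assume xy: "x \<in> S" "y \<in> S"
  have "dist (g x) (g y) \<le> (\<Sum>i\<in>UNIV. dist (g x $ i) (g y $ i))"
    using norm_le_sum_components[of "g x - g y"] by (simp add: dist_norm)
  also have "\<dots> \<le> (\<Sum>i\<in>UNIV. L i * dist x y)"
    by (intro sum_mono lipschitz_onD[OF assms] xy)
  finally show "dist (g x) (g y) \<le> (\<Sum>i\<in>UNIV. L i) * dist x y"
    by (simp add: sum_distrib_right)
qed

lemma lipschitz_on_powr_compact:
  fixes a b q :: real
  assumes "0 < a"
  obtains L where "L-lipschitz_on {a..b} (\<lambda>t. t powr q)"
proof -
  have "continuous_on {a..b} (\<lambda>t. q * t powr (q - 1))"
    using assms by (intro continuous_intros) auto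
  then have "bounded ((\<lambda>t. q * t powr (q - 1)) ` {a..b})"
    by (intro compact_imp_bounded compact_continuous_image) auto
  then obtain C where C: "\<And>t. t \<in> {a..b} \<Longrightarrow> \<bar>q * t powr (q - 1)\<bar> \<le> C"
    by (force simp: bounded_iff)
  have "(\<bar>C\<bar>)-lipschitz_on {a..b} (\<lambda>t. t powr q)"
  proof (rule bounded_derivative_imp_lipschitz)
    fix t assume t: "t \<in> {a..b}"
    show "((\<lambda>t. t powr q) has_derivative (\<lambda>h. h * (q * t powr (q - 1)))) (at t within {a..b})"
      using t assms
      by (auto intro!: derivative_eq_intros simp: has_field_derivative_def[symmetric] mult_commute_abs)
    show "onorm (\<lambda>h. h * (q * t powr (q - 1))) \<le> \<bar>C\<bar>"
    proof (rule onorm_le)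
      fix h :: real
      have "\<bar>h\<bar> * \<bar>q * t powr (q - 1)\<bar> \<le> \<bar>h\<bar> * \<bar>C\<bar>"
        using C[OF t] by (intro mult_left_mono) auto
      then show "norm (h * (q * t powr (q - 1))) \<le> \<bar>C\<bar> * norm h"
        by (simp add: abs_mult mult.commute)
    qed
  qed auto
  then show ?thesis by (rule that)
qed

section \<open>The controlled system\<close>

definition particles :: "(real^'d)^('n::finite option) \<Rightarrow> (real^'d)^'n" where
  "particles w = (\<chi> i. w $ Some i)"

definition join :: "(real^'d)^'n \<Rightarrow> real^'d \<Rightarrow> (real^'d)^('n::finite option)" where
  "join x y = (\<chi> k. case k of None \<Rightarrow> y | Some i \<Rightarrow> x $ i)"

lemma particles_nth [simp]: "particles w $ i = w $ Some i"
  by (simp add: particles_def)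

lemma join_nth [simp]: "join x y $ Some i = x $ i" "join x y $ None = y"
  by (simp_all add: join_def)

lemma particles_join [simp]: "particles (join x y) = x"
  by (simp add: vec_eq_iff)

lemma join_particles [simp]: "join (particles w) (w $ None) = w"
  by (auto simp: vec_eq_iff join_def split: option.splits)

lemma join_diff: "join x y - join x' y' = join (x - x') (y - y')"
  by (auto simp: vec_eq_iff join_def split: option.splits)

lemma norm_join_le: "norm (join x y) \<le> norm x + norm y"
proof -
  have "(\<Sum>k\<in>UNIV. (norm (join x y $ k))\<^sup>2) = (norm y)\<^sup>2 + (\<Sum>i\<in>UNIV. (norm (x $ i))\<^sup>2)"
    by (subst UNIV_option_conv) (simp add: sum.reindex)
  also have "(\<Sum>i\<in>UNIV. (norm (x $ i))\<^sup>2) = (norm x)\<^sup>2"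
    by (simp add: norm_vec_def L2_set_def sum_nonneg)
  finally have "norm (join x y) = sqrt ((norm y)\<^sup>2 + (norm x)\<^sup>2)"
    by (simp add: norm_vec_def L2_set_def)
  then show ?thesis using sqrt_sum_squares_le_sum[of "norm y" "norm x"] by simp
qed

lemma norm_particles_le: "norm (particles w) \<le> norm w"
proof -
  have "norm (particles w) = L2_set (\<lambda>k. norm (w $ k)) (range Some)"
    by (simp add: norm_vec_def L2_set_def sum.reindex)
  also have "\<dots> \<le> norm w"
    unfolding norm_vec_def L2_set_def by (intro real_sqrt_le_mono sum_mono2) auto
  finally show ?thesis .
qed

lemma particles_diff: "particles (v - w) = particles v - particles w"
  by (simp add: vec_eq_iff)

lemma lipschitz_on_particles: "1-lipschitz_on S particles"
  by (rule lipschitz_onI) (use norm_particles_le[of "_ - _"] in \<open>auto simp: dist_norm particles_diff\<close>)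

lemma continuous_on_particles [continuous_intros]:
  "continuous_on S g \<Longrightarrow> continuous_on S (\<lambda>s. particles (g s))"
  using continuous_on_compose2[OF lipschitz_on_continuous_on[OF lipschitz_on_particles[of UNIV]]] by auto

lemma continuous_on_join [continuous_intros]:
  assumes "continuous_on S g" "continuous_on S h"
  shows "continuous_on S (\<lambda>s. join (g s) (h s))"
  unfolding join_def
proof (rule continuous_on_vec_lambda)
  show "continuous_on S (\<lambda>s. case k of None \<Rightarrow> h s | Some i \<Rightarrow> g s $ i)" for k
    using assms by (cases k) (auto intro!: continuous_intros)
qed

lemma particles_off_diagonals: "w \<in> - diagonals \<Longrightarrow> particles w \<in> - diagonals"
  by (intro off_diagonalsI) (simp add: off_diagonalsD)

lemma join_off_diagonals:
  assumes "x \<in> - diagonals" "\<And>i. x $ i \<noteq> y"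
  shows "join x y \<in> - diagonals"
proof (rule off_diagonalsI)
  fix i j :: "'b option" assume "i \<noteq> j"
  then show "join x y $ i \<noteq> join x y $ j"
    using assms(2) not_sym[OF assms(2)] off_diagonalsD[OF assms(1)]
    by (cases i; cases j) simp_all
qed

lemma integral_component:
  fixes g :: "real \<Rightarrow> ('b::euclidean_space)^'n"
  assumes "g integrable_on S"
  shows "integral S g $ i = integral S (\<lambda>s. g s $ i)"
  using integral_linear[OF assms bounded_linear_vec_nth, of i] by (simp add: o_def)

locale particle_system =
  fixes K :: "'n::finite \<Rightarrow> real^'d \<Rightarrow> real^'d"
    and F :: "'n option \<Rightarrow> (real^'d)^('n option) \<Rightarrow> real^'d"
    and Ft :: "'n \<Rightarrow> (real^'d)^'n \<Rightarrow> real^'d"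
    and Fh :: "'n \<Rightarrow> (real^'d)^('n option) \<Rightarrow> real^'d"
    and A :: "'n \<Rightarrow> real^'d^'d"
    and f :: "'n \<Rightarrow> real \<Rightarrow> real"
    and p :: "'n \<Rightarrow> real"
  assumes dim: "CARD('d) \<ge> 2"
    and F_cont: "\<And>k. continuous_on (- diagonals) (F k)"
    and K_cont: "\<And>i. continuous_on (- {0}) (K i)"
    and F_split: "\<And>i x. x \<in> - diagonals \<Longrightarrow> F (Some i) x = Ft i (\<chi> j. x $ Some j) + Fh i x"
    and K_eq: "\<And>i z. z \<noteq> 0 \<Longrightarrow> K i z = f i (norm z) *\<^sub>R ((A i *v z) /\<^sub>R (norm z powr p i))"
    and Ft_lip: "\<And>i. locally_lipschitz_on (- diagonals) (Ft i)"
    and Fh_lip: "\<And>i. locally_lipschitz_on UNIV (Fh i)"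
    and A_inv: "\<And>i. invertible (A i)"
    and f_bounded: "\<And>i. bounded (f i ` {0..})"
    and f_lip: "\<And>i. \<exists>L. L-lipschitz_on {0..} (f i)"
    and f_0: "\<And>i. f i 0 \<noteq> 0"
    and p_gt_1: "\<And>i. p i > 1"
    and F_None_lip: "locally_lipschitz_on (- diagonals) (F None)"
begin

text \<open>
  The velocities of the uncontrolled particles. That of the controlled one is left out: it is at the
  disposal of the control.
\<close>

definition drift :: "(real^'d)^('n option) \<Rightarrow> (real^'d)^'n" where
  "drift w = (\<chi> i. K i (w $ Some i - w $ None) + F (Some i) w)"

lemma drift_nth: "drift w $ i = K i (w $ Some i - w $ None) + F (Some i) w"
  by (simp add: drift_def)

lemma diff_off_diagonals: "w \<in> - diagonals \<Longrightarrow> w $ Some i - w $ None \<in> - {0}"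
  using off_diagonalsD[of w "Some i" None] by simp

lemma continuous_on_drift: "continuous_on (- diagonals) drift"
  unfolding drift_def
proof (intro continuous_on_vec_lambda continuous_on_add F_cont)
  fix i
  have "continuous_on (- diagonals) (\<lambda>w::(real^'d)^('n option). w $ Some i - w $ None)"
    by (intro continuous_intros)
  moreover have "(\<lambda>w. w $ Some i - w $ None) ` (- diagonals :: ((real^'d)^('n option)) set) \<subseteq> - {0}"
    by (rule image_subsetI) (rule diff_off_diagonals)
  ultimately show "continuous_on (- diagonals) (\<lambda>w. K i (w $ Some i - w $ None))"
    by (rule continuous_on_compose2[OF K_cont])
qed

text \<open>
  On a compact set that avoids \<open>0\<close>, each of the three factors of \<open>K i\<close> is bounded and Lipschitz.
\<close>

lemma K_lipschitz_compact:
  assumes "compact Z" "0 \<notin> Z"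
  obtains L where "L-lipschitz_on Z (K i)"
proof (cases "Z = {}")
  case True
  then show ?thesis using that[of 0] by simp
next
  case False
  have "compact (norm ` Z)" using assms(1) by (intro compact_continuous_image continuous_intros)
  moreover have "norm ` Z \<noteq> {}" using False by simp
  ultimately obtain a b where "a \<in> norm ` Z" "\<forall>r\<in>norm ` Z. a \<le> r" "\<forall>r\<in>norm ` Z. r \<le> b"
    using compact_attains_inf[of "norm ` Z"] compact_attains_sup[of "norm ` Z"] by metis
  then obtain z0 where z0: "z0 \<in> Z" "\<And>z. z \<in> Z \<Longrightarrow> norm z0 \<le> norm z"
    and z1: "\<And>z. z \<in> Z \<Longrightarrow> norm z \<le> b" by auto
  have pos: "norm z0 > 0" using z0(1) assms(2) by auto
  have norm_lip: "1-lipschitz_on Z norm"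
    by (rule lipschitz_onI) (auto simp: dist_norm norm_triangle_ineq3)
  obtain L1 where "L1-lipschitz_on {0..} (f i)" using f_lip by blast
  then have 1: "(L1 * 1)-lipschitz_on Z (\<lambda>z. f i (norm z))"
    by (intro lipschitz_on_compose2[OF norm_lip]) (auto elim: lipschitz_on_subset)
  obtain B where "\<And>t. 0 \<le> t \<Longrightarrow> \<bar>f i t\<bar> \<le> B"
    using f_bounded[of i] by (auto simp: bounded_iff)
  then have B: "\<bar>f i (norm z)\<bar> \<le> B" for z :: "real^'d" by simp
  obtain L2 where "L2-lipschitz_on {norm z0..b} (\<lambda>t. t powr - p i)"
    using lipschitz_on_powr_compact[OF pos] by blast
  then have 2: "(L2 * 1)-lipschitz_on Z (\<lambda>z. norm z powr - p i)"
    by (intro lipschitz_on_compose2[OF norm_lip]) (auto elim!: lipschitz_on_subset simp: z0 z1)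
  obtain L3 where 3: "L3-lipschitz_on Z (\<lambda>z. A i *v z)"
    using bounded_linear.lipschitz_boundE[OF matrix_vector_mul_bounded_linear] by metis
  have bd: "\<exists>C\<ge>0. \<forall>z\<in>Z. norm (g z) \<le> C" if "L-lipschitz_on Z g" for g :: "real^'d \<Rightarrow> 'c::real_normed_vector" and L
    using compact_imp_bounded[OF compact_continuous_image[OF lipschitz_on_continuous_on[OF that] assms(1)]]
    unfolding bounded_pos by (auto intro: less_imp_le)
  obtain C2 where C2: "C2 \<ge> 0" "\<And>z. z \<in> Z \<Longrightarrow> \<bar>norm z powr - p i\<bar> \<le> C2" using bd[OF 2] by auto
  obtain C3 where C3: "C3 \<ge> 0" "\<And>z. z \<in> Z \<Longrightarrow> norm (A i *v z) \<le> C3" using bd[OF 3] by auto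
  note 23 = lipschitz_on_bounded_scaleR[OF 2 C2(2) 3 C3(2) C2(1) C3(1)]
  obtain C where C: "C \<ge> 0" "\<And>z. z \<in> Z \<Longrightarrow> norm (norm z powr - p i *\<^sub>R (A i *v z)) \<le> C"
    using bd[OF 23] by auto
  have "0 \<le> B" using B[of 0] by linarith
  note 123 = lipschitz_on_bounded_scaleR[OF 1 B 23 C(2) this C(1)]
  have "K i z = f i (norm z) *\<^sub>R (norm z powr - p i *\<^sub>R (A i *v z))" if "z \<in> Z" for z
    using that assms(2) by (subst K_eq) (auto simp: powr_minus)
  from that[OF lipschitz_on_transform[OF 123 this]] show ?thesis .
qed

lemma drift_lipschitz_compact:
  assumes "compact Q" "Q \<subseteq> - diagonals"
  obtains L where "L-lipschitz_on Q drift"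
proof -
  have "\<exists>L. L-lipschitz_on Q (\<lambda>w. drift w $ i)" for i
  proof -
    let ?h = "\<lambda>w::(real^'d)^('n option). w $ Some i - w $ None"
    have h: "(1 + 1)-lipschitz_on Q ?h"
      by (intro lipschitz_on_diff lipschitz_onI) (auto simp: dist_vec_nth_le)
    have "compact (?h ` Q)" using assms(1) by (intro compact_continuous_image continuous_intros)
    moreover have "0 \<notin> ?h ` Q" using diff_off_diagonals assms(2) by force
    ultimately obtain L1 where "L1-lipschitz_on (?h ` Q) (K i)" by (rule K_lipschitz_compact)
    note 1 = lipschitz_on_compose2[OF h this]
    have "compact (particles ` Q)" using assms(1) by (intro compact_continuous_image continuous_intros)
    moreover have "particles ` Q \<subseteq> - diagonals" using assms(2) particles_off_diagonals by blast
    ultimately obtain L2 where "L2-lipschitz_on (particles ` Q) (Ft i)"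
      using locally_lipschitz_on_compact[OF Ft_lip] by blast
    note 2 = lipschitz_on_compose2[OF lipschitz_on_particles this]
    obtain L3 where 3: "L3-lipschitz_on Q (Fh i)"
      using locally_lipschitz_on_compact[OF Fh_lip assms(1)] by blast
    have "drift w $ i = K i (?h w) + (Ft i (particles w) + Fh i w)" if "w \<in> Q" for w
      unfolding drift_nth particles_def using subsetD[OF assms(2) that] by (subst F_split) simp_all
    from lipschitz_on_transform[OF lipschitz_on_add[OF 1 lipschitz_on_add[OF 2 3]] this]
    show ?thesis by blast
  qed
  then obtain L where "\<And>i. (L i)-lipschitz_on Q (\<lambda>w. drift w $ i)" by metis
  then show ?thesis using that lipschitz_on_vec by blast
qed

end

section \<open>Families of motions\<close>

text \<open>Truncation to a ball turns a vector field that is Lipschitz near a curve into a globally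
  Lipschitz one.\<close>

definition clamp_ball :: "real \<Rightarrow> 'a::euclidean_space \<Rightarrow> 'a" where
  "clamp_ball \<rho> = closest_point (cball 0 \<rho>)"

lemma clamp_ball_id: "norm e \<le> \<rho> \<Longrightarrow> clamp_ball \<rho> e = e"
  by (simp add: clamp_ball_def closest_point_self)

lemma norm_clamp_ball: "0 \<le> \<rho> \<Longrightarrow> norm (clamp_ball \<rho> e) \<le> \<rho>"
  using closest_point_in_set[of "cball 0 \<rho>" e] by (simp add: clamp_ball_def)

lemma lipschitz_on_clamp_ball: "0 \<le> \<rho> \<Longrightarrow> 1-lipschitz_on S (clamp_ball \<rho>)"
  by (rule lipschitz_onI) (auto simp: clamp_ball_def intro!: closest_point_lipschitz)

lemma norm_clamp_ball_le: "0 \<le> \<rho> \<Longrightarrow> norm (clamp_ball \<rho> e) \<le> norm e"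
  using lipschitz_onD[OF lipschitz_on_clamp_ball[of \<rho> UNIV], of e 0] clamp_ball_id[of "0::'a" \<rho>]
  by (simp add: dist_norm)

lemma continuous_on_clamp_ball [continuous_intros]:
  assumes "continuous_on S g" "0 \<le> \<rho>"
  shows "continuous_on S (\<lambda>s. clamp_ball \<rho> (g s))"
  using continuous_on_compose2[OF lipschitz_on_continuous_on[OF lipschitz_on_clamp_ball[OF assms(2), of UNIV]] assms(1)]
  by simp

context particle_system
begin

text \<open>
  A family of motions, indexed by \<open>u\<close>, in which the controlled particle follows an arbitrary continuous
  path. The integral form of the equations allows such paths to have corners, so that motions can be
  concatenated freely.
\<close>

definition is_family ::
  "'u::topological_space set \<Rightarrow> real \<Rightarrow> ('u \<Rightarrow> real \<Rightarrow> (real^'d)^('n option)) \<Rightarrow> bool" where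
  "is_family U T w \<longleftrightarrow> continuous_on (U \<times> {0..T}) (\<lambda>(u, t). w u t) \<and>
     (\<forall>u\<in>U. \<forall>t\<in>{0..T}. w u t \<in> - diagonals \<and>
        particles (w u t) = particles (w u 0) + integral {0..t} (\<lambda>s. drift (w u s)))"

lemma continuous_on_drift_compose:
  assumes "continuous_on S g" "\<And>s. s \<in> S \<Longrightarrow> g s \<in> - diagonals"
  shows "continuous_on S (\<lambda>s. drift (g s))"
  using continuous_on_compose2[OF continuous_on_drift assms(1)] assms(2) by blast

text \<open>
  The equation for a feedback law \<open>Y\<close>, truncated to the \<open>\<rho>\<close>-tube around \<open>r\<close>. The states in the tube form a
  compact set without collisions, where the drift is Lipschitz, so solutions exist for the whole
  time. A solution that stays in the tube solves the original equation.
\<close>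

lemma tube_solution:
  fixes r :: "'u::metric_space \<Rightarrow> real \<Rightarrow> (real^'d)^'n" and Y :: "'u \<Rightarrow> real \<Rightarrow> (real^'d)^'n \<Rightarrow> real^'d"
  assumes U: "compact U" and "0 \<le> T" and \<rho>: "0 \<le> \<rho>"
    and r: "continuous_on (U \<times> {0..T}) (\<lambda>(u, t). r u t)"
    and Y: "continuous_on (U \<times> {0..T} \<times> UNIV) (\<lambda>(u, t, x). Y u t x)"
    and YL: "\<And>u t. u \<in> U \<Longrightarrow> t \<in> {0..T} \<Longrightarrow> M-lipschitz_on UNIV (Y u t)"
    and off: "\<And>u t e. u \<in> U \<Longrightarrow> t \<in> {0..T} \<Longrightarrow> norm e \<le> \<rho> \<Longrightarrow> join (r u t + e) (Y u t (r u t + e)) \<in> - diagonals"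
    and x0: "continuous_on U x0"
  obtains x where "continuous_on (U \<times> {0..T}) (\<lambda>(u, t). x u t)"
    and "\<And>u t. u \<in> U \<Longrightarrow> t \<in> {0..T} \<Longrightarrow> x u t = x0 u + integral {0..t} (\<lambda>s.
            let c = r u s + clamp_ball \<rho> (x u s - r u s) in drift (join c (Y u s c)))"
proof -
  let ?S = "U \<times> {0..T} \<times> (UNIV :: ((real^'d)^'n) set)"
  let ?c = "\<lambda>u t x. r u t + clamp_ball \<rho> (x - r u t)"
  have rS: "continuous_on (U \<times> {0..T} \<times> V) (\<lambda>q. r (fst q) (fst (snd q)))" for V :: "((real^'d)^'n) set"
  proof -
    have "continuous_on (U \<times> {0..T} \<times> V) ((\<lambda>(u, t). r u t) \<circ> (\<lambda>q. (fst q, fst (snd q))))"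
      by (intro continuous_on_compose continuous_intros continuous_on_subset[OF r]) auto
    then show ?thesis by (simp add: o_def)
  qed
  have YS: "continuous_on (U \<times> {0..T} \<times> V) (\<lambda>q. Y (fst q) (fst (snd q)) (g q))"
    if "continuous_on (U \<times> {0..T} \<times> V) g" for g and V :: "((real^'d)^'n) set"
  proof -
    have "continuous_on (U \<times> {0..T} \<times> V) ((\<lambda>(u, t, x). Y u t x) \<circ> (\<lambda>q. (fst q, fst (snd q), g q)))"
      by (intro continuous_on_compose continuous_intros that continuous_on_subset[OF Y]) auto
    then show ?thesis by (simp add: o_def)
  qed
  define Q where "Q = (\<lambda>(u, t, e). join (r u t + e) (Y u t (r u t + e))) ` (U \<times> {0..T} \<times> cball 0 \<rho>)"
  have "compact Q"
    unfolding Q_def case_prod_beta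
    by (intro compact_continuous_image compact_Times U continuous_intros rS YS) auto
  moreover have "Q \<subseteq> - diagonals"
    using off by (auto simp: Q_def)
  ultimately obtain L where L: "L-lipschitz_on Q drift" by (rule drift_lipschitz_compact)
  have inQ: "join (?c u t x) (Y u t (?c u t x)) \<in> Q" if "u \<in> U" "t \<in> {0..T}" for u t x
    unfolding Q_def using that norm_clamp_ball[OF \<rho>, of "x - r u t"]
    by (intro image_eqI[of _ _ "(u, t, clamp_ball \<rho> (x - r u t))"]) auto
  have cS: "continuous_on ?S (\<lambda>q. ?c (fst q) (fst (snd q)) (snd (snd q)))"
    by (intro continuous_intros rS \<rho>)
  have 1: "continuous_on ?S (\<lambda>(u, t, x). drift (join (?c u t x) (Y u t (?c u t x))))"
    unfolding case_prod_beta
  proof (rule continuous_on_drift_compose)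
    show "continuous_on ?S (\<lambda>q. join (?c (fst q) (fst (snd q)) (snd (snd q)))
        (Y (fst q) (fst (snd q)) (?c (fst q) (fst (snd q)) (snd (snd q)))))"
      by (intro continuous_on_join cS YS)
    show "join (?c (fst q) (fst (snd q)) (snd (snd q)))
        (Y (fst q) (fst (snd q)) (?c (fst q) (fst (snd q)) (snd (snd q)))) \<in> - diagonals" if "q \<in> ?S" for q
      by (rule subsetD[OF \<open>Q \<subseteq> - diagonals\<close> inQ]) (use that in auto)
  qed
  have 2: "(L * (1 + M))-lipschitz_on UNIV (\<lambda>x. drift (join (?c u t x) (Y u t (?c u t x))))"
    if ut: "u \<in> U" "t \<in> {0..T}" for u t
  proof (rule lipschitz_onI)
    have "0 \<le> L" "0 \<le> M" using L YL[OF ut] by (auto dest: lipschitz_on_nonneg)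
    then show "0 \<le> L * (1 + M)" by simp
    fix x y
    have c: "norm (?c u t x - ?c u t y) \<le> norm (x - y)"
      using lipschitz_onD[OF lipschitz_on_clamp_ball[OF \<rho>, of UNIV], of "x - r u t" "y - r u t"]
      by (simp add: dist_norm)
    have "norm (Y u t (?c u t x) - Y u t (?c u t y)) \<le> M * norm (?c u t x - ?c u t y)"
      using lipschitz_onD[OF YL[OF ut], of "?c u t x" "?c u t y"] by (simp add: dist_norm)
    also have "\<dots> \<le> M * norm (x - y)" using c \<open>0 \<le> M\<close> by (rule mult_left_mono)
    finally have "norm (?c u t x - ?c u t y) + norm (Y u t (?c u t x) - Y u t (?c u t y)) \<le> norm (x - y) + M * norm (x - y)"
      by (rule add_mono[OF c])
    then have "norm (join (?c u t x) (Y u t (?c u t x)) - join (?c u t y) (Y u t (?c u t y))) \<le> (1 + M) * norm (x - y)"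
      unfolding join_diff distrib_right mult_1 by (rule order_trans[OF norm_join_le])
    then have "L * dist (join (?c u t x) (Y u t (?c u t x))) (join (?c u t y) (Y u t (?c u t y))) \<le> L * ((1 + M) * dist x y)"
      using \<open>0 \<le> L\<close> by (intro mult_left_mono) (auto simp: dist_norm)
    then show "dist (drift (join (?c u t x) (Y u t (?c u t x)))) (drift (join (?c u t y) (Y u t (?c u t y)))) \<le> L * (1 + M) * dist x y"
      using lipschitz_onD[OF L inQ[OF ut, of x] inQ[OF ut, of y]] by (simp add: mult.assoc)
  qed
  show ?thesis
  proof (rule picard_family[OF U \<open>0 \<le> T\<close> 1 2 x0])
    fix x
    assume x: "continuous_on (U \<times> {0..T}) (\<lambda>(u, t). x u t)"
      and eq: "\<And>u t. u \<in> U \<Longrightarrow> t \<in> {0..T} \<Longrightarrow> x u t = x0 u + integral {0..t} (\<lambda>s. drift (join (?c u s (x u s)) (Y u s (?c u s (x u s)))))"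
    show ?thesis by (rule that[OF x]) (simp only: Let_def, rule eq)
  qed
qed

text \<open>
  A feedback law \<open>Y\<close> that keeps the speeds below \<open>M j\<close> on a tube around the initial positions can be
  followed for as long as the particles provably stay in the tube.
\<close>

lemma feedback_stage:
  fixes W :: "'u::metric_space \<Rightarrow> (real^'d)^('n option)" and Y :: "'u \<Rightarrow> real \<Rightarrow> (real^'d)^'n \<Rightarrow> real^'d"
  assumes U: "compact U" and T: "0 \<le> T" and \<rho>: "0 \<le> \<rho>"
    and W: "continuous_on U W"
    and Y: "continuous_on (U \<times> {0..T} \<times> UNIV) (\<lambda>(u, t, x). Y u t x)"
    and YL: "\<And>u t. u \<in> U \<Longrightarrow> t \<in> {0..T} \<Longrightarrow> L-lipschitz_on UNIV (Y u t)"
    and start: "\<And>u. u \<in> U \<Longrightarrow> Y u 0 (particles (W u)) = W u $ None"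
    and off: "\<And>u t x. u \<in> U \<Longrightarrow> t \<in> {0..T} \<Longrightarrow> norm (x - particles (W u)) \<le> \<rho> \<Longrightarrow> join x (Y u t x) \<in> - diagonals"
    and speed: "\<And>u t x j. u \<in> U \<Longrightarrow> t \<in> {0..T} \<Longrightarrow> norm (x - particles (W u)) \<le> \<rho> \<Longrightarrow>
      norm (drift (join x (Y u t x)) $ j) \<le> M j"
    and small: "T * (\<Sum>j\<in>UNIV. M j) \<le> \<rho>"
  obtains w where "is_family U T w" and "\<And>u. u \<in> U \<Longrightarrow> w u 0 = W u"
    and "\<And>u t. u \<in> U \<Longrightarrow> t \<in> {0..T} \<Longrightarrow> norm (particles (w u t) - particles (W u)) \<le> \<rho>"
    and "\<And>u t. u \<in> U \<Longrightarrow> t \<in> {0..T} \<Longrightarrow> w u t $ None = Y u t (particles (w u t))"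
    and "\<And>u t j. u \<in> U \<Longrightarrow> t \<in> {0..T} \<Longrightarrow> norm (w u t $ Some j - W u $ Some j) \<le> T * M j"
proof -
  let ?x0 = "\<lambda>u. particles (W u)"
  have x0: "continuous_on U ?x0" by (intro continuous_intros W)
  have x0': "continuous_on (U \<times> {0..T}) (\<lambda>(u, t). ?x0 u)"
    unfolding case_prod_beta by (rule continuous_on_compose2[OF x0 continuous_on_fst]) auto
  have off': "join (?x0 u + e) (Y u t (?x0 u + e)) \<in> - diagonals"
    if "u \<in> U" "t \<in> {0..T}" "norm e \<le> \<rho>" for u t e
    using off[of u t "?x0 u + e"] that by simp
  obtain x where xcont: "continuous_on (U \<times> {0..T}) (\<lambda>(u, t). x u t)"
    and xeq: "\<And>u t. u \<in> U \<Longrightarrow> t \<in> {0..T} \<Longrightarrow> x u t = ?x0 u + integral {0..t} (\<lambda>s.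
            let c = ?x0 u + clamp_ball \<rho> (x u s - ?x0 u) in drift (join c (Y u s c)))"
    using tube_solution[OF U T \<rho> x0' Y YL off' x0] by blast
  define c where "c u s = ?x0 u + clamp_ball \<rho> (x u s - ?x0 u)" for u s
  have xeq: "x u t = ?x0 u + integral {0..t} (\<lambda>s. drift (join (c u s) (Y u s (c u s))))"
    if "u \<in> U" "t \<in> {0..T}" for u t
    using xeq[OF that] by (simp add: c_def Let_def)
  have c_tube: "norm (c u s - ?x0 u) \<le> \<rho>" for u s
    using norm_clamp_ball[OF \<rho>] by (simp add: c_def)
  have ccont: "continuous_on (U \<times> {0..T}) (\<lambda>(u, t). c u t)"
    using x0' xcont unfolding c_def case_prod_beta
    by (intro continuous_on_add continuous_on_clamp_ball continuous_on_diff \<rho>) auto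
  have Ycont: "continuous_on (U \<times> {0..T}) (\<lambda>(u, t). Y u t (g u t))"
    if "continuous_on (U \<times> {0..T}) (\<lambda>(u, t). g u t)" for g
  proof -
    have "continuous_on (U \<times> {0..T}) ((\<lambda>(u, t, x). Y u t x) \<circ> (\<lambda>q. (fst q, snd q, g (fst q) (snd q))))"
      using that by (intro continuous_on_compose continuous_intros continuous_on_subset[OF Y]) (auto simp: case_prod_beta)
    then show ?thesis by (simp add: o_def case_prod_beta)
  qed
  have dcont: "continuous_on (U \<times> {0..T}) (\<lambda>(u, t). drift (join (c u t) (Y u t (c u t))))"
    unfolding case_prod_beta
  proof (rule continuous_on_drift_compose)
    show "continuous_on (U \<times> {0..T}) (\<lambda>q. join (c (fst q) (snd q)) (Y (fst q) (snd q) (c (fst q) (snd q))))"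
      using ccont Ycont[OF ccont] unfolding case_prod_beta by (rule continuous_on_join)
    show "join (c (fst q) (snd q)) (Y (fst q) (snd q) (c (fst q) (snd q))) \<in> - diagonals"
      if "q \<in> U \<times> {0..T}" for q
      by (rule off[OF _ _ c_tube]) (use that in auto)
  qed
  have disp: "norm ((x u t - ?x0 u) $ j) \<le> T * M j" if ut: "u \<in> U" "t \<in> {0..T}" for u t j
  proof -
    have cont: "continuous_on {0..t} (\<lambda>s. drift (join (c u s) (Y u s (c u s))))"
      by (rule continuous_on_subset[OF continuous_on_slice[OF dcont ut(1)]]) (use ut in auto)
    have "(x u t - ?x0 u) $ j = integral {0..t} (\<lambda>s. drift (join (c u s) (Y u s (c u s))) $ j)"
      using xeq[OF ut] integral_component[OF integrable_continuous_real[OF cont]] by simp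
    also have "norm \<dots> \<le> M j * (t - 0)"
      using ut c_tube by (intro integral_bound continuous_intros cont speed) auto
    also have "\<dots> \<le> M j * T"
      using ut speed[OF ut(1), of 0 "?x0 u" j] \<rho> T
      by (intro mult_left_mono) (auto intro: order_trans[OF norm_ge_zero])
    finally show ?thesis by (simp add: mult.commute)
  qed
  have tube: "norm (x u t - ?x0 u) \<le> \<rho>" if ut: "u \<in> U" "t \<in> {0..T}" for u t
  proof -
    have "norm (x u t - ?x0 u) \<le> (\<Sum>j\<in>UNIV. T * M j)"
      by (rule order_trans[OF norm_le_sum_components sum_mono]) (rule disp[OF ut])
    then show ?thesis using small by (simp add: sum_distrib_left)
  qed
  have cx: "c u t = x u t" if "u \<in> U" "t \<in> {0..T}" for u t
    using clamp_ball_id[OF tube[OF that]] by (simp add: c_def)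
  define w where "w u t = join (x u t) (Y u t (x u t))" for u t
  have w0: "w u 0 = W u" if "u \<in> U" for u
    using xeq[OF that, of 0] T start[OF that] by (simp add: w_def)
  show ?thesis
  proof (rule that[of w])
    show "is_family U T w"
      unfolding is_family_def
    proof (intro conjI ballI)
      show "continuous_on (U \<times> {0..T}) (\<lambda>(u, t). w u t)"
        using xcont Ycont[OF xcont] unfolding w_def case_prod_beta by (intro continuous_intros) auto
      fix u t assume ut: "u \<in> U" "t \<in> {0..T}"
      show "w u t \<in> - diagonals" unfolding w_def by (intro off ut tube)
      have "integral {0..t} (\<lambda>s. drift (join (c u s) (Y u s (c u s)))) = integral {0..t} (\<lambda>s. drift (w u s))"
        using ut by (intro integral_cong) (auto simp: w_def cx)
      then show "particles (w u t) = particles (w u 0) + integral {0..t} (\<lambda>s. drift (w u s))"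
        using xeq[OF ut] w0[OF ut(1)] by (simp add: w_def)
    qed
    show "w u 0 = W u" if "u \<in> U" for u by (rule w0[OF that])
    fix u t assume ut: "u \<in> U" "t \<in> {0..T}"
    show "norm (particles (w u t) - particles (W u)) \<le> \<rho>" using tube[OF ut] by (simp add: w_def)
    show "w u t $ None = Y u t (particles (w u t))" by (simp add: w_def)
    show "norm (w u t $ Some j - W u $ Some j) \<le> T * M j" for j
      using disp[OF ut, of j] by (simp add: w_def)
  qed
qed

lemma is_family_subset:
  assumes "is_family U T w" "V \<subseteq> U"
  shows "is_family V T w"
  using assms continuous_on_subset[of "U \<times> {0..T}" _ "V \<times> {0..T}"] unfolding is_family_def by blast

lemma is_family_reindex:
  assumes w: "is_family U T w" and g: "continuous_on V g" "g ` V \<subseteq> U"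
  shows "is_family V T (\<lambda>v. w (g v))"
proof -
  have "continuous_on (V \<times> {0..T}) ((\<lambda>(u, t). w u t) \<circ> (\<lambda>q. (g (fst q), snd q)))"
    using w g(2) unfolding is_family_def
    by (intro continuous_on_compose continuous_intros continuous_on_compose2[OF g(1)])
      (auto elim!: continuous_on_subset)
  then show ?thesis using w g(2) unfolding is_family_def by (auto simp: o_def case_prod_beta)
qed

lemma is_family_slice:
  assumes "is_family U T w" "u \<in> U"
  shows "continuous_on {0..T} (w u)" and "t \<in> {0..T} \<Longrightarrow> w u t \<in> - diagonals"
  using assms continuous_on_slice[of U "{0..T}" w u] unfolding is_family_def by auto

lemma is_family_eq:
  assumes "is_family U T w" "u \<in> U" "t \<in> {0..T}"
  shows "particles (w u t) = particles (w u 0) + integral {0..t} (\<lambda>s. drift (w u s))"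
  using assms unfolding is_family_def by blast

lemma is_family_eval:
  assumes "is_family U T w" "t \<in> {0..T}"
  shows "continuous_on U (\<lambda>u. w u t)"
proof -
  have "continuous_on U ((\<lambda>(u, t). w u t) \<circ> (\<lambda>u. (u, t)))"
    using assms unfolding is_family_def
    by (intro continuous_on_compose continuous_intros) (auto elim!: continuous_on_subset)
  then show ?thesis by (simp add: o_def)
qed

lemma is_family_drift_integrable:
  assumes "is_family U T w" "u \<in> U" "0 \<le> a" "b \<le> T"
  shows "(\<lambda>s. drift (w u s)) integrable_on {a..b}"
proof (rule integrable_continuous_real, rule continuous_on_drift_compose)
  show "continuous_on {a..b} (w u)"
    using is_family_slice(1)[OF assms(1,2)] assms(3,4) by (auto elim!: continuous_on_subset)
  show "w u s \<in> - diagonals" if "s \<in> {a..b}" for s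
    using that assms(3,4) by (intro is_family_slice(2)[OF assms(1,2)]) auto
qed

lemma is_family_append:
  fixes U :: "'u::metric_space set"
  assumes U: "compact U" and "0 \<le> S" "0 \<le> T"
    and v: "is_family U S v" and w: "is_family U T w"
    and glue: "\<And>u. u \<in> U \<Longrightarrow> w u 0 = v u S"
  obtains z where "is_family U (S + T) z" and "\<And>u. u \<in> U \<Longrightarrow> z u 0 = v u 0"
    and "\<And>u. u \<in> U \<Longrightarrow> z u (S + T) = w u T"
proof -
  define z where "z u t = (if t \<le> S then v u t else w u (t - S))" for u t
  have zw: "z u t = w u (t - S)" if "u \<in> U" "S \<le> t" for u t
    using that glue[OF that(1)] by (auto simp: z_def)
  have "continuous_on (U \<times> {0..S} \<union> U \<times> {S..S + T}) (\<lambda>p. if snd p \<le> S then v (fst p) (snd p) else w (fst p) (snd p - S))"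
  proof (rule continuous_on_cases)
    show "closed (U \<times> {0..S})" "closed (U \<times> {S..S + T})"
      using U by (auto intro!: closed_Times intro: compact_imp_closed)
    show "continuous_on (U \<times> {0..S}) (\<lambda>p. v (fst p) (snd p))"
      using v by (simp add: is_family_def case_prod_beta)
    have "continuous_on (U \<times> {S..S + T}) ((\<lambda>(u, t). w u t) \<circ> (\<lambda>p. (fst p, snd p - S)))"
      using w unfolding is_family_def
      by (intro continuous_on_compose continuous_intros) (auto elim!: continuous_on_subset)
    then show "continuous_on (U \<times> {S..S + T}) (\<lambda>p. w (fst p) (snd p - S))"
      by (simp add: o_def)
  qed (use glue in auto)
  moreover have "U \<times> {0..S} \<union> U \<times> {S..S + T} = U \<times> {0..S + T}"
    using \<open>0 \<le> S\<close> \<open>0 \<le> T\<close> by auto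
  ultimately have zcont: "continuous_on (U \<times> {0..S + T}) (\<lambda>(u, t). z u t)"
    by (simp add: z_def case_prod_beta)
  have "is_family U (S + T) z"
    unfolding is_family_def
  proof (intro conjI ballI zcont)
    fix u t assume u: "u \<in> U" and t: "t \<in> {0..S + T}"
    show "z u t \<in> - diagonals"
      proof (cases "t \<le> S")
      case True
      then have "v u t \<in> - diagonals" using t by (intro is_family_slice(2)[OF v u]) auto
      then show ?thesis using True by (simp add: z_def)
    next
      case False
      then have "w u (t - S) \<in> - diagonals" using t by (intro is_family_slice(2)[OF w u]) auto
      then show ?thesis using False by (simp add: z_def)
    qed
    show "particles (z u t) = particles (z u 0) + integral {0..t} (\<lambda>s. drift (z u s))"
    proof (cases "t \<le> S")
      case True
      then have "integral {0..t} (\<lambda>s. drift (z u s)) = integral {0..t} (\<lambda>s. drift (v u s))"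
        by (intro integral_cong) (auto simp: z_def)
      then show ?thesis using is_family_eq[OF v u, of t] t True \<open>0 \<le> S\<close> by (simp add: z_def)
    next
      case False
      have i1: "(\<lambda>s. drift (z u s)) integrable_on {0..S}"
        by (rule integrable_eq[OF is_family_drift_integrable[OF v u, of 0 S]]) (auto simp: z_def)
      have "((\<lambda>s. drift (w u s)) has_integral integral {0..t - S} (\<lambda>s. drift (w u s))) {0..t - S}"
        using t by (intro integrable_integral is_family_drift_integrable[OF w u]) auto
      from has_integral_shift_real_ivl[OF this, of "- S"]
      have "((\<lambda>s. drift (w u (s - S))) has_integral integral {0..t - S} (\<lambda>s. drift (w u s))) {S..t}"
        by simp
      then have i2: "((\<lambda>s. drift (z u s)) has_integral integral {0..t - S} (\<lambda>s. drift (w u s))) {S..t}"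
        by (rule has_integral_eq[rotated]) (simp add: zw[OF u])
      have "((\<lambda>s. drift (z u s)) has_integral (integral {0..S} (\<lambda>s. drift (z u s))
          + integral {0..t - S} (\<lambda>s. drift (w u s)))) {0..t}"
        using False \<open>0 \<le> S\<close> by (intro has_integral_combine[OF _ _ integrable_integral[OF i1] i2]) auto
      then have "integral {0..t} (\<lambda>s. drift (z u s)) = integral {0..S} (\<lambda>s. drift (z u s))
          + integral {0..t - S} (\<lambda>s. drift (w u s))" by (rule integral_unique)
      also have "integral {0..S} (\<lambda>s. drift (z u s)) = integral {0..S} (\<lambda>s. drift (v u s))"
        by (intro integral_cong) (auto simp: z_def)
      also have "\<dots> = particles (v u S) - particles (v u 0)"
        using is_family_eq[OF v u, of S] \<open>0 \<le> S\<close> by simp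
      also have "integral {0..t - S} (\<lambda>s. drift (w u s)) = particles (w u (t - S)) - particles (w u 0)"
        using is_family_eq[OF w u, of "t - S"] t False by simp
      finally show ?thesis using False \<open>0 \<le> S\<close> glue[OF u] by (simp add: z_def)
    qed
  qed
  then show ?thesis
    by (rule that) (use \<open>0 \<le> S\<close> \<open>0 \<le> T\<close> in \<open>auto simp: z_def[of _ 0] zw\<close>)
qed

end

lemma norm_component_diff_le:
  fixes x y :: "('a::real_normed_vector)^'n"
  shows "norm (x $ i - y $ i) \<le> norm (x - y)"
  using Finite_Cartesian_Product.norm_nth_le[of "x - y" i] by simp

lemma norm_triangle_three:
  fixes a b c :: "'a::real_normed_vector"
  shows "norm (a - b + c) \<le> norm a + norm b + norm c"
  using norm_triangle_ineq[of "a - b" c] norm_triangle_ineq4[of a b] by linarith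

lemma norm_diff_le_sum_components:
  fixes x y :: "('a::real_normed_vector)^'n"
  assumes "\<And>i. norm (x $ i - y $ i) \<le> \<epsilon>"
  shows "norm (x - y) \<le> real CARD('n) * \<epsilon>"
proof -
  have "norm (x - y) \<le> (\<Sum>i\<in>(UNIV::'n set). \<epsilon>)"
    by (rule order_trans[OF norm_le_sum_components sum_mono]) (simp add: assms)
  then show ?thesis by simp
qed

lemma compact_thickening:
  fixes Q :: "'a::euclidean_space set"
  assumes "compact Q" "open S" "Q \<subseteq> S"
  obtains \<delta> Q' where "\<delta> > 0" "compact Q'" "Q' \<subseteq> S"
    and "\<And>w z. z \<in> Q \<Longrightarrow> norm (w - z) \<le> \<delta> \<Longrightarrow> w \<in> Q'"
proof -
  obtain \<delta> where \<delta>: "\<delta> > 0" "(\<Union>z\<in>Q. cball z \<delta>) \<subseteq> S"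
    using compact_subset_open_imp_cball_epsilon_subset[OF assms] by metis
  let ?Q' = "(\<lambda>(z, e). z + e) ` (Q \<times> cball 0 \<delta>)"
  show ?thesis
  proof (rule that[OF \<delta>(1)])
    show "compact ?Q'"
      unfolding case_prod_beta
      by (intro compact_continuous_image compact_Times assms(1) continuous_intros) auto
    show "?Q' \<subseteq> S"
    proof
      fix w assume "w \<in> ?Q'"
      then obtain z e where "z \<in> Q" "norm e \<le> \<delta>" "w = z + e" by auto
      then have "w \<in> (\<Union>z\<in>Q. cball z \<delta>)" by (auto simp: dist_norm intro!: bexI[of _ z])
      then show "w \<in> S" using \<delta>(2) by (rule subsetD[rotated])
    qed
    show "w \<in> ?Q'" if "z \<in> Q" "norm (w - z) \<le> \<delta>" for w z
      using that by (intro image_eqI[of _ _ "(z, w - z)"]) auto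
  qed
qed

context particle_system
begin

text \<open>
  Some family of motions starts at \<open>W u\<close> and ends, after time \<open>T\<close>, at a state related to \<open>u\<close> by \<open>R\<close>. Stages
  are composed through \<open>R\<close> alone: the next stage must start from every continuous choice of states
  that satisfy it.
\<close>

definition steers ::
  "'u::topological_space set \<Rightarrow> real \<Rightarrow> ('u \<Rightarrow> (real^'d)^('n option)) \<Rightarrow>
   ('u \<Rightarrow> (real^'d)^('n option) \<Rightarrow> bool) \<Rightarrow> bool" where
  "steers U T W R \<longleftrightarrow> (\<exists>w. is_family U T w \<and> (\<forall>u\<in>U. w u 0 = W u \<and> R u (w u T)))"

lemma steers_append:
  fixes U :: "'u::metric_space set"
  assumes U: "compact U" and "0 \<le> S" "0 \<le> T"
    and 1: "steers U S W R"
    and 2: "\<And>V. continuous_on U V \<Longrightarrow> (\<And>u. u \<in> U \<Longrightarrow> R u (V u)) \<Longrightarrow> steers U T V R'"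
  shows "steers U (S + T) W R'"
proof -
  obtain v where v: "is_family U S v" "\<And>u. u \<in> U \<Longrightarrow> v u 0 = W u" "\<And>u. u \<in> U \<Longrightarrow> R u (v u S)"
    using 1 unfolding steers_def by blast
  have "S \<in> {0..S}" using \<open>0 \<le> S\<close> by simp
  then have "steers U T (\<lambda>u. v u S) R'"
    by (intro 2 is_family_eval[OF v(1)] v(3))
  then obtain w where w: "is_family U T w" "\<And>u. u \<in> U \<Longrightarrow> w u 0 = v u S" "\<And>u. u \<in> U \<Longrightarrow> R' u (w u T)"
    unfolding steers_def by blast
  obtain z where "is_family U (S + T) z" "\<And>u. u \<in> U \<Longrightarrow> z u 0 = v u 0"
    "\<And>u. u \<in> U \<Longrightarrow> z u (S + T) = w u T"
    using is_family_append[OF U \<open>0 \<le> S\<close> \<open>0 \<le> T\<close> v(1) w(1,2)] by blast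
  with v(2) w(3) show ?thesis unfolding steers_def by metis
qed

lemma steers_mono:
  "steers U T W R \<Longrightarrow> (\<And>u z. u \<in> U \<Longrightarrow> R u z \<Longrightarrow> R' u z) \<Longrightarrow> steers U T W R'"
  unfolding steers_def by blast

section \<open>Moving the controlled particle between the others\<close>

text \<open>
  A journey of the controlled particle from \<open>P\<close> to \<open>P'\<close>. The allowance \<open>c u\<close> lets the last journey end at a
  target that depends on \<open>u\<close>.
\<close>

definition travels_in ::
  "real \<Rightarrow> (real^'d)^'n \<Rightarrow> real^'d \<Rightarrow> real^'d \<Rightarrow> real \<Rightarrow> real \<Rightarrow> bool" where
  "travels_in T m P P' \<epsilon>\<^sub>0 \<epsilon> \<longleftrightarrow>
    (\<forall>(U :: ((real^'d)^('n option)) set) W c. compact U \<longrightarrow> continuous_on U W \<longrightarrow> continuous_on U c \<longrightarrow>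
      (\<forall>u\<in>U. W u $ None = P \<and> (\<forall>j. norm (W u $ Some j - m $ j) \<le> \<epsilon>\<^sub>0) \<and> norm (c u) \<le> \<epsilon>\<^sub>0) \<longrightarrow>
      steers U T W (\<lambda>u z. z $ None = P' + c u \<and> (\<forall>j. norm (z $ Some j - W u $ Some j) \<le> \<epsilon>)))"

text \<open>
  The controlled particle can be moved along any path that avoids the other particles so fast that
  these hardly move.
\<close>

lemma travel_stage:
  fixes m :: "(real^'d)^'n" and q :: "real \<Rightarrow> real^'d"
  assumes m: "m \<in> - diagonals" and q: "continuous_on {0..1} q"
    and avoid: "\<And>t i. t \<in> {0..1} \<Longrightarrow> m $ i \<noteq> q t"
  obtains \<epsilon>\<^sub>0 where "\<epsilon>\<^sub>0 > 0"
    and "\<And>\<epsilon>. \<epsilon> > 0 \<Longrightarrow> \<exists>T\<^sub>0>0. \<forall>T. 0 < T \<and> T < T\<^sub>0 \<longrightarrow> travels_in T m (q 0) (q 1) \<epsilon>\<^sub>0 \<epsilon>"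
proof -
  define Q where "Q = (\<lambda>t. join m (q t)) ` {0..1}"
  have "compact Q" unfolding Q_def by (intro compact_continuous_image continuous_intros q) auto
  moreover have "Q \<subseteq> - diagonals"
    unfolding Q_def by (rule image_subsetI) (intro join_off_diagonals m avoid)
  ultimately obtain \<delta> Q' where \<delta>: "\<delta> > 0" and "compact Q'" and Q'_off: "Q' \<subseteq> - diagonals"
    and Q'I: "\<And>w z. z \<in> Q \<Longrightarrow> norm (w - z) \<le> \<delta> \<Longrightarrow> w \<in> Q'"
    using compact_thickening[OF _ open_off_diagonals] by metis
  have "bounded (drift ` Q')"
    by (intro compact_imp_bounded compact_continuous_image \<open>compact Q'\<close>
        continuous_on_subset[OF continuous_on_drift Q'_off])
  then obtain M where M: "M > 0" "\<And>w. w \<in> Q' \<Longrightarrow> norm (drift w) \<le> M"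
    by (auto simp: bounded_pos)
  define N where "N = real CARD('n)"
  have N: "N \<ge> 1" by (simp add: N_def Suc_le_eq)
  \<comment> \<open>\<open>N + 2\<close> errors of size \<open>\<epsilon>\<^sub>0\<close> add up: \<open>N\<close> initial positions, the motion of the particles, and \<open>c u\<close>.\<close>
  define \<epsilon>\<^sub>0 where "\<epsilon>\<^sub>0 = \<delta> / (N + 2)"
  have e0: "\<epsilon>\<^sub>0 > 0" "(N + 2) * \<epsilon>\<^sub>0 = \<delta>" using \<delta> N by (auto simp: \<epsilon>\<^sub>0_def)
  show ?thesis
  proof (rule that[OF e0(1)])
    fix \<epsilon> :: real assume "\<epsilon> > 0"
    define T\<^sub>0 where "T\<^sub>0 = min \<epsilon>\<^sub>0 \<epsilon> / (N * M)"
    have "T\<^sub>0 > 0" using e0 \<open>\<epsilon> > 0\<close> M N by (simp add: T\<^sub>0_def)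
    moreover have "steers U T W (\<lambda>u z. z $ None = q 1 + c u \<and> (\<forall>j. norm (z $ Some j - W u $ Some j) \<le> \<epsilon>))"
      if T: "0 < T" "T < T\<^sub>0" and U: "compact U" and W: "continuous_on U W" and c: "continuous_on U c"
        and near: "\<forall>u\<in>U. W u $ None = q 0 \<and> (\<forall>j. norm (W u $ Some j - m $ j) \<le> \<epsilon>\<^sub>0) \<and> norm (c u) \<le> \<epsilon>\<^sub>0"
      for T and U :: "((real^'d)^('n option)) set" and W c
    proof -
      define Y where "Y u t x = q (t / T) + (t / T) *\<^sub>R c u" for u t and x :: "(real^'d)^'n"
      have "T * (N * M) \<le> min \<epsilon>\<^sub>0 \<epsilon>"
        using T M N by (simp add: T\<^sub>0_def pos_less_divide_eq)
      then have TM: "T * (N * M) \<le> \<epsilon>\<^sub>0" "T * (N * M) \<le> \<epsilon>" by auto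
      have "T * M \<le> T * (N * M)" using N M T by simp
      with TM(2) have "T * M \<le> \<epsilon>" by linarith
      have inQ: "join x (Y u t x) \<in> Q'"
        if u: "u \<in> U" and t: "t \<in> {0..T}" and x: "norm (x - particles (W u)) \<le> \<epsilon>\<^sub>0" for u t x
      proof (rule Q'I)
        show "join m (q (t / T)) \<in> Q" using t T unfolding Q_def by (intro imageI) auto
        have "norm (particles (W u) - m) \<le> N * \<epsilon>\<^sub>0"
          unfolding N_def using near u by (intro norm_diff_le_sum_components) auto
        then have "norm (x - m) \<le> \<epsilon>\<^sub>0 + N * \<epsilon>\<^sub>0"
          using x norm_triangle_ineq[of "x - particles (W u)" "particles (W u) - m"] by simp
        moreover have "norm ((t / T) *\<^sub>R c u) \<le> 1 * \<epsilon>\<^sub>0"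
          using t T near u e0 unfolding norm_scaleR by (intro mult_mono) auto
        ultimately have "norm (x - m) + norm (Y u t x - q (t / T)) \<le> \<delta>"
          using e0(2) by (simp add: Y_def algebra_simps)
        then show "norm (join x (Y u t x) - join m (q (t / T))) \<le> \<delta>"
          unfolding join_diff by (rule order_trans[OF norm_join_le])
      qed
      show ?thesis
      proof (rule feedback_stage[where W = W and Y = Y and T = T and \<rho> = \<epsilon>\<^sub>0 and L = 0 and M = "\<lambda>_. M" and U = U])
        have "continuous_on (U \<times> {0..T} \<times> (UNIV::((real^'d)^'n) set)) (\<lambda>r. q (fst (snd r) / T))"
          using T by (intro continuous_on_compose2[OF q] continuous_intros) auto
        moreover have "continuous_on (U \<times> {0..T} \<times> (UNIV::((real^'d)^'n) set)) (\<lambda>r. c (fst r))"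
          by (intro continuous_on_compose2[OF c] continuous_intros) auto
        ultimately show "continuous_on (U \<times> {0..T} \<times> UNIV) (\<lambda>(u, t, x). Y u t x)"
          unfolding Y_def case_prod_beta using T by (intro continuous_intros) auto
        show "0-lipschitz_on UNIV (Y u t)" for u t
          unfolding Y_def by (rule lipschitz_on_constant)
        show "Y u 0 (particles (W u)) = W u $ None" if "u \<in> U" for u
          using near that by (simp add: Y_def)
        show "T * (\<Sum>j\<in>(UNIV::'n set). M) \<le> \<epsilon>\<^sub>0"
          using TM(1) by (simp add: N_def)
        fix u t x assume utx: "u \<in> U" "t \<in> {0..T}" "norm (x - particles (W u)) \<le> \<epsilon>\<^sub>0"
        show "join x (Y u t x) \<in> - diagonals" by (rule subsetD[OF Q'_off inQ[OF utx]])
        show "norm (drift (join x (Y u t x)) $ j) \<le> M" for j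
          by (rule order_trans[OF Finite_Cartesian_Product.norm_nth_le M(2)[OF inQ[OF utx]]])
      next
        fix w assume w: "is_family U T w" "\<And>u. u \<in> U \<Longrightarrow> w u 0 = W u"
          "\<And>u t. u \<in> U \<Longrightarrow> t \<in> {0..T} \<Longrightarrow> w u t $ None = Y u t (particles (w u t))"
          "\<And>u t j. u \<in> U \<Longrightarrow> t \<in> {0..T} \<Longrightarrow> norm (w u t $ Some j - W u $ Some j) \<le> T * M"
        have "w u T $ None = q 1 + c u" if "u \<in> U" for u
          using w(3)[OF that, of T] T by (simp add: Y_def)
        moreover have "norm (w u T $ Some j - W u $ Some j) \<le> \<epsilon>" if "u \<in> U" for u j
          using w(4)[OF that, of T j] T \<open>T * M \<le> \<epsilon>\<close> by simp
        ultimately show ?thesis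
          unfolding steers_def using w(1,2) by (intro exI[of _ w]) blast
      qed (use U W T e0 in auto)
    qed
    ultimately show "\<exists>T\<^sub>0>0. \<forall>T. 0 < T \<and> T < T\<^sub>0 \<longrightarrow> travels_in T m (q 0) (q 1) \<epsilon>\<^sub>0 \<epsilon>"
      unfolding travels_in_def by blast
  qed
qed

end

section \<open>Pushing one particle\<close>

text \<open>
  The solution \<open>z\<close> of \<open>z /\<^sub>R norm z powr q = v\<close>. It tends to \<open>0\<close> as \<open>v\<close> tends to infinity.
\<close>

definition offset :: "real \<Rightarrow> 'a::euclidean_space \<Rightarrow> 'a" where
  "offset q v = norm v powr (- q / (q - 1)) *\<^sub>R v"

lemma norm_offset:
  assumes "q > 1" "v \<noteq> 0"
  shows "norm (offset q v) = norm v powr (- 1 / (q - 1))"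
proof -
  have "norm (offset q v) = norm v powr (- q / (q - 1)) * norm v powr 1"
    using assms by (simp add: offset_def)
  also have "\<dots> = norm v powr (- q / (q - 1) + 1)" by (rule powr_add[symmetric])
  also have "- q / (q - 1) + 1 = - 1 / (q - 1)" using assms by (simp add: field_simps)
  finally show ?thesis .
qed

lemma offset_nonzero: "v \<noteq> 0 \<Longrightarrow> offset q v \<noteq> 0"
  by (simp add: offset_def)

lemma continuous_on_offset:
  assumes "continuous_on S g" "\<And>s. s \<in> S \<Longrightarrow> g s \<noteq> 0"
  shows "continuous_on S (\<lambda>s. offset q (g s))"
  unfolding offset_def using assms by (intro continuous_intros) auto

lemma norm_offset_le:
  assumes "q > 1" "0 < a" "a \<le> norm v"
  shows "norm (offset q v) \<le> a powr (- 1 / (q - 1))"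
proof -
  have "v \<noteq> 0" using assms by auto
  then show ?thesis
    using assms norm_offset[of q v] powr_mono2'[of "- 1 / (q - 1)" a "norm v"]
    by (simp add: divide_nonpos_pos)
qed

context particle_system
begin

text \<open>
  At the offset of \<open>v\<close> the force on the particle is \<open>f i 0 *\<^sub>R (A i *v v)\<close> up to a factor that tends to \<open>1\<close> as
  the offset tends to \<open>0\<close>.
\<close>

lemma K_offset:
  assumes "v \<noteq> 0"
  shows "K i (offset (p i) v) = f i (norm (offset (p i) v)) *\<^sub>R (A i *v v)"
proof -
  have "norm (offset (p i) v) powr p i = norm v powr (- p i / (p i - 1))"
    using norm_offset[OF p_gt_1 assms, of i] by (simp add: powr_powr)
  moreover have "A i *v offset (p i) v = norm v powr (- p i / (p i - 1)) *\<^sub>R (A i *v v)"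
    by (simp add: offset_def matrix_vector_mult_scaleR)
  moreover have "norm v powr (- p i / (p i - 1)) \<noteq> 0" using assms by simp
  ultimately show ?thesis
    using K_eq[OF offset_nonzero[OF assms], of i "p i"] by simp
qed

text \<open>
  When the controlled particle is close to particle \<open>i\<close>, the term with \<open>K i\<close> is the only unbounded one.
  The bound \<open>M\<close> is independent of how close they are, hence of the speed of the push.
\<close>

lemma bounds_near_particle:
  fixes m :: "(real^'d)^'n"
  assumes "\<eta> > 0" and sep: "\<And>k l. k \<noteq> l \<Longrightarrow> 4 * \<eta> \<le> norm (m $ k - m $ l)"
  obtains M where "M > 0"
    and "\<And>x y. norm (x - m) \<le> \<eta> \<Longrightarrow> norm (y - m $ i) \<le> 2 * \<eta> \<Longrightarrow> y \<noteq> x $ i \<Longrightarrow> join x y \<in> - diagonals"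
    and "\<And>x y j. norm (x - m) \<le> \<eta> \<Longrightarrow> norm (y - m $ i) \<le> 2 * \<eta> \<Longrightarrow> y \<noteq> x $ i \<Longrightarrow>
      norm (drift (join x y) $ j - (if j = i then K i (x $ i - y) else 0)) \<le> M"
proof -
  have xsep: "2 * \<eta> \<le> norm (x $ k - x $ l)" if "norm (x - m) \<le> \<eta>" "k \<noteq> l" for x k l
  proof -
    have "norm (m $ k - m $ l) \<le> norm (x $ k - x $ l) + norm (x $ k - m $ k) + norm (x $ l - m $ l)"
      using norm_triangle_three[of "x $ k - x $ l" "x $ k - m $ k" "x $ l - m $ l"] by simp
    then show ?thesis
      using sep[OF that(2)] norm_component_diff_le[of x k m] norm_component_diff_le[of x l m] that(1) by linarith
  qed
  have x_off: "x \<in> - diagonals" if "norm (x - m) \<le> \<eta>" for x :: "(real^'d)^'n"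
    using xsep[OF that] \<open>\<eta> > 0\<close> by (intro off_diagonalsI) force
  have ysep: "\<eta> \<le> norm (x $ j - y)" if "norm (x - m) \<le> \<eta>" "norm (y - m $ i) \<le> 2 * \<eta>" "j \<noteq> i" for x y j
  proof -
    have "norm (m $ j - m $ i) \<le> norm (x $ j - y) + norm (x $ j - m $ j) + norm (y - m $ i)"
      using norm_triangle_three[of "x $ j - y" "x $ j - m $ j" "y - m $ i"] by simp
    then show ?thesis
      using sep[OF that(3)] norm_component_diff_le[of x j m] that by linarith
  qed
  have off: "join x y \<in> - diagonals" if "norm (x - m) \<le> \<eta>" "norm (y - m $ i) \<le> 2 * \<eta>" "y \<noteq> x $ i" for x y
  proof (rule join_off_diagonals[OF x_off[OF that(1)]])
    show "x $ j \<noteq> y" for j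
      using ysep[OF that(1,2), of j] that(3) \<open>\<eta> > 0\<close> by (cases "j = i") auto
  qed
  have lip_bd: "\<exists>C\<ge>0. \<forall>z\<in>Z. norm (g z) \<le> C"
    if lip: "locally_lipschitz_on S g" and Z: "compact Z" "Z \<subseteq> S"
    for Z S and g :: "'c::metric_space \<Rightarrow> real^'d"
  proof -
    obtain L where "L-lipschitz_on Z g" using locally_lipschitz_on_compact[OF lip Z] by blast
    then have "bounded (g ` Z)"
      using Z(1) by (intro compact_imp_bounded compact_continuous_image lipschitz_on_continuous_on)
    then show ?thesis unfolding bounded_pos by (auto intro: less_imp_le)
  qed
  have "\<exists>C\<ge>0. \<forall>x\<in>cball m \<eta>. norm (Ft j x) \<le> C" for j
    using x_off by (intro lip_bd[OF Ft_lip] subsetI) (auto simp: dist_norm norm_minus_commute)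
  then obtain C1 where C1: "\<And>j. C1 j \<ge> 0" "\<And>j x. x \<in> cball m \<eta> \<Longrightarrow> norm (Ft j x) \<le> C1 j" by metis
  let ?Z = "(\<lambda>(x, y). join x y) ` (cball m \<eta> \<times> cball (m $ i) (2 * \<eta>))"
  have "compact ?Z"
    unfolding case_prod_beta by (intro compact_continuous_image compact_Times continuous_intros) auto
  then have "\<exists>C\<ge>0. \<forall>w\<in>?Z. norm (Fh j w) \<le> C" for j
    by (intro lip_bd[OF Fh_lip]) auto
  then obtain C2 where C2: "\<And>j. C2 j \<ge> 0" "\<And>j w. w \<in> ?Z \<Longrightarrow> norm (Fh j w) \<le> C2 j" by metis
  have "\<exists>C\<ge>0. \<forall>z\<in>cball 0 (3 * \<eta> + norm (m $ j - m $ i)) - ball 0 \<eta>. norm (K j z) \<le> C" for j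
  proof -
    have "compact (cball 0 (3 * \<eta> + norm (m $ j - m $ i)) - ball (0 :: real^'d) \<eta>)"
      by (intro compact_diff) auto
    then have "bounded (K j ` (cball 0 (3 * \<eta> + norm (m $ j - m $ i)) - ball 0 \<eta>))"
      using \<open>\<eta> > 0\<close> by (intro compact_imp_bounded compact_continuous_image continuous_on_subset[OF K_cont]) auto
    then show ?thesis unfolding bounded_pos by (auto intro: less_imp_le)
  qed
  then obtain C3 where C3: "\<And>j. C3 j \<ge> 0"
    "\<And>j z. z \<in> cball 0 (3 * \<eta> + norm (m $ j - m $ i)) - ball 0 \<eta> \<Longrightarrow> norm (K j z) \<le> C3 j" by metis
  define M where "M = 1 + (\<Sum>j\<in>UNIV. C1 j + C2 j + C3 j)"
  have "C1 j + C2 j + C3 j \<le> (\<Sum>j\<in>UNIV. C1 j + C2 j + C3 j)" for j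
    using C1(1) C2(1) C3(1) by (intro member_le_sum) auto
  then have Mj: "C1 j + C2 j + C3 j \<le> M" for j by (simp add: M_def add_increasing)
  show ?thesis
  proof (rule that[of M])
    show "M > 0" using C1(1) C2(1) C3(1) by (simp add: M_def add_pos_nonneg sum_nonneg)
    fix x y assume xy: "norm (x - m) \<le> \<eta>" "norm (y - m $ i) \<le> 2 * \<eta>" "y \<noteq> x $ i"
    show "join x y \<in> - diagonals" by (rule off[OF xy])
    fix j
    have "F (Some j) (join x y) = Ft j x + Fh j (join x y)"
      using F_split[OF off[OF xy], of j] by simp
    moreover have "norm (Ft j x) \<le> C1 j"
      using xy by (intro C1) (auto simp: dist_norm norm_minus_commute)
    moreover have "norm (Fh j (join x y)) \<le> C2 j"
      using xy by (intro C2 image_eqI[of _ _ "(x, y)"]) (auto simp: dist_norm norm_minus_commute)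
    moreover have "norm (K j (x $ j - y)) \<le> C3 j" if "j \<noteq> i"
    proof (rule C3)
      have "norm (x $ j - y) \<le> norm (x $ j - m $ j) + norm (y - m $ i) + norm (m $ j - m $ i)"
        using norm_triangle_three[of "x $ j - m $ j" "y - m $ i" "m $ j - m $ i"] by simp
      then show "x $ j - y \<in> cball 0 (3 * \<eta> + norm (m $ j - m $ i)) - ball 0 \<eta>"
        using norm_component_diff_le[of x j m] xy ysep[OF xy(1,2) that] by auto
    qed
    ultimately have "norm (drift (join x y) $ j - (if j = i then K i (x $ i - y) else 0)) \<le> C1 j + C2 j + C3 j"
      using C3(1)[of j] norm_triangle_ineq[of "K j (x $ j - y)" "F (Some j) (join x y)"]
        norm_triangle_ineq[of "Ft j x" "Fh j (join x y)"]
      by (auto simp: drift_nth)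
    then show "norm (drift (join x y) $ j - (if j = i then K i (x $ i - y) else 0)) \<le> M"
      using Mj[of j] by linarith
  qed
qed

end

lemma orthonormal_pair:
  assumes "CARD('d) \<ge> 2"
  obtains e e' :: "real^'d" where "norm e = 1" "norm e' = 1" "e \<bullet> e' = 0"
proof -
  have "\<exists>i j :: 'd. i \<noteq> j"
  proof (rule ccontr)
    assume "\<not> ?thesis"
    then have "(UNIV :: 'd set) \<subseteq> {SOME i. True}" by auto
    then have "CARD('d) \<le> 1" using card_mono[of "{SOME i. True}" "UNIV :: 'd set"] by simp
    then show False using assms by simp
  qed
  then obtain i j :: 'd where "i \<noteq> j" by blast
  then show ?thesis by (intro that[of "axis i 1" "axis j 1"]) (auto simp: inner_axis_axis)
qed

text \<open>
  As \<open>g\<close> and the offset both lie on the positive side of the axis \<open>e\<close>, the segment between them stays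
  away from \<open>0\<close>. So the force during the approach is at most a constant times the force of the push.
\<close>

lemma norm_approach_ge:
  fixes e g v :: "'a::euclidean_space"
  assumes "norm e = 1" "q > 1" and v: "v \<noteq> 0" "norm v \<le> 3 * (v \<bullet> e)"
    and g: "norm (offset q v) \<le> g \<bullet> e" and t: "0 \<le> t" "t \<le> 1"
  shows "norm (offset q v) / 3 \<le> norm ((1 - t) *\<^sub>R g + t *\<^sub>R offset q v)"
proof -
  let ?z = "offset q v"
  have "norm ?z = norm v powr (- q / (q - 1)) * norm v" by (simp add: offset_def)
  also have "\<dots> \<le> norm v powr (- q / (q - 1)) * (3 * (v \<bullet> e))"
    using v(2) by (intro mult_left_mono) auto
  also have "\<dots> = 3 * (?z \<bullet> e)" by (simp add: offset_def)
  finally have z: "norm ?z / 3 \<le> ?z \<bullet> e" by simp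
  have "norm ?z / 3 = (1 - t) * (norm ?z / 3) + t * (norm ?z / 3)" by (simp flip: distrib_right)
  also have "\<dots> \<le> (1 - t) * (g \<bullet> e) + t * (?z \<bullet> e)"
  proof (intro add_mono mult_left_mono z)
    show "norm ?z / 3 \<le> g \<bullet> e" using g norm_ge_zero[of ?z] by linarith
  qed (use t in auto)
  also have "\<dots> = ((1 - t) *\<^sub>R g + t *\<^sub>R ?z) \<bullet> e" by (simp add: inner_add_left)
  also have "\<dots> \<le> norm ((1 - t) *\<^sub>R g + t *\<^sub>R ?z)"
    using norm_cauchy_schwarz[of _ e] assms(1) by (metis mult.right_neutral)
  finally show ?thesis .
qed

context particle_system
begin

lemma norm_K_approach_le:
  assumes "v \<noteq> 0" and q: "norm (offset (p i) v) / 3 \<le> norm q"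
    and B: "\<And>t. 0 \<le> t \<Longrightarrow> \<bar>f i t\<bar> \<le> B" and a: "0 \<le> a" "\<And>z. norm (A i *v z) \<le> a * norm z"
  shows "norm (K i q) \<le> B * a * 3 powr (p i - 1) * norm v"
proof -
  let ?z = "offset (p i) v"
  have z: "norm ?z > 0" using offset_nonzero[OF assms(1)] by simp
  then have q0: "norm q > 0" using q by linarith
  have "B \<ge> 0" using B[of 0] by linarith
  have "norm (K i q) = \<bar>f i (norm q)\<bar> * (norm (A i *v q) * norm q powr - p i)"
    using q0 by (subst K_eq) (auto simp: powr_minus abs_mult)
  also have "\<dots> \<le> B * (a * norm q * norm q powr - p i)"
    using B[of "norm q"] a(2)[of q] \<open>B \<ge> 0\<close> by (intro mult_mono mult_right_mono) auto
  also have "norm q * norm q powr - p i = norm q powr (1 - p i)"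
    using q0 powr_add[of "norm q" 1 "- p i"] by simp
  then have "a * norm q * norm q powr - p i = a * norm q powr (1 - p i)" by simp
  also have "B * (a * norm q powr (1 - p i)) \<le> B * (a * (norm ?z / 3) powr (1 - p i))"
    using p_gt_1[of i] z q \<open>B \<ge> 0\<close> a(1) by (intro mult_left_mono powr_mono2') auto
  also have "(norm ?z / 3) powr (1 - p i) = norm ?z powr (1 - p i) * 3 powr (p i - 1)"
    by (simp add: powr_divide powr_diff field_simps)
  also have "norm ?z powr (1 - p i) = norm v"
  proof -
    have "norm ?z powr (1 - p i) = norm v powr ((- 1 / (p i - 1)) * (1 - p i))"
      using norm_offset[OF p_gt_1 assms(1), of i] by (simp add: powr_powr)
    also have "(- 1 / (p i - 1)) * (1 - p i) = 1" using p_gt_1[of i] by (simp add: field_simps)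
    finally show ?thesis by simp
  qed
  finally show ?thesis by (simp add: mult_ac)
qed

text \<open>
  The feedback law \<open>y = \<theta> t *\<^sub>R (x $ i - offset (p i) (V u t)) + (1 - \<theta> t) *\<^sub>R P\<close> covers the approach,
  the push and the departure: only \<open>\<theta>\<close> and \<open>V\<close> differ. The condition involving \<open>e\<close> is what keeps a partial
  approach, where \<open>\<theta> t < 1\<close>, away from particle \<open>i\<close>.
\<close>

lemma near_stage:
  fixes m :: "(real^'d)^'n" and e :: "real^'d" and U :: "'u::metric_space set"
    and W :: "'u \<Rightarrow> (real^'d)^('n option)"
  assumes e: "norm e = 1" and "\<eta> > 0"
    and M: "\<And>x y. norm (x - m) \<le> \<eta> \<Longrightarrow> norm (y - m $ i) \<le> 2 * \<eta> \<Longrightarrow> y \<noteq> x $ i \<Longrightarrow> join x y \<in> - diagonals"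
      "\<And>x y j. norm (x - m) \<le> \<eta> \<Longrightarrow> norm (y - m $ i) \<le> 2 * \<eta> \<Longrightarrow> y \<noteq> x $ i \<Longrightarrow>
        norm (drift (join x y) $ j - (if j = i then K i (x $ i - y) else 0)) \<le> M"
    and B: "\<And>t. 0 \<le> t \<Longrightarrow> \<bar>f i t\<bar> \<le> B" and a: "0 \<le> a" "\<And>z. norm (A i *v z) \<le> a * norm z"
    and U: "compact U" and W: "continuous_on U W" and T: "0 \<le> T"
    and V: "continuous_on (U \<times> {0..T}) (\<lambda>(u, t). V u t)"
    and V_bd: "\<And>u t. u \<in> U \<Longrightarrow> t \<in> {0..T} \<Longrightarrow> V u t \<noteq> 0 \<and> norm (V u t) \<le> b \<and> norm (offset (p i) (V u t)) \<le> \<eta>"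
    and \<theta>: "continuous_on {0..T} \<theta>" "\<And>t. t \<in> {0..T} \<Longrightarrow> 0 \<le> \<theta> t \<and> \<theta> t \<le> 1"
    and dir: "\<And>u t. u \<in> U \<Longrightarrow> t \<in> {0..T} \<Longrightarrow> \<theta> t = 1 \<or> norm (V u t) \<le> 3 * (V u t \<bullet> e)"
    and start: "\<And>u. u \<in> U \<Longrightarrow> W u $ None = \<theta> 0 *\<^sub>R (W u $ Some i - offset (p i) (V u 0)) + (1 - \<theta> 0) *\<^sub>R (m $ i - (2 * \<eta>) *\<^sub>R e)"
    and \<rho>: "0 \<le> \<rho>" "\<And>u. u \<in> U \<Longrightarrow> norm (particles (W u) - m) + \<rho> \<le> \<eta>"
      "T * (B * a * 3 powr (p i - 1) * b + real CARD('n) * M) \<le> \<rho>"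
  obtains w where "is_family U T w" and "\<And>u. u \<in> U \<Longrightarrow> w u 0 = W u"
    and "\<And>u t. u \<in> U \<Longrightarrow> t \<in> {0..T} \<Longrightarrow> norm (particles (w u t) - particles (W u)) \<le> \<rho>"
    and "\<And>u t. u \<in> U \<Longrightarrow> t \<in> {0..T} \<Longrightarrow>
      w u t $ None = \<theta> t *\<^sub>R (w u t $ Some i - offset (p i) (V u t)) + (1 - \<theta> t) *\<^sub>R (m $ i - (2 * \<eta>) *\<^sub>R e)"
    and "\<And>u t j. u \<in> U \<Longrightarrow> t \<in> {0..T} \<Longrightarrow> norm (w u t $ Some j - W u $ Some j)
      \<le> T * ((if j = i then B * a * 3 powr (p i - 1) * b else 0) + M)"
proof -
  define P where "P = m $ i - (2 * \<eta>) *\<^sub>R e"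
  define C where "C = B * a * 3 powr (p i - 1) * b"
  define Y where "Y u t x = \<theta> t *\<^sub>R (x $ i - offset (p i) (V u t)) + (1 - \<theta> t) *\<^sub>R P" for u t and x :: "(real^'d)^'n"
  have "B \<ge> 0" using B[of 0] by linarith
  have geo: "Y u t x \<noteq> x $ i \<and> norm (Y u t x - m $ i) \<le> 2 * \<eta> \<and> norm (K i (x $ i - Y u t x)) \<le> C"
    if u: "u \<in> U" and t: "t \<in> {0..T}" and x: "norm (x - m) \<le> \<eta>" for u t x
  proof -
    let ?z = "offset (p i) (V u t)"
    have z: "norm ?z > 0" "norm ?z \<le> \<eta>" "V u t \<noteq> 0" "norm (V u t) \<le> b"
      using V_bd[OF u t] offset_nonzero[of "V u t"] by auto
    have th: "0 \<le> \<theta> t" "\<theta> t \<le> 1" using \<theta>(2)[OF t] by auto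
    have xi: "norm (x $ i - m $ i) \<le> \<eta>" using norm_component_diff_le[of x i m] x by linarith
    have diff: "x $ i - Y u t x = (1 - \<theta> t) *\<^sub>R (x $ i - P) + \<theta> t *\<^sub>R ?z"
      by (simp add: Y_def algebra_simps)
    have "norm ?z / 3 \<le> norm (x $ i - Y u t x)"
    proof (cases "\<theta> t = 1")
      case True
      then show ?thesis using diff z(1) by simp
    next
      case False
      have "\<bar>(x $ i - m $ i) \<bullet> e\<bar> \<le> \<eta>"
        using Cauchy_Schwarz_ineq2[of "x $ i - m $ i" e] xi e by simp
      moreover have "(x $ i - P) \<bullet> e = (x $ i - m $ i) \<bullet> e + 2 * \<eta>"
        using e by (simp add: P_def inner_add_left inner_diff_left dot_square_norm)
      ultimately have "norm ?z \<le> (x $ i - P) \<bullet> e" using z(2) by linarith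
      then show ?thesis
        unfolding diff using dir[OF u t] False by (intro norm_approach_ge[OF e p_gt_1] z(3) th) auto
    qed
    then have 1: "norm (K i (x $ i - Y u t x)) \<le> B * a * 3 powr (p i - 1) * norm (V u t)"
      and 2: "Y u t x \<noteq> x $ i"
      using norm_K_approach_le[OF z(3) _ B a] z(1) by auto
    have "B * a * 3 powr (p i - 1) * norm (V u t) \<le> C"
      unfolding C_def using z(4) \<open>B \<ge> 0\<close> a(1) by (intro mult_left_mono) auto
    with 1 have 3: "norm (K i (x $ i - Y u t x)) \<le> C" by linarith
    have "Y u t x - m $ i = \<theta> t *\<^sub>R ((x $ i - m $ i) - ?z) + (1 - \<theta> t) *\<^sub>R (- ((2 * \<eta>) *\<^sub>R e))"
      by (simp add: Y_def P_def algebra_simps)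
    also have "norm \<dots> \<le> \<theta> t * norm ((x $ i - m $ i) - ?z) + (1 - \<theta> t) * (2 * \<eta>)"
      using th e \<open>\<eta> > 0\<close> by (intro order_trans[OF norm_triangle_ineq]) simp
    also have "\<dots> \<le> \<theta> t * (2 * \<eta>) + (1 - \<theta> t) * (2 * \<eta>)"
      using norm_triangle_ineq4[of "x $ i - m $ i" ?z] xi z(2) th by (intro add_mono mult_left_mono) auto
    finally have "norm (Y u t x - m $ i) \<le> 2 * \<eta>" by (simp add: algebra_simps)
    with 2 3 show ?thesis by blast
  qed
  have tube: "norm (x - m) \<le> \<eta>" if "u \<in> U" "norm (x - particles (W u)) \<le> \<rho>" for u x
    using \<rho>(2)[OF that(1)] that(2) norm_triangle_ineq[of "x - particles (W u)" "particles (W u) - m"] by simp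
  show ?thesis
  proof (rule feedback_stage[where W = W and Y = Y and T = T and \<rho> = \<rho> and L = 1 and U = U
        and M = "\<lambda>j. (if j = i then C else 0) + M"])
    let ?S = "U \<times> {0..T} \<times> (UNIV::((real^'d)^'n) set)"
    have "continuous_on (U \<times> {0..T}) (\<lambda>(u, t). offset (p i) (V u t))"
      using V V_bd unfolding case_prod_beta by (intro continuous_on_offset) auto
    then have "continuous_on ?S ((\<lambda>(u, t). offset (p i) (V u t)) \<circ> (\<lambda>r. (fst r, fst (snd r))))"
      by (intro continuous_on_compose continuous_intros) (auto elim!: continuous_on_subset)
    then have 1: "continuous_on ?S (\<lambda>r. offset (p i) (V (fst r) (fst (snd r))))"
      by (simp add: o_def)
    have 2: "continuous_on ?S (\<lambda>r. \<theta> (fst (snd r)))"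
      by (intro continuous_on_compose2[OF \<theta>(1)] continuous_intros) auto
    show "continuous_on ?S (\<lambda>(u, t, x). Y u t x)"
      unfolding Y_def case_prod_beta by (intro continuous_intros 1 2)
    show "1-lipschitz_on UNIV (Y u t)" if "u \<in> U" "t \<in> {0..T}" for u t
    proof (rule lipschitz_onI)
      fix x y
      have "norm (Y u t x - Y u t y) = \<theta> t * norm (x $ i - y $ i)"
        using \<theta>(2)[OF that(2)] by (simp add: Y_def flip: scaleR_diff_right)
      also have "\<dots> \<le> 1 * norm (x - y)"
        using \<theta>(2)[OF that(2)] norm_component_diff_le[of x i y] by (intro mult_mono) auto
      finally show "dist (Y u t x) (Y u t y) \<le> 1 * dist x y" by (simp add: dist_norm)
    qed simp
    show "Y u 0 (particles (W u)) = W u $ None" if "u \<in> U" for u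
      using start[OF that] by (simp add: Y_def P_def)
    show "T * (\<Sum>j\<in>UNIV. (if j = i then C else 0) + M) \<le> \<rho>"
      using \<rho>(3) by (simp add: C_def sum.distrib)
    fix u t x assume utx: "u \<in> U" "t \<in> {0..T}" "norm (x - particles (W u)) \<le> \<rho>"
    note g = geo[OF utx(1,2) tube[OF utx(1,3)]]
    show "join x (Y u t x) \<in> - diagonals"
      using g by (intro M(1)[OF tube[OF utx(1,3)]]) auto
    show "norm (drift (join x (Y u t x)) $ j) \<le> (if j = i then C else 0) + M" for j
    proof -
      have "norm (drift (join x (Y u t x)) $ j - (if j = i then K i (x $ i - Y u t x) else 0)) \<le> M"
        using g by (intro M(2)[OF tube[OF utx(1,3)]]) auto
      moreover have "norm (if j = i then K i (x $ i - Y u t x) else 0) \<le> (if j = i then C else 0)"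
        using g by auto
      ultimately show ?thesis
        using norm_triangle_ineq2[of "drift (join x (Y u t x)) $ j" "if j = i then K i (x $ i - Y u t x) else 0"]
        by linarith
    qed
  next
    fix w assume w: "is_family U T w" "\<And>u. u \<in> U \<Longrightarrow> w u 0 = W u"
      "\<And>u t. u \<in> U \<Longrightarrow> t \<in> {0..T} \<Longrightarrow> norm (particles (w u t) - particles (W u)) \<le> \<rho>"
      "\<And>u t. u \<in> U \<Longrightarrow> t \<in> {0..T} \<Longrightarrow> w u t $ None = Y u t (particles (w u t))"
      "\<And>u t j. u \<in> U \<Longrightarrow> t \<in> {0..T} \<Longrightarrow> norm (w u t $ Some j - W u $ Some j) \<le> T * ((if j = i then C else 0) + M)"
    show ?thesis
    proof (rule that[OF w(1,2,3)])
      fix u t assume ut: "u \<in> U" "t \<in> {0..T}"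
      show "w u t $ None = \<theta> t *\<^sub>R (w u t $ Some i - offset (p i) (V u t)) + (1 - \<theta> t) *\<^sub>R (m $ i - (2 * \<eta>) *\<^sub>R e)"
        using w(4)[OF ut] by (simp add: Y_def P_def)
      show "norm (w u t $ Some j - W u $ Some j) \<le> T * ((if j = i then B * a * 3 powr (p i - 1) * b else 0) + M)" for j
        using w(5)[OF ut, of j] by (simp only: C_def)
    qed
  qed (use U W T \<rho> in auto)
qed

end

text \<open>
  A loop with mean \<open>v\<close>. If \<open>v\<close> is at most half the radius, it avoids \<open>0\<close>, also when \<open>v = 0\<close>. So the
  offset along it depends continuously on \<open>v\<close> in a whole ball, which the offset of \<open>v\<close> itself does not.
\<close>

definition shifted_circle :: "'a::euclidean_space \<Rightarrow> 'a \<Rightarrow> real \<Rightarrow> 'a \<Rightarrow> real \<Rightarrow> 'a" where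
  "shifted_circle e e' \<omega> v s = v + \<omega> *\<^sub>R (cos (2 * pi * s) *\<^sub>R e + sin (2 * pi * s) *\<^sub>R e')"

lemma norm_shifted_circle:
  assumes "norm e = 1" "norm e' = 1" "e \<bullet> e' = 0" and "0 < \<omega>" "norm v \<le> \<omega> / 2"
  shows "\<omega> / 2 \<le> norm (shifted_circle e e' \<omega> v s)" "norm (shifted_circle e e' \<omega> v s) \<le> 3 * \<omega> / 2"
proof -
  let ?c = "cos (2 * pi * s) *\<^sub>R e + sin (2 * pi * s) *\<^sub>R e'"
  have "(norm ?c)\<^sup>2 = ?c \<bullet> ?c" by (rule power2_norm_eq_inner)
  also have "\<dots> = (cos (2 * pi * s))\<^sup>2 + (sin (2 * pi * s))\<^sup>2"
    using assms(1-3)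
    by (simp add: norm_eq_1 inner_add_left inner_add_right inner_commute flip: power2_eq_square)
  finally have "(norm ?c)\<^sup>2 = 1" by simp
  then have "norm ?c = 1"
    unfolding power2_eq_1_iff using norm_ge_zero[of ?c] by linarith
  then have "norm (\<omega> *\<^sub>R ?c) = \<omega>" using assms(4) by simp
  then show "\<omega> / 2 \<le> norm (shifted_circle e e' \<omega> v s)" "norm (shifted_circle e e' \<omega> v s) \<le> 3 * \<omega> / 2"
    using assms(5) norm_triangle_ineq[of v "\<omega> *\<^sub>R ?c"] norm_triangle_ineq4[of "v + \<omega> *\<^sub>R ?c" v]
    unfolding shifted_circle_def by auto
qed

lemma has_integral_shifted_circle:
  assumes "0 < \<tau>"
  shows "((\<lambda>t. (1 / \<tau>) *\<^sub>R shifted_circle e e' \<omega> v (t / \<tau>)) has_integral v) {0..\<tau>}"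
proof -
  let ?\<Psi> = "\<lambda>t. (t / \<tau>) *\<^sub>R v + (\<omega> / (2 * pi)) *\<^sub>R (sin (2 * pi * (t / \<tau>)) *\<^sub>R e - cos (2 * pi * (t / \<tau>)) *\<^sub>R e')"
  have "((\<lambda>t. (1 / \<tau>) *\<^sub>R shifted_circle e e' \<omega> v (t / \<tau>)) has_integral ?\<Psi> \<tau> - ?\<Psi> 0) {0..\<tau>}"
  proof (rule fundamental_theorem_of_calculus)
    show "0 \<le> \<tau>" using assms by simp
    fix t assume "t \<in> {0..\<tau>}"
    have "\<tau> \<noteq> 0" using assms by simp
    then have "((\<lambda>t. sin (2 * pi * (t / \<tau>))) has_real_derivative cos (2 * pi * (t / \<tau>)) * (2 * pi / \<tau>)) (at t within {0..\<tau>})"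
      and "((\<lambda>t. cos (2 * pi * (t / \<tau>))) has_real_derivative - sin (2 * pi * (t / \<tau>)) * (2 * pi / \<tau>)) (at t within {0..\<tau>})"
      and "((\<lambda>t. t / \<tau>) has_real_derivative 1 / \<tau>) (at t within {0..\<tau>})"
      by (auto intro!: derivative_eq_intros)
    then have "(?\<Psi> has_vector_derivative (1 / \<tau>) *\<^sub>R v + (\<omega> / (2 * pi)) *\<^sub>R
        ((cos (2 * pi * (t / \<tau>)) * (2 * pi / \<tau>)) *\<^sub>R e - (- sin (2 * pi * (t / \<tau>)) * (2 * pi / \<tau>)) *\<^sub>R e')) (at t within {0..\<tau>})"
      using \<open>\<tau> \<noteq> 0\<close> by (auto intro!: derivative_eq_intros)
    moreover have "(1 / \<tau>) *\<^sub>R v + (\<omega> / (2 * pi)) *\<^sub>R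
        ((cos (2 * pi * (t / \<tau>)) * (2 * pi / \<tau>)) *\<^sub>R e - (- sin (2 * pi * (t / \<tau>)) * (2 * pi / \<tau>)) *\<^sub>R e')
        = (1 / \<tau>) *\<^sub>R shifted_circle e e' \<omega> v (t / \<tau>)"
      by (simp add: shifted_circle_def scaleR_add_right mult_ac)
    ultimately show "(?\<Psi> has_vector_derivative (1 / \<tau>) *\<^sub>R shifted_circle e e' \<omega> v (t / \<tau>)) (at t within {0..\<tau>})"
      by simp
  qed
  moreover have "?\<Psi> \<tau> - ?\<Psi> 0 = v" using assms by simp
  ultimately show ?thesis by simp
qed

context particle_system
begin

text \<open>
  A displacement of particle \<open>i\<close> by \<open>D u\<close>. The controlled particle starts from and returns to a point \<open>P\<close>
  common to all \<open>u\<close>, so that the journeys before and after it are the same for the whole family.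
\<close>

definition pushes_in ::
  "real \<Rightarrow> 'n \<Rightarrow> (real^'d)^'n \<Rightarrow> real^'d \<Rightarrow> real \<Rightarrow> real \<Rightarrow> real \<Rightarrow> bool" where
  "pushes_in h i m P \<eta> \<rho> \<epsilon> \<longleftrightarrow>
    (\<forall>(U :: ((real^'d)^('n option)) set) W D. compact U \<longrightarrow> continuous_on U W \<longrightarrow> continuous_on U D \<longrightarrow>
      (\<forall>u\<in>U. W u $ None = P \<and> norm (particles (W u) - m) \<le> \<eta> / 4 \<and> norm (D u) \<le> \<rho>) \<longrightarrow>
      steers U h W (\<lambda>u z. z $ None = P \<and>
        (\<forall>j. norm (z $ Some j - W u $ Some j - (if j = i then D u else 0)) \<le> \<epsilon>)))"

text \<open>
  The order of the quantifiers matters: the length \<open>\<rho>\<close> is the same for all times and all \<open>m\<close>. The distance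
  of \<open>P\<close> from the points of \<open>m\<close> leaves room for the displacement.
\<close>

definition pushes :: "'n \<Rightarrow> real \<Rightarrow> real \<Rightarrow> bool" where
  "pushes i \<eta> \<rho> \<longleftrightarrow>
    (\<forall>m :: (real^'d)^'n. (\<forall>k l. k \<noteq> l \<longrightarrow> 4 * \<eta> \<le> norm (m $ k - m $ l)) \<longrightarrow>
      (\<exists>P. (\<forall>j. 2 * \<eta> \<le> norm (m $ j - P)) \<and> (\<forall>\<epsilon>>0. \<exists>h\<^sub>0>0. \<forall>h. 0 < h \<and> h < h\<^sub>0 \<longrightarrow> pushes_in h i m P \<eta> \<rho> \<epsilon>)))"

text \<open>
  The time \<open>h\<close> is split into an approach of time \<open>h * h / 2\<close>, a push of time \<open>h - h * h\<close> and a departure of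
  time \<open>h * h / 2\<close>. In all three the speed of particle \<open>i\<close> is at most of order \<open>1 / h\<close>. So it moves by a length
  of order one in the push, and of order \<open>h\<close> in the other two.
\<close>

lemma push_particle:
  fixes i :: 'n
  assumes "\<eta> > 0"
  obtains \<rho> where "\<rho> > 0" "pushes i \<eta> \<rho>"
proof -
  obtain B where B: "\<And>t. 0 \<le> t \<Longrightarrow> \<bar>f i t\<bar> \<le> B" and "B > 0"
    using f_bounded[of i] unfolding bounded_pos by auto
  obtain L where L: "L-lipschitz_on {0..} (f i)" using f_lip by blast
  then have "L \<ge> 0" by (rule lipschitz_on_nonneg)
  obtain a where a: "a > 0" "\<And>z. norm (A i *v z) \<le> a * norm z"
    using bounded_linear.pos_bounded[OF matrix_vector_mul_bounded_linear[of "A i"]] by (metis mult.commute)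
  obtain A' where A': "A i ** A' = mat 1" using A_inv[of i] unfolding invertible_def by blast
  obtain a' where a': "a' > 0" "\<And>z. norm (A' *v z) \<le> a' * norm z"
    using bounded_linear.pos_bounded[OF matrix_vector_mul_bounded_linear[of A']] by (metis mult.commute)
  define c3 :: real where "c3 = 3 powr (p i - 1)"
  have "c3 > 0" by (simp add: c3_def)
  \<comment> \<open>The radius of the loop is such that the whole push has length at most \<open>\<eta> / 8\<close> (\<open>C_eq\<close>).\<close>
  define \<omega> where "\<omega> = \<eta> / (12 * (B * a * c3))"
  have "B * a * c3 > 0" using \<open>B > 0\<close> a(1) \<open>c3 > 0\<close> by simp
  then have \<omega>: "\<omega> > 0" and C_eq: "B * a * c3 * (3 * \<omega> / 2) = \<eta> / 8"
    using \<open>\<eta> > 0\<close> by (auto simp: \<omega>_def field_simps)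
  define C where "C = \<eta> / 8"
  have "C > 0" using \<open>\<eta> > 0\<close> by (simp add: C_def)
  \<comment> \<open>Displacements up to \<open>\<rho>\<close> require a mean of the loop up to half its radius (\<open>v_le\<close>).\<close>
  define \<rho> where "\<rho> = \<omega> * \<bar>f i 0\<bar> / (2 * a')"
  have "\<rho> > 0" using \<omega> f_0[of i] a'(1) by (simp add: \<rho>_def)
  have "pushes i \<eta> \<rho>"
    unfolding pushes_def
  proof (intro allI impI)
    fix m :: "(real^'d)^'n"
    assume "\<forall>k l. k \<noteq> l \<longrightarrow> 4 * \<eta> \<le> norm (m $ k - m $ l)"
    then have sep: "\<And>k l. k \<noteq> l \<Longrightarrow> 4 * \<eta> \<le> norm (m $ k - m $ l)" by blast
    obtain M where "M > 0"
      and M: "\<And>x y. norm (x - m) \<le> \<eta> \<Longrightarrow> norm (y - m $ i) \<le> 2 * \<eta> \<Longrightarrow> y \<noteq> x $ i \<Longrightarrow> join x y \<in> - diagonals"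
        "\<And>x y j. norm (x - m) \<le> \<eta> \<Longrightarrow> norm (y - m $ i) \<le> 2 * \<eta> \<Longrightarrow> y \<noteq> x $ i \<Longrightarrow>
          norm (drift (join x y) $ j - (if j = i then K i (x $ i - y) else 0)) \<le> M"
      using bounds_near_particle[OF \<open>\<eta> > 0\<close> sep, where i = i] by blast
    obtain e e' :: "real^'d" where e: "norm e = 1" "norm e' = 1" "e \<bullet> e' = 0"
      by (rule orthonormal_pair[OF dim])
    define P where "P = m $ i - (2 * \<eta>) *\<^sub>R e"
    define N where "N = real CARD('n)"
    have N: "N \<ge> 1" by (simp add: N_def Suc_le_eq)
    have Pm: "2 * \<eta> \<le> norm (m $ j - P)" for j
    proof (cases "j = i")
      case True
      then show ?thesis using e(1) \<open>\<eta> > 0\<close> by (simp add: P_def)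
    next
      case False
      have "(m $ j - P) - (2 * \<eta>) *\<^sub>R e = m $ j - m $ i" by (simp add: P_def)
      then have "norm (m $ j - m $ i) \<le> norm (m $ j - P) + 2 * \<eta>"
        using norm_triangle_ineq4[of "m $ j - P" "(2 * \<eta>) *\<^sub>R e"] e(1) \<open>\<eta> > 0\<close> by (simp only: norm_scaleR)
      then show ?thesis using sep[OF False] by linarith
    qed
    have "\<exists>h\<^sub>0>0. \<forall>h. 0 < h \<and> h < h\<^sub>0 \<longrightarrow> pushes_in h i m P \<eta> \<rho> \<epsilon>"
      if "\<epsilon> > 0" for \<epsilon>
    proof -
      define \<mu> where "\<mu> = min (\<eta> / 8) (\<epsilon> / 8)"
      have \<mu>: "\<mu> > 0" "\<mu> \<le> \<eta> / 8" "\<mu> \<le> \<epsilon> / 8" using \<open>\<eta> > 0\<close> \<open>\<epsilon> > 0\<close> by (auto simp: \<mu>_def)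
      define l where "l = L * a * (3 * \<omega> / 2)"
      have "l \<ge> 0" using \<open>L \<ge> 0\<close> a \<omega> by (simp add: l_def)
      \<comment> \<open>An offset below \<open>\<xi>\<close> makes the variation of \<open>f i\<close> contribute at most \<open>\<epsilon> / 4\<close>.\<close>
      define \<xi> where "\<xi> = min \<eta> (\<epsilon> / (4 * (l + 1)))"
      have \<xi>: "\<xi> > 0" "\<xi> \<le> \<eta>" using \<open>\<eta> > 0\<close> \<open>\<epsilon> > 0\<close> \<open>l \<ge> 0\<close> by (auto simp: \<xi>_def)
      have "\<xi> * l \<le> \<epsilon> / (4 * (l + 1)) * (l + 1)"
        using \<open>l \<ge> 0\<close> \<open>\<epsilon> > 0\<close> by (intro mult_mono) (auto simp: \<xi>_def)
      also have "\<epsilon> / (4 * (l + 1)) * (l + 1) = \<epsilon> / 4"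
        using \<open>l \<ge> 0\<close> by (simp add: field_simps)
      finally have \<xi>l: "\<xi> * l \<le> \<epsilon> / 4" .
      define S where "S = C + N * M"
      have S: "S > 0" "C \<le> S" "M \<le> S" "N * M \<le> S"
        using \<open>C > 0\<close> \<open>M > 0\<close> N mult_right_mono[of 1 N M]
        by (simp_all add: S_def add_pos_pos add_increasing)
      define h\<^sub>0 where "h\<^sub>0 = min (1 / 2) (min (\<omega> / 2 * \<xi> powr (p i - 1)) (\<mu> / S))"
      have "h\<^sub>0 > 0" using \<omega> \<xi> \<mu> S by (simp add: h\<^sub>0_def)
      moreover have "steers U h W (\<lambda>u z. z $ None = P \<and>
            (\<forall>j. norm (z $ Some j - W u $ Some j - (if j = i then D u else 0)) \<le> \<epsilon>))"
        if h: "0 < h" "h < h\<^sub>0" and U: "compact U" and W: "continuous_on U W" and D: "continuous_on U D"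
          and near: "\<forall>u\<in>U. W u $ None = P \<and> norm (particles (W u) - m) \<le> \<eta> / 4 \<and> norm (D u) \<le> \<rho>"
        for h and U :: "((real^'d)^('n option)) set" and W D
      proof -
        define \<sigma> where "\<sigma> = h * h / 2"
        define \<tau> where "\<tau> = h - h * h"
        have h1: "h < 1 / 2" "h < \<omega> / 2 * \<xi> powr (p i - 1)" "h * S < \<mu>"
          using h S by (auto simp: h\<^sub>0_def field_simps)
        have "h * h < h * (1 / 2)" using h h1 by (intro mult_strict_left_mono) auto
        then have \<tau>: "\<tau> > 0" "\<tau> \<le> h" and "h / 2 \<le> \<tau>" using h by (auto simp: \<tau>_def)
        have \<sigma>: "\<sigma> > 0" "\<sigma> \<le> h" using h \<open>h * h < h * (1 / 2)\<close> by (auto simp: \<sigma>_def)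
        have "h * (h / 2) \<le> h * \<tau>" using \<open>h / 2 \<le> \<tau>\<close> h by (intro mult_left_mono) auto
        then have \<sigma>\<tau>: "\<sigma> / \<tau> \<le> h" using \<tau> by (simp add: \<sigma>_def field_simps)
        have htot: "h = \<sigma> + (\<tau> + \<sigma>)" by (simp add: \<sigma>_def \<tau>_def)
        define b where "b = 3 * \<omega> / 2 / \<tau>"
        have Cb: "B * a * 3 powr (p i - 1) * b = C / \<tau>"
        proof -
          have "B * a * c3 * b = B * a * c3 * (3 * \<omega> / 2) / \<tau>" by (simp add: b_def)
          then show ?thesis unfolding C_eq by (simp add: C_def c3_def)
        qed
        have \<sigma>bd: "\<sigma> * (C / \<tau> + N * M) \<le> \<mu>"
        proof -
          have "\<sigma> * (C / \<tau> + N * M) = (\<sigma> / \<tau>) * C + \<sigma> * (N * M)" by (simp add: algebra_simps)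
          also have "\<dots> \<le> h * C + h * (N * M)"
            using \<sigma>\<tau> \<sigma> \<open>C > 0\<close> \<open>M > 0\<close> N by (intro add_mono mult_right_mono) auto
          also have "\<dots> = h * S" by (simp add: S_def algebra_simps)
          finally show ?thesis using h1 by linarith
        qed
        have "\<tau> * (N * M) \<le> h * S" using \<tau> S \<open>M > 0\<close> N by (intro mult_mono) auto
        then have \<tau>bd: "\<tau> * (N * M) \<le> \<mu>" using h1 by linarith
        have "\<tau> * M \<le> \<tau> * (N * M)" using N \<open>M > 0\<close> \<tau> by simp
        with \<tau>bd have \<tau>M: "\<tau> * M \<le> \<mu>" by linarith
        have \<tau>Cb: "\<tau> * (C / \<tau> + N * M) \<le> \<eta> / 4"
          using \<tau> \<tau>bd \<mu>(2) by (simp add: algebra_simps C_def)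
        have \<sigma>disp: "\<sigma> * ((if j = i then C / \<tau> else 0) + M) \<le> \<mu>" for j
        proof -
          have "(if j = i then C / \<tau> else 0) + M \<le> C / \<tau> + N * M"
            using \<tau> \<open>C > 0\<close> N \<open>M > 0\<close> by (intro add_mono) auto
          then have "\<sigma> * ((if j = i then C / \<tau> else 0) + M) \<le> \<sigma> * (C / \<tau> + N * M)"
            using \<sigma> by (intro mult_left_mono) auto
          with \<sigma>bd show ?thesis by linarith
        qed
        define v where "v u = (1 / f i 0) *\<^sub>R (A' *v D u)" for u
        have v_cont: "continuous_on U v"
          unfolding v_def by (intro continuous_intros bounded_linear.continuous_on[OF matrix_vector_mul_bounded_linear] D)
        have v_le: "norm (v u) \<le> \<omega> / 2" if "u \<in> U" for u
        proof -
          have "norm (v u) \<le> (a' * \<rho>) / \<bar>f i 0\<bar>"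
            using a'(2)[of "D u"] near that a'(1)
            by (auto simp: v_def intro!: divide_right_mono intro: order_trans mult_left_mono)
          then show ?thesis using f_0[of i] a'(1) by (simp add: \<rho>_def)
        qed
        have Av: "f i 0 *\<^sub>R (A i *v v u) = D u" for u
          using f_0[of i] by (simp add: v_def matrix_vector_mult_scaleR matrix_vector_mul_assoc A')
        define V where "V u t = (1 / \<tau>) *\<^sub>R shifted_circle e e' \<omega> (v u) (t / \<tau>)" for u t
        have V_cont: "continuous_on (U \<times> {0..\<tau>}) (\<lambda>(u, t). V u t)"
          unfolding V_def shifted_circle_def case_prod_beta
          by (intro continuous_intros continuous_on_compose2[OF v_cont]) (use \<tau> in auto)
        have V_norm: "\<omega> / 2 / \<tau> \<le> norm (V u t)" "norm (V u t) \<le> b" if "u \<in> U" for u t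
          using norm_shifted_circle[OF e \<omega> v_le[OF that], of "t / \<tau>", THEN divide_right_mono, of \<tau>] \<tau>
          by (simp_all add: V_def b_def)
        have z_small: "norm (offset (p i) (V u t)) \<le> \<xi>" if "u \<in> U" for u t
        proof -
          have "\<tau> \<le> \<omega> / 2 * \<xi> powr (p i - 1)" using h1 \<tau> by linarith
          moreover have "\<xi> powr (p i - 1) > 0" using \<xi> by simp
          ultimately have "1 / \<xi> powr (p i - 1) \<le> \<omega> / 2 / \<tau>"
            using \<tau> by (simp add: field_simps)
          then have "\<xi> powr (- (p i - 1)) \<le> \<omega> / 2 / \<tau>"
            by (simp only: powr_minus_divide)
          then have "\<xi> powr (- (p i - 1)) \<le> norm (V u t)" using V_norm(1)[OF that, of t] by linarith
          then have "norm (offset (p i) (V u t)) \<le> (\<xi> powr (- (p i - 1))) powr (- 1 / (p i - 1))"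
            using \<xi>(1) by (intro norm_offset_le p_gt_1) auto
          also have "\<dots> = \<xi> powr (- (p i - 1) * (- 1 / (p i - 1)))" by (rule powr_powr)
          also have "- (p i - 1) * (- 1 / (p i - 1)) = 1" using p_gt_1[of i] by (simp add: field_simps)
          also have "\<xi> powr 1 = \<xi>" using \<xi>(1) by simp
          finally show ?thesis .
        qed
        have V_ne: "V u t \<noteq> 0" if "u \<in> U" for u t
        proof -
          have "0 < \<omega> / 2 / \<tau>" using \<omega> \<tau> by simp
          also note V_norm(1)[OF that, of t]
          finally show ?thesis by simp
        qed
        have V_bd: "V u t \<noteq> 0 \<and> norm (V u t) \<le> b \<and> norm (offset (p i) (V u t)) \<le> \<eta>" if "u \<in> U" for u t
          using V_ne[OF that] V_norm(2)[OF that] z_small[OF that, of t] \<xi>(2) by (auto intro: order_trans)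
        have V0: "V u 0 = (1 / \<tau>) *\<^sub>R (v u + \<omega> *\<^sub>R e)" and V\<tau>: "V u \<tau> = V u 0" for u
          using \<tau> by (auto simp: V_def shifted_circle_def)
        have V0_cont: "continuous_on (U \<times> {0..\<sigma>}) (\<lambda>(u, t). V u 0)"
          unfolding V0 case_prod_beta
          by (intro continuous_intros continuous_on_compose2[OF v_cont]) auto
        have V0_dir: "norm (V u 0) \<le> 3 * (V u 0 \<bullet> e)" if "u \<in> U" for u
        proof -
          have "norm (v u + \<omega> *\<^sub>R e) \<le> \<omega> / 2 + \<omega>"
            using v_le[OF that] e(1) \<omega> by (intro order_trans[OF norm_triangle_ineq]) auto
          moreover have "\<bar>v u \<bullet> e\<bar> \<le> \<omega> / 2"
            using Cauchy_Schwarz_ineq2[of "v u" e] e(1) v_le[OF that] by simp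
          moreover have "(v u + \<omega> *\<^sub>R e) \<bullet> e = v u \<bullet> e + \<omega>"
            using e(1) by (simp add: inner_add_left dot_square_norm)
          ultimately have "norm (v u + \<omega> *\<^sub>R e) \<le> 3 * ((v u + \<omega> *\<^sub>R e) \<bullet> e)" by linarith
          then show ?thesis using \<tau> by (simp add: V0 divide_right_mono)
        qed
        note near_stage' = near_stage[OF e(1) \<open>\<eta> > 0\<close> M B less_imp_le[OF a(1)] a(2) U]
        define R1 where "R1 u z \<longleftrightarrow> z $ None = z $ Some i - offset (p i) (V u 0) \<and>
          norm (particles z - m) \<le> 3 * \<eta> / 8 \<and> (\<forall>j. norm (z $ Some j - W u $ Some j) \<le> \<mu>)" for u z
        define R2 where "R2 u z \<longleftrightarrow> z $ None = z $ Some i - offset (p i) (V u 0) \<and>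
          norm (particles z - m) \<le> 5 * \<eta> / 8 \<and>
          (\<forall>j. norm (z $ Some j - W u $ Some j - (if j = i then D u else 0)) \<le> 2 * \<mu> + \<epsilon> / 4)" for u z
        have tri: "norm (particles z - m) \<le> r + s"
          if "norm (particles z - particles z') \<le> r" "norm (particles z' - m) \<le> s" for z z' r s
          using norm_triangle_ineq[of "particles z - particles z'" "particles z' - m"] that by simp
        \<comment> \<open>Approach along a segment from \<open>P\<close> to the starting point of the loop.\<close>
        have s1: "steers U \<sigma> W R1"
        proof (rule near_stage'[where W = W and T = \<sigma> and V = "\<lambda>u t. V u 0" and \<theta> = "\<lambda>t. t / \<sigma>" and b = b and \<rho> = "\<eta> / 8"])
          show "continuous_on {0..\<sigma>} (\<lambda>t. t / \<sigma>)" using \<sigma> by (intro continuous_intros) auto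
          show "\<sigma> * (B * a * 3 powr (p i - 1) * b + real CARD('n) * M) \<le> \<eta> / 8"
            using \<sigma>bd \<mu>(2) unfolding Cb N_def by linarith
          fix w assume w: "is_family U \<sigma> w" "\<And>u. u \<in> U \<Longrightarrow> w u 0 = W u"
            "\<And>u t. u \<in> U \<Longrightarrow> t \<in> {0..\<sigma>} \<Longrightarrow> norm (particles (w u t) - particles (W u)) \<le> \<eta> / 8"
            "\<And>u t. u \<in> U \<Longrightarrow> t \<in> {0..\<sigma>} \<Longrightarrow> w u t $ None = (t / \<sigma>) *\<^sub>R (w u t $ Some i - offset (p i) (V u 0))
              + (1 - t / \<sigma>) *\<^sub>R (m $ i - (2 * \<eta>) *\<^sub>R e)"
            "\<And>u t j. u \<in> U \<Longrightarrow> t \<in> {0..\<sigma>} \<Longrightarrow> norm (w u t $ Some j - W u $ Some j)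
              \<le> \<sigma> * ((if j = i then B * a * 3 powr (p i - 1) * b else 0) + M)"
          have "R1 u (w u \<sigma>)" if u: "u \<in> U" for u
            unfolding R1_def
          proof (intro conjI allI)
            have s: "\<sigma> \<in> {0..\<sigma>}" using \<sigma> by simp
            show "w u \<sigma> $ None = w u \<sigma> $ Some i - offset (p i) (V u 0)"
              using w(4)[OF u s] \<sigma> by simp
            show "norm (particles (w u \<sigma>) - m) \<le> 3 * \<eta> / 8"
              using tri[OF w(3)[OF u s], of "\<eta> / 4"] near u by simp
            show "norm (w u \<sigma> $ Some j - W u $ Some j) \<le> \<mu>" for j
              using w(5)[OF u s, of j] \<sigma>disp[of j] unfolding Cb by linarith
          qed
          then show ?thesis using w(1,2) unfolding steers_def by blast
        qed (use W V0_cont V_bd V0_dir near \<sigma> \<open>\<eta> > 0\<close> in \<open>auto simp: P_def\<close>)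
        \<comment> \<open>Push along the loop.\<close>
        have s2: "steers U \<tau> W1 R2"
          if W1: "continuous_on U W1" "\<And>u. u \<in> U \<Longrightarrow> R1 u (W1 u)" for W1
        proof (rule near_stage'[where W = W1 and T = \<tau> and V = V and \<theta> = "\<lambda>t. 1" and b = b and \<rho> = "\<eta> / 4"])
          show "\<tau> * (B * a * 3 powr (p i - 1) * b + real CARD('n) * M) \<le> \<eta> / 4"
            using \<tau>Cb unfolding Cb N_def .
          show "W1 u $ None = 1 *\<^sub>R (W1 u $ Some i - offset (p i) (V u 0)) + (1 - 1) *\<^sub>R (m $ i - (2 * \<eta>) *\<^sub>R e)" if "u \<in> U" for u
            using W1(2)[OF that] by (simp add: R1_def)
          show "norm (particles (W1 u) - m) + \<eta> / 4 \<le> \<eta>" if "u \<in> U" for u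
            using W1(2)[OF that] \<open>\<eta> > 0\<close> by (simp add: R1_def)
          fix w assume w: "is_family U \<tau> w" "\<And>u. u \<in> U \<Longrightarrow> w u 0 = W1 u"
            "\<And>u t. u \<in> U \<Longrightarrow> t \<in> {0..\<tau>} \<Longrightarrow> norm (particles (w u t) - particles (W1 u)) \<le> \<eta> / 4"
            "\<And>u t. u \<in> U \<Longrightarrow> t \<in> {0..\<tau>} \<Longrightarrow> w u t $ None = 1 *\<^sub>R (w u t $ Some i - offset (p i) (V u t))
              + (1 - 1) *\<^sub>R (m $ i - (2 * \<eta>) *\<^sub>R e)"
            "\<And>u t j. u \<in> U \<Longrightarrow> t \<in> {0..\<tau>} \<Longrightarrow> norm (w u t $ Some j - W1 u $ Some j)
              \<le> \<tau> * ((if j = i then B * a * 3 powr (p i - 1) * b else 0) + M)"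
          have "R2 u (w u \<tau>)" if u: "u \<in> U" for u
          proof -
            have t: "\<tau> \<in> {0..\<tau>}" using \<tau> by simp
            \<comment> \<open>If \<open>f i\<close> were constant and \<open>K i\<close> the only term, the displacement would be exactly \<open>D u\<close>.\<close>
            have i_disp: "norm (w u \<tau> $ Some i - W1 u $ Some i - D u) \<le> \<epsilon> / 4 + \<mu>"
            proof -
              have "((\<lambda>s. V u s) has_integral v u) {0..\<tau>}"
                unfolding V_def by (rule has_integral_shifted_circle[OF \<tau>(1)])
              from has_integral_linear[OF this matrix_vector_mul_bounded_linear[of "A i"]]
              have "((\<lambda>s. f i 0 *\<^sub>R (A i *v V u s)) has_integral f i 0 *\<^sub>R (A i *v v u)) {0..\<tau>}"
                by (intro has_integral_cmul) (simp add: o_def)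
              then have iA: "((\<lambda>s. f i 0 *\<^sub>R (A i *v V u s)) has_integral D u) {0..\<tau>}"
                unfolding Av .
              have w_cont: "continuous_on {0..\<tau>} (\<lambda>s. drift (w u s))"
                by (intro continuous_on_drift_compose is_family_slice[OF w(1) u])
              have "((\<lambda>s. drift (w u s) $ i) has_integral (integral {0..\<tau>} (\<lambda>s. drift (w u s))) $ i) {0..\<tau>}"
                using has_integral_linear[OF integrable_integral[OF integrable_continuous_real[OF w_cont]] bounded_linear_vec_nth[of i]]
                by (simp add: o_def)
              moreover have "integral {0..\<tau>} (\<lambda>s. drift (w u s)) = particles (w u \<tau>) - particles (w u 0)"
                using is_family_eq[OF w(1) u t] by simp
              ultimately have iw: "((\<lambda>s. drift (w u s) $ i) has_integral (w u \<tau> $ Some i - W1 u $ Some i)) {0..\<tau>}"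
                using w(2)[OF u] by simp
              have "norm (drift (w u s) $ i - f i 0 *\<^sub>R (A i *v V u s)) \<le> \<xi> * L * (a * b) + M" if s: "s \<in> {0..\<tau>}" for s
              proof -
                let ?x = "particles (w u s)" and ?y = "w u s $ None" and ?z = "offset (p i) (V u s)"
                have xy: "?x $ i - ?y = ?z" using w(4)[OF u s] by simp
                have x: "norm (?x - m) \<le> 5 * \<eta> / 8"
                  using tri[OF w(3)[OF u s], of "3 * \<eta> / 8"] W1(2)[OF u] by (simp add: R1_def)
                have "?y - m $ i = (?x $ i - m $ i) - ?z" using xy by (simp add: algebra_simps)
                then have "norm (?y - m $ i) \<le> norm (?x $ i - m $ i) + norm ?z"
                  by (simp only: norm_triangle_ineq4)
                then have y: "norm (?y - m $ i) \<le> 2 * \<eta>"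
                  using norm_component_diff_le[of ?x i m] x V_bd[OF u, of s] \<open>\<eta> > 0\<close> by simp
                have "norm (drift (join ?x ?y) $ i - (if i = i then K i (?x $ i - ?y) else 0)) \<le> M"
                  using xy offset_nonzero[OF V_ne[OF u, of s], of "p i"] x y \<open>\<eta> > 0\<close> by (intro M(2)) auto
                then have 1: "norm (drift (w u s) $ i - K i ?z) \<le> M" using xy by simp
                have "\<bar>f i (norm ?z) - f i 0\<bar> \<le> L * norm ?z"
                  using lipschitz_onD[OF L, of "norm ?z" 0] by (simp add: dist_real_def)
                also have "\<dots> \<le> L * \<xi>" using z_small[OF u, of s] \<open>L \<ge> 0\<close> by (intro mult_left_mono)
                finally have f: "\<bar>f i (norm ?z) - f i 0\<bar> \<le> \<xi> * L" by (simp add: mult.commute)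
                have "norm (A i *v V u s) \<le> a * b"
                  using a(2)[of "V u s"] V_norm(2)[OF u, of s] a(1) mult_left_mono[of "norm (V u s)" b a] by linarith
                then have "\<bar>f i (norm ?z) - f i 0\<bar> * norm (A i *v V u s) \<le> \<xi> * L * (a * b)"
                  using f \<xi>(1) \<open>L \<ge> 0\<close> by (intro mult_mono) auto
                then have 2: "norm (K i ?z - f i 0 *\<^sub>R (A i *v V u s)) \<le> \<xi> * L * (a * b)"
                  unfolding K_offset[OF V_ne[OF u]] by (simp flip: scaleR_diff_left)
                show ?thesis
                  using norm_triangle_ineq[of "drift (w u s) $ i - K i ?z" "K i ?z - f i 0 *\<^sub>R (A i *v V u s)"] 1 2
                  by simp
              qed
              then have "norm (w u \<tau> $ Some i - W1 u $ Some i - D u) \<le> (\<xi> * L * (a * b) + M) * measure lborel (cbox 0 \<tau>)"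
                using has_integral_diff[OF iw iA] \<xi>(1) \<open>L \<ge> 0\<close> a(1) \<omega> \<tau> \<open>M > 0\<close>
                by (intro has_integral_bound[where f = "\<lambda>s. drift (w u s) $ i - f i 0 *\<^sub>R (A i *v V u s)"])
                  (auto simp: b_def)
              also have "\<dots> = \<xi> * l + \<tau> * M"
                using \<tau> by (simp add: l_def b_def field_simps)
              finally show ?thesis using \<xi>l \<tau>M by linarith
            qed
            show ?thesis
              unfolding R2_def
            proof (intro conjI allI)
              show "w u \<tau> $ None = w u \<tau> $ Some i - offset (p i) (V u 0)"
                using w(4)[OF u t] by (simp add: V\<tau>)
              show "norm (particles (w u \<tau>) - m) \<le> 5 * \<eta> / 8"
                using tri[OF w(3)[OF u t], of "3 * \<eta> / 8"] W1(2)[OF u] by (simp add: R1_def)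
              fix j
              have j1: "norm (W1 u $ Some j - W u $ Some j) \<le> \<mu>" using W1(2)[OF u] by (simp add: R1_def)
              have j2: "norm (w u \<tau> $ Some j - W1 u $ Some j - (if j = i then D u else 0)) \<le> \<epsilon> / 4 + \<mu>"
              proof (cases "j = i")
                case False
                then show ?thesis using w(5)[OF u t, of j] \<tau>M \<open>\<epsilon> > 0\<close> by simp
              qed (use i_disp in simp)
              show "norm (w u \<tau> $ Some j - W u $ Some j - (if j = i then D u else 0)) \<le> 2 * \<mu> + \<epsilon> / 4"
                using norm_triangle_ineq[of "w u \<tau> $ Some j - W1 u $ Some j - (if j = i then D u else 0)" "W1 u $ Some j - W u $ Some j"] j1 j2
                by (cases "j = i") (simp_all add: algebra_simps)
            qed
          qed
          then show ?thesis using w(1,2) unfolding steers_def by blast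
        qed (use W1(1) V_cont V_bd \<tau> \<open>\<eta> > 0\<close> in auto)
        \<comment> \<open>Departure to \<open>P\<close>; the loop is closed, so this is the approach backwards.\<close>
        have s3: "steers U \<sigma> W2 (\<lambda>u z. z $ None = P \<and>
            (\<forall>j. norm (z $ Some j - W u $ Some j - (if j = i then D u else 0)) \<le> \<epsilon>))"
          if W2: "continuous_on U W2" "\<And>u. u \<in> U \<Longrightarrow> R2 u (W2 u)" for W2
        proof (rule near_stage'[where W = W2 and T = \<sigma> and V = "\<lambda>u t. V u 0" and \<theta> = "\<lambda>t. 1 - t / \<sigma>" and b = b and \<rho> = "\<eta> / 8"])
          show "continuous_on {0..\<sigma>} (\<lambda>t. 1 - t / \<sigma>)" using \<sigma> by (intro continuous_intros) auto
          show "\<sigma> * (B * a * 3 powr (p i - 1) * b + real CARD('n) * M) \<le> \<eta> / 8"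
            using \<sigma>bd \<mu>(2) unfolding Cb N_def by linarith
          show "W2 u $ None = (1 - 0 / \<sigma>) *\<^sub>R (W2 u $ Some i - offset (p i) (V u 0)) + (1 - (1 - 0 / \<sigma>)) *\<^sub>R (m $ i - (2 * \<eta>) *\<^sub>R e)" if "u \<in> U" for u
            using W2(2)[OF that] by (simp add: R2_def)
          show "norm (particles (W2 u) - m) + \<eta> / 8 \<le> \<eta>" if "u \<in> U" for u
            using W2(2)[OF that] \<open>\<eta> > 0\<close> by (simp add: R2_def)
          fix w assume w: "is_family U \<sigma> w" "\<And>u. u \<in> U \<Longrightarrow> w u 0 = W2 u"
            "\<And>u t. u \<in> U \<Longrightarrow> t \<in> {0..\<sigma>} \<Longrightarrow> w u t $ None = (1 - t / \<sigma>) *\<^sub>R (w u t $ Some i - offset (p i) (V u 0))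
              + (1 - (1 - t / \<sigma>)) *\<^sub>R (m $ i - (2 * \<eta>) *\<^sub>R e)"
            "\<And>u t j. u \<in> U \<Longrightarrow> t \<in> {0..\<sigma>} \<Longrightarrow> norm (w u t $ Some j - W2 u $ Some j)
              \<le> \<sigma> * ((if j = i then B * a * 3 powr (p i - 1) * b else 0) + M)"
          have "w u \<sigma> $ None = P \<and>
            (\<forall>j. norm (w u \<sigma> $ Some j - W u $ Some j - (if j = i then D u else 0)) \<le> \<epsilon>)" if u: "u \<in> U" for u
          proof (intro conjI allI)
            have s: "\<sigma> \<in> {0..\<sigma>}" using \<sigma> by simp
            show "w u \<sigma> $ None = P"
              using w(3)[OF u s] \<sigma> by (simp add: P_def)
            fix j
            have "norm (W2 u $ Some j - W u $ Some j - (if j = i then D u else 0)) \<le> 2 * \<mu> + \<epsilon> / 4"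
              using W2(2)[OF u] by (simp add: R2_def)
            moreover have "norm (w u \<sigma> $ Some j - W2 u $ Some j) \<le> \<mu>"
              using w(4)[OF u s, of j] \<sigma>disp[of j] unfolding Cb by linarith
            ultimately show "norm (w u \<sigma> $ Some j - W u $ Some j - (if j = i then D u else 0)) \<le> \<epsilon>"
              using norm_triangle_ineq[of "w u \<sigma> $ Some j - W2 u $ Some j" "W2 u $ Some j - W u $ Some j - (if j = i then D u else 0)"] \<mu> \<open>\<epsilon> > 0\<close>
              by (cases "j = i") (simp_all add: algebra_simps)
          qed
          then show ?thesis using w(1,2) unfolding steers_def by blast
        qed (use W2(1) V0_cont V_bd V0_dir \<sigma> \<open>\<eta> > 0\<close> in auto)
        have "steers U (\<sigma> + (\<tau> + \<sigma>)) W (\<lambda>u z. z $ None = P \<and>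
            (\<forall>j. norm (z $ Some j - W u $ Some j - (if j = i then D u else 0)) \<le> \<epsilon>))"
        proof (rule steers_append[OF U _ _ s1])
          fix W1 assume W1: "continuous_on U W1" "\<And>u. u \<in> U \<Longrightarrow> R1 u (W1 u)"
          show "steers U (\<tau> + \<sigma>) W1 (\<lambda>u z. z $ None = P \<and>
              (\<forall>j. norm (z $ Some j - W u $ Some j - (if j = i then D u else 0)) \<le> \<epsilon>))"
            by (rule steers_append[OF U _ _ s2[OF W1] s3]) (use \<sigma> \<tau> in simp_all)
        qed (use \<sigma> \<tau> in simp_all)
        then show ?thesis using htot by simp
      qed
      ultimately show ?thesis unfolding pushes_in_def by blast
    qed
    with Pm show "\<exists>P. (\<forall>j. 2 * \<eta> \<le> norm (m $ j - P)) \<and> (\<forall>\<epsilon>>0. \<exists>h\<^sub>0>0. \<forall>h. 0 < h \<and> h < h\<^sub>0 \<longrightarrow> pushes_in h i m P \<eta> \<rho> \<epsilon>)"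
      by blast
  qed
  with \<open>\<rho> > 0\<close> show ?thesis by (rule that)
qed

end

section \<open>Pushing all particles in turn\<close>

lemma path_avoiding_finite:
  fixes S :: "(real^'d) set"
  assumes "CARD('d) \<ge> 2" "finite S" "x \<notin> S" "y \<notin> S"
  shows "\<exists>q :: real \<Rightarrow> real^'d. continuous_on {0..1} q \<and> q 0 = x \<and> q 1 = y \<and> (\<forall>t\<in>{0..1}. q t \<notin> S)"
proof -
  have "path_connected (- S)"
    using assms(1,2) by (intro path_connected_complement_countable) (auto intro: countable_finite)
  then obtain q where q: "path q" "path_image q \<subseteq> - S" "pathstart q = x" "pathfinish q = y"
    using assms(3,4) unfolding path_connected_def by (metis ComplI)
  show ?thesis
  proof (intro exI[of _ q] conjI ballI)
    show "continuous_on {0..1} q" using q(1) by (simp add: path_def)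
    show "q 0 = x" "q 1 = y" using q(3,4) by (simp_all add: pathstart_def pathfinish_def)
    show "q t \<notin> S" if "t \<in> {0..1}" for t
      using q(2) imageI[OF that, of q] unfolding path_image_def by blast
  qed
qed

definition mixed :: "'n::finite set \<Rightarrow> (real^'d)^('n option) \<Rightarrow> (real^'d)^('n option) \<Rightarrow> (real^'d)^'n" where
  "mixed Z u w = (\<chi> j. if j \<in> Z then u $ Some j else w $ Some j)"

context particle_system
begin

lemma steers_subset: "steers U T W R \<Longrightarrow> V \<subseteq> U \<Longrightarrow> steers V T W R"
  unfolding steers_def using is_family_subset by blast

lemma steers_cong: "steers U T W R \<Longrightarrow> (\<And>u. u \<in> U \<Longrightarrow> W u = W' u) \<Longrightarrow> steers U T W' R"
  unfolding steers_def by metis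

text \<open>
  After the particles in \<open>Z\<close> have been pushed, they are close to their targets in \<open>u\<close>, the others are still
  close to their positions in \<open>a\<close>, and the controlled particle is at a point \<open>P\<close> that is the same for
  all \<open>u\<close>. Fixing \<open>P\<close> allows one path around the other particles to serve the whole family, if
  the radius \<open>R\<close> is smaller than the distance of that path from them; this is why \<open>R\<close> shrinks with
  each particle.
\<close>

lemma push_particles_in_turn:
  fixes a b :: "(real^'d)^('n option)"
  assumes a: "a \<in> - diagonals" and "\<eta> > 0"
    and sep: "\<And>Z k l. k \<noteq> l \<Longrightarrow> 4 * \<eta> \<le> norm (mixed Z b a $ k - mixed Z b a $ l)"
    and \<rho>: "\<And>i. \<rho> i > 0" "\<And>i. pushes i \<eta> (\<rho> i)"
    and close: "\<And>i. norm (b $ Some i - a $ Some i) \<le> \<rho> i / 2" "\<And>i. norm (b $ Some i - a $ Some i) \<le> \<eta>"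
    and "finite Z"
  shows "\<exists>R>0. \<exists>P. (\<forall>j. mixed Z b a $ j \<noteq> P) \<and> (\<forall>\<epsilon>>0. \<exists>h\<^sub>0>0. \<forall>h. 0 < h \<and> h < h\<^sub>0 \<longrightarrow>
    steers (cball b R) h (\<lambda>_. a) (\<lambda>u z. z $ None = P \<and> (\<forall>j. norm (z $ Some j - mixed Z u a $ j) \<le> \<epsilon>)))"
  using \<open>finite Z\<close>
proof induction
  case empty
  have m0: "mixed {} u a = particles a" for u by (simp add: mixed_def particles_def)
  have ne: "particles a $ j \<noteq> a $ None" for j
    using off_diagonalsD[OF a, of "Some j" None] by simp
  have q: "continuous_on {0..1} (\<lambda>_::real. a $ None)" by simp
  obtain \<epsilon>\<^sub>0 where e0: "\<epsilon>\<^sub>0 > 0"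
    and travel: "\<And>\<epsilon>. \<epsilon> > 0 \<Longrightarrow> \<exists>T\<^sub>0>0. \<forall>T. 0 < T \<and> T < T\<^sub>0 \<longrightarrow> travels_in T (particles a) (a $ None) (a $ None) \<epsilon>\<^sub>0 \<epsilon>"
    using travel_stage[OF particles_off_diagonals[OF a] q ne] by blast
  show ?case
  proof (rule exI[of _ "1::real"], rule conjI, simp, rule exI[of _ "a $ None"], rule conjI; intro allI impI)
    show "mixed {} b a $ j \<noteq> a $ None" for j using ne by (simp add: m0)
    fix \<epsilon> :: real assume "\<epsilon> > 0"
    obtain T\<^sub>0 where T0: "T\<^sub>0 > 0" "\<forall>T. 0 < T \<and> T < T\<^sub>0 \<longrightarrow> travels_in T (particles a) (a $ None) (a $ None) \<epsilon>\<^sub>0 \<epsilon>"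
      using travel[OF \<open>\<epsilon> > 0\<close>] by blast
    have "steers (cball b 1) h (\<lambda>_. a) (\<lambda>u z. z $ None = a $ None + 0 \<and> (\<forall>j. norm (z $ Some j - a $ Some j) \<le> \<epsilon>))"
      if "0 < h \<and> h < T\<^sub>0" for h
      using that e0 by (intro T0(2)[rule_format, unfolded travels_in_def, rule_format]) auto
    with T0(1) show "\<exists>h\<^sub>0>0. \<forall>h. 0 < h \<and> h < h\<^sub>0 \<longrightarrow>
        steers (cball b 1) h (\<lambda>_. a) (\<lambda>u z. z $ None = a $ None \<and> (\<forall>j. norm (z $ Some j - mixed {} u a $ j) \<le> \<epsilon>))"
      by (auto simp: m0)
  qed
next
  case (insert i Z)
  define m where "m = mixed Z b a"
  define N where "N = real CARD('n)"
  have N: "N \<ge> 1" by (simp add: N_def Suc_le_eq)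
  obtain R P where "R > 0" and P: "\<And>j. m $ j \<noteq> P"
    and IH: "\<And>\<epsilon>. \<epsilon> > 0 \<Longrightarrow> \<exists>h\<^sub>0>0. \<forall>h. 0 < h \<and> h < h\<^sub>0 \<longrightarrow>
      steers (cball b R) h (\<lambda>_. a) (\<lambda>u z. z $ None = P \<and> (\<forall>j. norm (z $ Some j - mixed Z u a $ j) \<le> \<epsilon>))"
    using insert.IH unfolding m_def by blast
  have msep: "\<forall>k l. k \<noteq> l \<longrightarrow> 4 * \<eta> \<le> norm (m $ k - m $ l)"
    unfolding m_def using sep by blast
  have m_off: "m \<in> - diagonals"
    using msep \<open>\<eta> > 0\<close> by (intro off_diagonalsI) force
  obtain P' where P': "\<And>j. 2 * \<eta> \<le> norm (m $ j - P')"
    and push: "\<And>\<epsilon>. \<epsilon> > 0 \<Longrightarrow> \<exists>h\<^sub>0>0. \<forall>h. 0 < h \<and> h < h\<^sub>0 \<longrightarrow> pushes_in h i m P' \<eta> (\<rho> i) \<epsilon>"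
    using \<rho>(2)[of i, unfolded pushes_def, THEN spec, THEN mp, OF msep] by blast
  have P'm: "m $ j \<noteq> P'" for j using P'[of j] \<open>\<eta> > 0\<close> by auto
  have P_notin: "P \<notin> range (($) m)" "P' \<notin> range (($) m)"
    using not_sym[OF P] not_sym[OF P'm] by (auto simp: image_iff)
  obtain q :: "real \<Rightarrow> real^'d" where "continuous_on {0..1} q \<and> q 0 = P \<and> q 1 = P' \<and> (\<forall>t\<in>{0..1}. q t \<notin> range (($) m))"
    by (rule exE[OF path_avoiding_finite[OF dim finite_imageI[OF finite] P_notin]], rule that)
  then have q: "continuous_on {0..1} q" "q 0 = P" "q 1 = P'" "\<And>t. t \<in> {0..1} \<Longrightarrow> q t \<notin> range (($) m)"
    by blast+
  have qm: "m $ j \<noteq> q t" if "t \<in> {0..1}" for t j using q(4)[OF that] by (metis rangeI)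
  obtain \<epsilon>\<^sub>0 where e0: "\<epsilon>\<^sub>0 > 0"
    and travel: "\<And>\<epsilon>. \<epsilon> > 0 \<Longrightarrow> \<exists>T\<^sub>0>0. \<forall>T. 0 < T \<and> T < T\<^sub>0 \<longrightarrow> travels_in T m P P' \<epsilon>\<^sub>0 \<epsilon>"
    using travel_stage[OF m_off q(1) qm] unfolding q(2,3) by blast
  define R' where "R' = min R (min (\<epsilon>\<^sub>0 / 2) (min (\<rho> i / 2) (\<eta> / (8 * N))))"
  have R': "R' > 0" "R' \<le> R" "R' \<le> \<epsilon>\<^sub>0 / 2" "R' \<le> \<rho> i / 2" "R' \<le> \<eta> / (8 * N)"
    using \<open>R > 0\<close> e0 \<rho>(1)[of i] \<open>\<eta> > 0\<close> N unfolding R'_def by auto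
  have mix: "norm (mixed Z u a $ j - m $ j) \<le> R'" if "u \<in> cball b R'" for u j
  proof -
    have "norm (u $ Some j - b $ Some j) \<le> R'"
      using that norm_component_diff_le[of u "Some j" b] by (simp add: dist_norm norm_minus_commute)
    then show ?thesis using R'(1) by (simp add: mixed_def m_def)
  qed
  show ?case
  proof (rule exI[of _ R'], rule conjI, rule R'(1), rule exI[of _ P'], rule conjI; intro allI impI)
    show "mixed (insert i Z) b a $ j \<noteq> P'" for j
    proof (cases "j = i")
      case True
      have "m $ i - P' = (b $ Some i - P') - (b $ Some i - a $ Some i)"
        using insert.hyps by (simp add: m_def mixed_def)
      then have "norm (m $ i - P') \<le> norm (b $ Some i - P') + norm (b $ Some i - a $ Some i)"
        by (simp only: norm_triangle_ineq4)
      then have "b $ Some i \<noteq> P'" using P'[of i] close(2)[of i] \<open>\<eta> > 0\<close> by auto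
      then show ?thesis using True by (simp add: mixed_def)
    next
      case False
      then show ?thesis using P'm[of j] by (simp add: mixed_def m_def)
    qed
    fix \<epsilon> :: real assume "\<epsilon> > 0"
    define \<epsilon>' where "\<epsilon>' = min (\<epsilon> / 3) (min (\<epsilon>\<^sub>0 / 2) (\<eta> / (16 * N)))"
    have e': "\<epsilon>' > 0" "3 * \<epsilon>' \<le> \<epsilon>" "\<epsilon>' \<le> \<epsilon>\<^sub>0 / 2" "\<epsilon>' \<le> \<eta> / (16 * N)"
      using \<open>\<epsilon> > 0\<close> e0 \<open>\<eta> > 0\<close> N unfolding \<epsilon>'_def by auto
    obtain h1 where h1: "h1 > 0" "\<And>h. 0 < h \<and> h < h1 \<Longrightarrow>
      steers (cball b R) h (\<lambda>_. a) (\<lambda>u z. z $ None = P \<and> (\<forall>j. norm (z $ Some j - mixed Z u a $ j) \<le> \<epsilon>'))"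
      using IH[OF e'(1)] by blast
    obtain h2 where h2: "h2 > 0" "\<forall>T. 0 < T \<and> T < h2 \<longrightarrow> travels_in T m P P' \<epsilon>\<^sub>0 \<epsilon>'"
      using travel[OF e'(1)] by blast
    obtain h3 where h3: "h3 > 0" "\<forall>h. 0 < h \<and> h < h3 \<longrightarrow> pushes_in h i m P' \<eta> (\<rho> i) \<epsilon>'"
      using push[OF e'(1)] by blast
    define h\<^sub>0 where "h\<^sub>0 = min h1 (min h2 h3)"
    have "h\<^sub>0 > 0" using h1(1) h2(1) h3(1) by (simp add: h\<^sub>0_def)
    moreover have "steers (cball b R') h (\<lambda>_. a)
        (\<lambda>u z. z $ None = P' \<and> (\<forall>j. norm (z $ Some j - mixed (insert i Z) u a $ j) \<le> \<epsilon>))"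
      if h: "0 < h" "h < h\<^sub>0" for h
    proof -
      let ?U = "cball b R'"
      have hh: "0 < h / 3 \<and> h / 3 < h1" "0 < h / 3 \<and> h / 3 < h2" "0 < h / 3 \<and> h / 3 < h3"
        using h by (auto simp: h\<^sub>0_def)
      have 1: "steers ?U (h / 3) (\<lambda>_. a) (\<lambda>u z. z $ None = P \<and> (\<forall>j. norm (z $ Some j - mixed Z u a $ j) \<le> \<epsilon>'))"
        using R'(2) by (intro steers_subset[OF h1(2)[OF hh(1)]]) auto
      have 2: "steers ?U (h / 3) V (\<lambda>u z. z $ None = P' \<and> (\<forall>j. norm (z $ Some j - mixed Z u a $ j) \<le> 2 * \<epsilon>'))"
        if V: "continuous_on ?U V" "\<And>u. u \<in> ?U \<Longrightarrow> V u $ None = P \<and> (\<forall>j. norm (V u $ Some j - mixed Z u a $ j) \<le> \<epsilon>')" for V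
      proof -
        have "norm (V u $ Some j - m $ j) \<le> \<epsilon>\<^sub>0" if "u \<in> ?U" for u j
          using V(2)[OF that] mix[OF that, of j] e'(3) R'(3)
            norm_triangle_ineq[of "V u $ Some j - mixed Z u a $ j" "mixed Z u a $ j - m $ j"]
          by (auto dest!: spec[of _ j])
        then have "steers ?U (h / 3) V (\<lambda>u z. z $ None = P' + 0 \<and> (\<forall>j. norm (z $ Some j - V u $ Some j) \<le> \<epsilon>'))"
          using V e0 by (intro h2(2)[rule_format, OF hh(2), unfolded travels_in_def, rule_format]) auto
        then show ?thesis
        proof (rule steers_mono)
          fix u z assume u: "u \<in> ?U" and z: "z $ None = P' + 0 \<and> (\<forall>j. norm (z $ Some j - V u $ Some j) \<le> \<epsilon>')"
          have "norm (z $ Some j - mixed Z u a $ j) \<le> 2 * \<epsilon>'" for j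
            using norm_triangle_ineq[of "z $ Some j - V u $ Some j" "V u $ Some j - mixed Z u a $ j"] V(2)[OF u] z
            by (auto dest!: spec[of _ j])
          then show "z $ None = P' \<and> (\<forall>j. norm (z $ Some j - mixed Z u a $ j) \<le> 2 * \<epsilon>')" using z by simp
        qed
      qed
      have 3: "steers ?U (h / 3) V (\<lambda>u z. z $ None = P' \<and> (\<forall>j. norm (z $ Some j - mixed (insert i Z) u a $ j) \<le> \<epsilon>))"
        if V: "continuous_on ?U V" "\<And>u. u \<in> ?U \<Longrightarrow> V u $ None = P' \<and> (\<forall>j. norm (V u $ Some j - mixed Z u a $ j) \<le> 2 * \<epsilon>')" for V
      proof -
        define D where "D u = u $ Some i - a $ Some i" for u :: "(real^'d)^('n option)"
        have D_le: "norm (D u) \<le> \<rho> i" if "u \<in> ?U" for u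
        proof -
          have "norm (u $ Some i - b $ Some i) \<le> \<rho> i / 2"
            using that norm_component_diff_le[of u "Some i" b] R'(4) by (simp add: dist_norm norm_minus_commute)
          then show ?thesis
            using close(1)[of i] norm_triangle_ineq[of "u $ Some i - b $ Some i" "b $ Some i - a $ Some i"]
            by (simp add: D_def)
        qed
        have near: "norm (particles (V u) - m) \<le> \<eta> / 4" if "u \<in> ?U" for u
        proof -
          have "norm (particles (V u) $ j - m $ j) \<le> \<eta> / (4 * N)" for j
          proof -
            have "norm (V u $ Some j - mixed Z u a $ j) \<le> 2 * \<epsilon>'" using V(2)[OF that] by blast
            moreover have "\<eta> / (16 * N) = \<eta> / (4 * N) / 4" "\<eta> / (8 * N) = \<eta> / (4 * N) / 2" by simp_all
            ultimately show ?thesis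
              using mix[OF that, of j] e'(4) R'(5)
                norm_triangle_ineq[of "V u $ Some j - mixed Z u a $ j" "mixed Z u a $ j - m $ j"]
              by simp
          qed
          then have "norm (particles (V u) - m) \<le> N * (\<eta> / (4 * N))"
            unfolding N_def by (rule norm_diff_le_sum_components)
          then show ?thesis using N by simp
        qed
        have "steers ?U (h / 3) V (\<lambda>u z. z $ None = P' \<and>
            (\<forall>j. norm (z $ Some j - V u $ Some j - (if j = i then D u else 0)) \<le> \<epsilon>'))"
          using V near D_le unfolding D_def by (intro h3(2)[rule_format, OF hh(3), unfolded pushes_in_def, rule_format] continuous_intros) auto
        then show ?thesis
        proof (rule steers_mono)
          fix u z assume u: "u \<in> ?U" and z: "z $ None = P' \<and>
            (\<forall>j. norm (z $ Some j - V u $ Some j - (if j = i then D u else 0)) \<le> \<epsilon>')"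
          have "norm (z $ Some j - mixed (insert i Z) u a $ j) \<le> \<epsilon>" for j
          proof -
            have "mixed (insert i Z) u a $ j = mixed Z u a $ j + (if j = i then D u else 0)"
              using insert.hyps by (simp add: mixed_def D_def)
            then have "z $ Some j - mixed (insert i Z) u a $ j
                = (z $ Some j - V u $ Some j - (if j = i then D u else 0)) + (V u $ Some j - mixed Z u a $ j)"
              by simp
            also have "norm \<dots> \<le> \<epsilon>' + 2 * \<epsilon>'"
              using z V(2)[OF u] by (intro norm_triangle_le add_mono) auto
            finally show ?thesis using e'(2) by simp
          qed
          then show "z $ None = P' \<and> (\<forall>j. norm (z $ Some j - mixed (insert i Z) u a $ j) \<le> \<epsilon>)" using z by simp
        qed
      qed
      have "steers ?U (h / 3 + (h / 3 + h / 3)) (\<lambda>_. a)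
        (\<lambda>u z. z $ None = P' \<and> (\<forall>j. norm (z $ Some j - mixed (insert i Z) u a $ j) \<le> \<epsilon>))"
      proof (rule steers_append[OF _ _ _ 1])
        fix V assume V: "continuous_on ?U V"
          "\<And>u. u \<in> ?U \<Longrightarrow> V u $ None = P \<and> (\<forall>j. norm (V u $ Some j - mixed Z u a $ j) \<le> \<epsilon>')"
        show "steers ?U (h / 3 + h / 3) V
          (\<lambda>u z. z $ None = P' \<and> (\<forall>j. norm (z $ Some j - mixed (insert i Z) u a $ j) \<le> \<epsilon>))"
          by (rule steers_append[OF _ _ _ 2[OF V] 3]) (use h in simp_all)
      qed (use h in auto)
      then show ?thesis by simp
    qed
    ultimately show "\<exists>h\<^sub>0>0. \<forall>h. 0 < h \<and> h < h\<^sub>0 \<longrightarrow> steers (cball b R') h (\<lambda>_. a)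
        (\<lambda>u z. z $ None = P' \<and> (\<forall>j. norm (z $ Some j - mixed (insert i Z) u a $ j) \<le> \<epsilon>))"
      by blast
  qed
qed


text \<open>
  Once all particles are in place, the controlled one travels to its own target.
\<close>

lemma local_steering:
  fixes a b :: "(real^'d)^('n option)"
  assumes a: "a \<in> - diagonals" and b: "b \<in> - diagonals" and "\<eta> > 0"
    and sep: "\<And>Z k l. k \<noteq> l \<Longrightarrow> 4 * \<eta> \<le> norm (mixed Z b a $ k - mixed Z b a $ l)"
    and \<rho>: "\<And>i. \<rho> i > 0" "\<And>i. pushes i \<eta> (\<rho> i)"
    and close: "\<And>i. norm (b $ Some i - a $ Some i) \<le> \<rho> i / 2" "\<And>i. norm (b $ Some i - a $ Some i) \<le> \<eta>"
  shows "\<exists>R>0. \<exists>h\<^sub>0>0. \<forall>h. 0 < h \<and> h < h\<^sub>0 \<longrightarrow> steers (cball b R) h (\<lambda>_. a) (\<lambda>u z. norm (z - u) \<le> R / 4)"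
proof -
  define m where "m = particles b"
  define N where "N = real CARD('n)"
  have N: "N \<ge> 1" by (simp add: N_def Suc_le_eq)
  have m0: "mixed UNIV u a = particles u" for u by (simp add: mixed_def particles_def)
  obtain R P where "R > 0" and P: "\<And>j. m $ j \<noteq> P"
    and turn: "\<And>\<epsilon>. \<epsilon> > 0 \<Longrightarrow> \<exists>h\<^sub>0>0. \<forall>h. 0 < h \<and> h < h\<^sub>0 \<longrightarrow>
      steers (cball b R) h (\<lambda>_. a) (\<lambda>u z. z $ None = P \<and> (\<forall>j. norm (z $ Some j - u $ Some j) \<le> \<epsilon>))"
    using push_particles_in_turn[OF a \<open>\<eta> > 0\<close> sep \<rho> close finite_class.finite_UNIV]
    unfolding m0 m_def particles_nth by blast
  have m_off: "m \<in> - diagonals" unfolding m_def by (rule particles_off_diagonals[OF b])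
  have bm: "b $ None \<noteq> m $ j" for j
    using off_diagonalsD[OF b, of None "Some j"] by (simp add: m_def)
  have notin: "P \<notin> range (($) m)" "b $ None \<notin> range (($) m)"
    using not_sym[OF P] bm by (auto simp: image_iff)
  obtain q :: "real \<Rightarrow> real^'d" where "continuous_on {0..1} q \<and> q 0 = P \<and> q 1 = b $ None \<and> (\<forall>t\<in>{0..1}. q t \<notin> range (($) m))"
    by (rule exE[OF path_avoiding_finite[OF dim finite_imageI[OF finite] notin]], rule that)
  then have q: "continuous_on {0..1} q" "q 0 = P" "q 1 = b $ None" "\<And>t. t \<in> {0..1} \<Longrightarrow> q t \<notin> range (($) m)"
    by blast+
  have qm: "m $ j \<noteq> q t" if "t \<in> {0..1}" for t j using q(4)[OF that] by (metis rangeI)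
  obtain \<epsilon>\<^sub>0 where e0: "\<epsilon>\<^sub>0 > 0"
    and travel: "\<And>\<epsilon>. \<epsilon> > 0 \<Longrightarrow> \<exists>T\<^sub>0>0. \<forall>T. 0 < T \<and> T < T\<^sub>0 \<longrightarrow> travels_in T m P (b $ None) \<epsilon>\<^sub>0 \<epsilon>"
    using travel_stage[OF m_off q(1) qm] unfolding q(2,3) by blast
  define R' where "R' = min R (\<epsilon>\<^sub>0 / 2)"
  have R': "R' > 0" "R' \<le> R" "R' \<le> \<epsilon>\<^sub>0 / 2" using \<open>R > 0\<close> e0 by (auto simp: R'_def)
  define \<epsilon>' where "\<epsilon>' = min (\<epsilon>\<^sub>0 / 2) (R' / (8 * N))"
  have e': "\<epsilon>' > 0" "\<epsilon>' \<le> \<epsilon>\<^sub>0 / 2" "\<epsilon>' \<le> R' / (8 * N)"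
    using R' e0 N unfolding \<epsilon>'_def by auto
  let ?U = "cball b R'"
  have ub: "norm (u $ k - b $ k) \<le> R'" if "u \<in> ?U" for u k
    using that norm_component_diff_le[of u k b] by (simp add: dist_norm norm_minus_commute)
  obtain h1 where h1: "h1 > 0" "\<forall>h. 0 < h \<and> h < h1 \<longrightarrow>
      steers (cball b R) h (\<lambda>_. a) (\<lambda>u z. z $ None = P \<and> (\<forall>j. norm (z $ Some j - u $ Some j) \<le> \<epsilon>'))"
    using turn[OF e'(1)] by blast
  obtain h2 where h2: "h2 > 0" "\<forall>T. 0 < T \<and> T < h2 \<longrightarrow> travels_in T m P (b $ None) \<epsilon>\<^sub>0 \<epsilon>'"
    using travel[OF e'(1)] by blast
  have "steers ?U h (\<lambda>_. a) (\<lambda>u z. norm (z - u) \<le> R' / 4)" if h: "0 < h" "h < min h1 h2" for h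
  proof -
    have hh: "0 < h / 2 \<and> h / 2 < h1" "0 < h / 2 \<and> h / 2 < h2" using h by auto
    have 1: "steers ?U (h / 2) (\<lambda>_. a) (\<lambda>u z. z $ None = P \<and> (\<forall>j. norm (z $ Some j - u $ Some j) \<le> \<epsilon>'))"
      using R'(2) by (intro steers_subset[OF h1(2)[rule_format, OF hh(1)]]) auto
    have 2: "steers ?U (h / 2) V (\<lambda>u z. norm (z - u) \<le> R' / 4)"
      if V: "continuous_on ?U V" "\<And>u. u \<in> ?U \<Longrightarrow> V u $ None = P \<and> (\<forall>j. norm (V u $ Some j - u $ Some j) \<le> \<epsilon>')" for V
    proof -
      have "norm (V u $ Some j - m $ j) \<le> \<epsilon>\<^sub>0" if u: "u \<in> ?U" for u j
      proof -
        have "norm (V u $ Some j - u $ Some j) \<le> \<epsilon>'" using V(2)[OF u] by blast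
        then show ?thesis
          using ub[OF u, of "Some j"] e'(2) R'(3)
            norm_triangle_ineq[of "V u $ Some j - u $ Some j" "u $ Some j - b $ Some j"]
          by (simp add: m_def)
      qed
      then have "steers ?U (h / 2) V (\<lambda>u z. z $ None = b $ None + (u $ None - b $ None) \<and>
          (\<forall>j. norm (z $ Some j - V u $ Some j) \<le> \<epsilon>'))"
      proof (intro h2(2)[rule_format, OF hh(2), unfolded travels_in_def, rule_format] V(1) continuous_intros conjI allI)
        show "norm (u $ None - b $ None) \<le> \<epsilon>\<^sub>0" if "u \<in> ?U" for u
          using ub[OF that, of None] R'(3) e0 by linarith
      qed (use V in auto)
      then show ?thesis
      proof (rule steers_mono)
        fix u z assume u: "u \<in> ?U" and z: "z $ None = b $ None + (u $ None - b $ None) \<and>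
          (\<forall>j. norm (z $ Some j - V u $ Some j) \<le> \<epsilon>')"
        have "norm (particles z $ j - particles u $ j) \<le> R' / (4 * N)" for j
        proof -
          have "norm (V u $ Some j - u $ Some j) \<le> \<epsilon>'" "norm (z $ Some j - V u $ Some j) \<le> \<epsilon>'"
            using V(2)[OF u] z by blast+
          moreover have "R' / (8 * N) = R' / (4 * N) / 2" by simp
          ultimately show ?thesis
            using e'(3) norm_triangle_ineq[of "z $ Some j - V u $ Some j" "V u $ Some j - u $ Some j"] by simp
        qed
        then have "norm (particles z - particles u) \<le> N * (R' / (4 * N))"
          unfolding N_def by (rule norm_diff_le_sum_components)
        then have "norm (particles z - particles u) \<le> R' / 4" using N by simp
        moreover have "norm (z - u) \<le> norm (particles z - particles u) + norm (z $ None - u $ None)"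
          using norm_join_le[of "particles z - particles u" "z $ None - u $ None"]
            join_diff[of "particles z" "z $ None" "particles u" "u $ None"] by simp
        ultimately show "norm (z - u) \<le> R' / 4" using z by simp
      qed
    qed
    have "steers ?U (h / 2 + h / 2) (\<lambda>_. a) (\<lambda>u z. norm (z - u) \<le> R' / 4)"
      by (rule steers_append[OF _ _ _ 1 2]) (use h in simp_all)
    then show ?thesis by simp
  qed
  with R'(1) h1(1) h2(1) show ?thesis
    by (intro exI[of _ R'] conjI exI[of _ "min h1 h2"]) auto
qed

text \<open>
  The radius \<open>r\<close> depends on \<open>c\<close> only through the mutual distances of the uncontrolled particles, because
  pushes of a fixed length are possible in arbitrarily short time. Only \<open>R\<close> and \<open>h\<^sub>0\<close> depend on \<open>a\<close> and \<open>b\<close>, in particular on how close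
  the controlled particle is to the others.
\<close>

lemma steering_near:
  fixes c :: "(real^'d)^('n option)"
  assumes c: "c \<in> - diagonals"
  obtains r where "r > 0" and "\<And>a b. a \<in> - diagonals \<Longrightarrow> b \<in> - diagonals \<Longrightarrow> norm (a - c) < r \<Longrightarrow> norm (b - c) < r \<Longrightarrow>
    \<exists>R>0. \<exists>h\<^sub>0>0. \<forall>h. 0 < h \<and> h < h\<^sub>0 \<longrightarrow> steers (cball b R) h (\<lambda>_. a) (\<lambda>u z. norm (z - u) \<le> R / 4)"
proof -
  define D where "D = insert 1 ((\<lambda>(k, l). norm (c $ Some k - c $ Some l)) ` {(k, l). k \<noteq> l})"
  have D: "finite D" "D \<noteq> {}" by (auto simp: D_def)
  \<comment> \<open>Half of the distances in \<open>c\<close> survives in configurations near \<open>c\<close>, and \<open>pushes\<close> needs \<open>4 * \<eta>\<close>. The entry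
      \<open>1\<close> of \<open>D\<close> covers the case of a single particle.\<close>
  define \<eta> where "\<eta> = Min D / 8"
  have "x > 0" if "x \<in> D" for x
    using that off_diagonalsD[OF c, of "Some k" "Some l" for k l] by (auto simp: D_def)
  then have "\<eta> > 0" using Min_in[OF D] by (simp add: \<eta>_def)
  have csep: "8 * \<eta> \<le> norm (c $ Some k - c $ Some l)" if "k \<noteq> l" for k l
    using that D by (auto simp: \<eta>_def D_def intro!: Min_le)
  have "\<exists>\<rho>>0. pushes i \<eta> \<rho>" for i using push_particle[OF \<open>\<eta> > 0\<close>, of i] by blast
  then obtain \<rho> where \<rho>: "\<And>i. \<rho> i > 0" "\<And>i. pushes i \<eta> (\<rho> i)" by metis
  define r where "r = min (\<eta> / 2) (Min (range \<rho>) / 4)"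
  have "r > 0" using \<rho>(1) \<open>\<eta> > 0\<close> by (simp add: r_def)
  moreover have "r \<le> \<eta> / 2" "r \<le> Min (range \<rho>) / 4"
    unfolding r_def by (rule min.cobounded1, rule min.cobounded2)
  moreover have "Min (range \<rho>) \<le> \<rho> i" for i by simp
  ultimately have r: "r > 0" "r \<le> \<eta> / 2" "r \<le> \<rho> i / 4" for i
    using order_trans[of r "Min (range \<rho>) / 4" "\<rho> i / 4"] by (simp_all only: divide_right_mono zero_le_numeral)
  show ?thesis
  proof (rule that[OF r(1)])
    fix a b assume ab: "a \<in> - diagonals" "b \<in> - diagonals" "norm (a - c) < r" "norm (b - c) < r"
    have ac: "norm (a $ k - c $ k) \<le> r" and bc: "norm (b $ k - c $ k) \<le> r" for k
      using norm_component_diff_le[of a k c] norm_component_diff_le[of b k c] ab(3,4) by linarith+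
    have dist_ba: "norm (b $ k - a $ k) \<le> 2 * r" for k
      using norm_triangle_ineq4[of "b $ k - c $ k" "a $ k - c $ k"] ac[of k] bc[of k] by simp
    have mc: "norm (mixed Z b a $ k - c $ Some k) \<le> r" for Z k
      using ac[of "Some k"] bc[of "Some k"] by (simp add: mixed_def)
    have sep: "4 * \<eta> \<le> norm (mixed Z b a $ k - mixed Z b a $ l)" if "k \<noteq> l" for Z k l
    proof -
      have "norm (c $ Some k - c $ Some l) \<le> norm (mixed Z b a $ k - mixed Z b a $ l)
          + norm (mixed Z b a $ k - c $ Some k) + norm (mixed Z b a $ l - c $ Some l)"
        using norm_triangle_three[of "mixed Z b a $ k - mixed Z b a $ l" "mixed Z b a $ k - c $ Some k" "mixed Z b a $ l - c $ Some l"]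
        by simp
      then show ?thesis using csep[OF that] mc[of Z k] mc[of Z l] r(2) \<open>\<eta> > 0\<close> by linarith
    qed
    have close: "norm (b $ Some i - a $ Some i) \<le> \<rho> i / 2" "norm (b $ Some i - a $ Some i) \<le> \<eta>" for i
      using dist_ba[of "Some i"] r(2) r(3)[of i] by linarith+
    show "\<exists>R>0. \<exists>h\<^sub>0>0. \<forall>h. 0 < h \<and> h < h\<^sub>0 \<longrightarrow> steers (cball b R) h (\<lambda>_. a) (\<lambda>u z. norm (z - u) \<le> R / 4)"
      by (rule local_steering[OF ab(1,2) \<open>\<eta> > 0\<close> sep \<rho> close])
  qed
qed

section \<open>From approximate families to exact reachability\<close>

definition reaches :: "real \<Rightarrow> (real^'d)^('n option) \<Rightarrow> (real^'d)^('n option) \<Rightarrow> bool" where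
  "reaches T a b \<longleftrightarrow> steers {0::real} T (\<lambda>_. a) (\<lambda>_ z. z = b)"

lemma reaches_trans: "0 \<le> S \<Longrightarrow> 0 \<le> T \<Longrightarrow> reaches S a b \<Longrightarrow> reaches T b c \<Longrightarrow> reaches (S + T) a c"
  unfolding reaches_def
  by (rule steers_append[where R = "\<lambda>_ z. z = b"]) (auto elim: steers_cong)

lemma reaches_if_steers:
  assumes "R > 0" "0 \<le> h" and st: "steers (cball b R) h (\<lambda>_. a) (\<lambda>u z. norm (z - u) \<le> R / 4)"
  shows "reaches h a b"
proof -
  obtain w where w: "is_family (cball b R) h w" "\<And>u. u \<in> cball b R \<Longrightarrow> w u 0 = a"
    "\<And>u. u \<in> cball b R \<Longrightarrow> norm (w u h - u) \<le> R / 4"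
    using st unfolding steers_def by blast
  have "continuous_on (cball b R) (\<lambda>u. w u h)"
    by (rule is_family_eval[OF w(1)]) (use \<open>0 \<le> h\<close> in simp)
  from brouwer_covering[OF \<open>R > 0\<close> this w(3), of b] \<open>R > 0\<close>
  obtain u where u: "u \<in> cball b R" "w u h = b" by auto
  have "is_family {0::real} h (\<lambda>_. w u)"
    using is_family_reindex[OF w(1), of "{0::real}" "\<lambda>_. u"] u(1) by simp
  then show ?thesis
    unfolding reaches_def steers_def using w(2)[OF u(1)] u(2) by (intro exI[of _ "\<lambda>_. w u"]) auto
qed

text \<open>
  A state that can be regained exactly after every short time can be regained after any time.
\<close>

lemma reaches_self:
  assumes "h\<^sub>0 > 0" and short: "\<And>h. 0 < h \<Longrightarrow> h < h\<^sub>0 \<Longrightarrow> reaches h a a" and "T > 0"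
  shows "reaches T a a"
proof -
  obtain n where n: "T / h\<^sub>0 < real n" using reals_Archimedean2 by blast
  have "0 < T / h\<^sub>0" using assms(1,3) by simp
  then have "n > 0" using n by (cases n) auto
  define h where "h = T / real n"
  have h: "0 < h" "h < h\<^sub>0" using n \<open>n > 0\<close> assms(1,3) by (auto simp: h_def field_simps)
  have "reaches (real (Suc k) * h) a a" for k
  proof (induction k)
    case 0
    then show ?case using short[OF h] by simp
  next
    case (Suc k)
    then have "reaches (real (Suc k) * h + h) a a"
      using h by (intro reaches_trans[OF _ _ Suc short[OF h]]) auto
    then show ?case by (simp add: algebra_simps)
  qed
  from this[of "n - 1"] show ?thesis using \<open>n > 0\<close> by (simp add: h_def)
qed

lemma reaches_near:
  assumes c: "c \<in> - diagonals"
  obtains r where "r > 0" and "\<And>a b T. a \<in> - diagonals \<Longrightarrow> b \<in> - diagonals \<Longrightarrow> norm (a - c) < r \<Longrightarrow> norm (b - c) < r \<Longrightarrow>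
    T > 0 \<Longrightarrow> reaches T a b"
proof -
  obtain r where r: "r > 0" and steer: "\<And>a b. a \<in> - diagonals \<Longrightarrow> b \<in> - diagonals \<Longrightarrow> norm (a - c) < r \<Longrightarrow> norm (b - c) < r \<Longrightarrow>
    \<exists>R>0. \<exists>h\<^sub>0>0. \<forall>h. 0 < h \<and> h < h\<^sub>0 \<longrightarrow> steers (cball b R) h (\<lambda>_. a) (\<lambda>u z. norm (z - u) \<le> R / 4)"
    using steering_near[OF c] by blast
  have short: "\<exists>h\<^sub>0>0. \<forall>h. 0 < h \<and> h < h\<^sub>0 \<longrightarrow> reaches h a b"
    if ab: "a \<in> - diagonals" "b \<in> - diagonals" "norm (a - c) < r" "norm (b - c) < r" for a b
  proof -
    obtain R h\<^sub>0 where "R > 0" "h\<^sub>0 > 0"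
      and st: "\<And>h. 0 < h \<and> h < h\<^sub>0 \<Longrightarrow> steers (cball b R) h (\<lambda>_. a) (\<lambda>u z. norm (z - u) \<le> R / 4)"
      using steer[OF ab] by blast
    have "reaches h a b" if "0 < h \<and> h < h\<^sub>0" for h
      using that by (intro reaches_if_steers[OF \<open>R > 0\<close> _ st]) auto
    then show ?thesis using \<open>h\<^sub>0 > 0\<close> by blast
  qed
  show ?thesis
  proof (rule that[OF r])
    fix a b T assume ab: "a \<in> - diagonals" "b \<in> - diagonals" "norm (a - c) < r" "norm (b - c) < r" and "(T::real) > 0"
    obtain h\<^sub>0 where h0: "h\<^sub>0 > 0" "\<And>h. 0 < h \<and> h < h\<^sub>0 \<Longrightarrow> reaches h a b" using short[OF ab] by blast
    obtain h\<^sub>1 where h1: "h\<^sub>1 > 0" "\<And>h. 0 < h \<and> h < h\<^sub>1 \<Longrightarrow> reaches h b b" using short[OF ab(2,2,4,4)] by blast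
    define h where "h = min h\<^sub>0 T / 2"
    have h: "0 < h" "h < h\<^sub>0" "h < T" using h0(1) \<open>T > 0\<close> by (auto simp: h_def)
    have "reaches (T - h) b b"
      using h by (intro reaches_self[OF h1(1) h1(2)]) auto
    then have "reaches (h + (T - h)) a b"
      using h by (intro reaches_trans[OF _ _ h0(2)]) auto
    then show "reaches T a b" by simp
  qed
qed

text \<open>
  Being reachable from each other in every time is an equivalence relation with open classes on a
  connected set.
\<close>

lemma reaches_all:
  assumes ab: "a \<in> - diagonals" "b \<in> - diagonals" and "T > 0"
  shows "reaches T a b"
proof -
  have "(\<forall>T>0. reaches T a b) \<and> (\<forall>T>0. reaches T b a)"
  proof (rule connected_equivalence_relation[OF connected_off_diagonals[OF dim] ab,
        where R = "\<lambda>a b. (\<forall>T>0. reaches T a b) \<and> (\<forall>T>0. reaches T b a)"])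
    show "(\<forall>T>0. reaches T y x) \<and> (\<forall>T>0. reaches T x y)"
      if "(\<forall>T>0. reaches T x y) \<and> (\<forall>T>0. reaches T y x)" for x y
      using that by blast
    have tr: "\<forall>T>0. reaches T x z" if xy: "\<forall>T>0. reaches T x y" and yz: "\<forall>T>0. reaches T y z" for x y z
    proof (intro allI impI)
      fix T :: real assume "T > 0"
      then have "reaches (T / 2 + T / 2) x z"
        using xy yz by (intro reaches_trans[of "T / 2" "T / 2" x y z]) auto
      then show "reaches T x z" by simp
    qed
    show "(\<forall>T>0. reaches T x z) \<and> (\<forall>T>0. reaches T z x)"
      if "(\<forall>T>0. reaches T x y) \<and> (\<forall>T>0. reaches T y x)" "(\<forall>T>0. reaches T y z) \<and> (\<forall>T>0. reaches T z y)" for x y z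
      using that tr[of x y z] tr[of z y x] by blast
    fix c :: "(real^'d)^('n option)" assume c: "c \<in> - diagonals"
    obtain r where r: "r > 0" and near: "\<And>a b T. a \<in> - diagonals \<Longrightarrow> b \<in> - diagonals \<Longrightarrow>
      norm (a - c) < r \<Longrightarrow> norm (b - c) < r \<Longrightarrow> T > 0 \<Longrightarrow> reaches T a b"
      using reaches_near[OF c] by blast
    show "\<exists>V. openin (top_of_set (- diagonals)) V \<and> c \<in> V \<and>
      (\<forall>x\<in>V. (\<forall>T>0. reaches T c x) \<and> (\<forall>T>0. reaches T x c))"
    proof (intro exI[of _ "- diagonals \<inter> ball c r"] conjI ballI)
      show "openin (top_of_set (- diagonals)) (- diagonals \<inter> ball c r)" by (intro openin_open_Int) auto
      show "c \<in> - diagonals \<inter> ball c r" using c r by simp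
      fix x assume x: "x \<in> - diagonals \<inter> ball c r"
      then have "x \<in> - diagonals" "norm (x - c) < r" by (auto simp: dist_norm norm_minus_commute)
      then show "\<forall>T>0. reaches T c x" "\<forall>T>0. reaches T x c"
        using near[OF c] near[OF _ c] r by auto
    qed
  qed
  then show ?thesis using \<open>T > 0\<close> by blast
qed

text \<open>
  It suffices to reach the centre \<open>c\<close> exactly a short time before \<open>T\<close>, and to spread out only then.
\<close>

lemma steering_family:
  assumes a: "a \<in> - diagonals" and c: "c \<in> - diagonals" and "T > 0"
  obtains R where "R > 0" "steers (cball c R) T (\<lambda>_. a) (\<lambda>u z. norm (z - u) \<le> R / 4)"
proof -
  obtain r where "r > 0" and r: "\<And>a b. a \<in> - diagonals \<Longrightarrow> b \<in> - diagonals \<Longrightarrow> norm (a - c) < r \<Longrightarrow> norm (b - c) < r \<Longrightarrow>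
    \<exists>R>0. \<exists>h\<^sub>0>0. \<forall>h. 0 < h \<and> h < h\<^sub>0 \<longrightarrow> steers (cball b R) h (\<lambda>_. a) (\<lambda>u z. norm (z - u) \<le> R / 4)"
    using steering_near[OF c] by blast
  obtain R h\<^sub>0 where R: "R > 0" "h\<^sub>0 > 0"
    and st: "\<And>h. 0 < h \<and> h < h\<^sub>0 \<Longrightarrow> steers (cball c R) h (\<lambda>_. c) (\<lambda>u z. norm (z - u) \<le> R / 4)"
    using r[OF c c] \<open>r > 0\<close> by auto
  define h where "h = min h\<^sub>0 T / 2"
  have h: "0 < h \<and> h < h\<^sub>0" "h < T" using R(2) \<open>T > 0\<close> by (auto simp: h_def)
  have "reaches (T - h) a c" using h by (intro reaches_all a c) auto
  then obtain w where w: "is_family {0::real} (T - h) w" "w 0 0 = a" "w 0 (T - h) = c"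
    unfolding reaches_def steers_def by auto
  have "is_family (cball c R) (T - h) (\<lambda>_. w 0)"
    using is_family_reindex[OF w(1), of "cball c R" "\<lambda>_. 0"] by auto
  then have "steers (cball c R) (T - h) (\<lambda>_. a) (\<lambda>_ z. z = c)"
    unfolding steers_def using w(2,3) by (intro exI[of _ "\<lambda>_. w 0"]) auto
  then have "steers (cball c R) (T - h + h) (\<lambda>_. a) (\<lambda>u z. norm (z - u) \<le> R / 4)"
    using h st[OF h(1)] by (intro steers_append[of _ "T - h" h]) (auto elim: steers_cong)
  then show ?thesis using that R(1) by simp
qed


section \<open>Differentiable controls\<close>

text \<open>
  Replacing the path of the controlled particle by a uniformly close one changes the motion of the
  others only slightly, because their velocities are Lipschitz along the motion. So the path may be
  taken continuously differentiable, as the control requires.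
\<close>

lemma smooth_family:
  fixes U :: "'u::metric_space set"
  assumes U: "compact U" and T: "0 < T" and "0 < \<delta>" and w: "is_family U T w"
  obtains v z' where "is_family U T v" and "\<And>u. u \<in> U \<Longrightarrow> v u 0 = w u 0"
    and "\<And>u t. u \<in> U \<Longrightarrow> t \<in> {0..T} \<Longrightarrow> norm (v u t - w u t) \<le> \<delta>"
    and "\<And>u t. u \<in> U \<Longrightarrow> t \<in> {0..T} \<Longrightarrow> ((\<lambda>s. v u s $ None) has_vector_derivative z' u t) (at t within {0..T})"
    and "continuous_on (U \<times> {0..T}) (\<lambda>(u, t). z' u t)"
proof -
  have w_cont: "continuous_on (U \<times> {0..T}) (\<lambda>(u, t). w u t)" using w unfolding is_family_def by blast
  define Q where "Q = (\<lambda>(u, t). w u t) ` (U \<times> {0..T})"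
  have "compact Q"
    unfolding Q_def by (intro compact_continuous_image compact_Times w_cont U) auto
  moreover have "Q \<subseteq> - diagonals"
  proof
    fix z assume "z \<in> Q"
    then obtain u t where "u \<in> U" "t \<in> {0..T}" "z = w u t" unfolding Q_def by auto
    then show "z \<in> - diagonals" using is_family_slice(2)[OF w] by simp
  qed
  ultimately obtain d Q' where "d > 0" and Q': "compact Q'" "Q' \<subseteq> - diagonals"
    and Q'I: "\<And>z' z. z \<in> Q \<Longrightarrow> norm (z' - z) \<le> d \<Longrightarrow> z' \<in> Q'"
    using compact_thickening[OF _ open_off_diagonals] by metis
  have wQ: "w u t \<in> Q" if "u \<in> U" "t \<in> {0..T}" for u t
    unfolding Q_def using that by (intro image_eqI[of _ _ "(u, t)"]) auto
  obtain L where L: "L-lipschitz_on Q' drift" by (rule drift_lipschitz_compact[OF Q'])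
  have "L \<ge> 0" using L by (rule lipschitz_on_nonneg)
  define \<rho> where "\<rho> = min d \<delta> / 2"
  \<comment> \<open>By Gronwall's inequality a deviation \<open>\<epsilon>\<close> of the controlled particle grows to at most \<open>\<rho>\<close> in the others.\<close>
  define \<epsilon> where "\<epsilon> = \<rho> / exp (L * T)"
  have \<rho>: "\<rho> > 0" "2 * \<rho> \<le> d" "2 * \<rho> \<le> \<delta>" using \<open>d > 0\<close> \<open>\<delta> > 0\<close> by (auto simp: \<rho>_def)
  have "1 \<le> exp (L * T)" using \<open>L \<ge> 0\<close> T by simp
  then have \<epsilon>: "\<epsilon> > 0" "\<epsilon> \<le> \<rho>" "\<epsilon> * exp (L * T) = \<rho>"
    using \<rho>(1) divide_left_mono[of 1 "exp (L * T)" \<rho>] by (auto simp: \<epsilon>_def)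
  have y_cont: "continuous_on (U \<times> {0..T}) (\<lambda>(u, t). w u t $ None)"
    and r_cont: "continuous_on (U \<times> {0..T}) (\<lambda>(u, t). particles (w u t))"
    using w_cont unfolding case_prod_beta by (intro continuous_intros; simp)+
  obtain z z' where z: "continuous_on (U \<times> {0..T}) (\<lambda>(u, t). z u t)"
    and z'_cont: "continuous_on (U \<times> {0..T}) (\<lambda>(u, t). z' u t)"
    and z': "\<And>u t. u \<in> U \<Longrightarrow> t \<in> {0..T} \<Longrightarrow> (z u has_vector_derivative z' u t) (at t within {0..T})"
    and z0: "\<And>u. u \<in> U \<Longrightarrow> z u 0 = w u 0 $ None"
    and zy: "\<And>u t. u \<in> U \<Longrightarrow> t \<in> {0..T} \<Longrightarrow> norm (z u t - w u t $ None) \<le> \<epsilon>"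
    by (rule smooth_approximation[OF U T \<epsilon>(1) y_cont]) (rule that)
  have near: "norm (join (particles (w u t) + e) (z u t) - w u t) \<le> \<rho> + \<epsilon>"
    if "u \<in> U" "t \<in> {0..T}" "norm e \<le> \<rho>" for u t e
  proof -
    have "join (particles (w u t) + e) (z u t) - w u t = join e (z u t - w u t $ None)"
      using join_diff[of "particles (w u t) + e" "z u t" "particles (w u t)" "w u t $ None"] by simp
    then show ?thesis
      using norm_join_le[of e "z u t - w u t $ None"] that(3) zy[OF that(1,2)] by simp
  qed
  then have nearQ: "join (particles (w u t) + e) (z u t) \<in> Q'"
    if "u \<in> U" "t \<in> {0..T}" "norm e \<le> \<rho>" for u t e
    using near[OF that] \<rho>(2) \<epsilon>(2) by (intro Q'I[OF wQ[OF that(1,2)]]) linarith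
  have zY: "continuous_on (U \<times> {0..T} \<times> UNIV) (\<lambda>(u, t, x::(real^'d)^'n). z u t)"
  proof -
    have "continuous_on (U \<times> {0..T} \<times> (UNIV::((real^'d)^'n) set)) ((\<lambda>(u, t). z u t) \<circ> (\<lambda>q. (fst q, fst (snd q))))"
      by (intro continuous_on_compose continuous_intros continuous_on_subset[OF z]) auto
    then show ?thesis by (simp add: o_def case_prod_beta)
  qed
  have x0: "continuous_on U (\<lambda>u. particles (w u 0))"
    using T by (intro continuous_intros is_family_eval[OF w]) auto
  have lip0: "0-lipschitz_on UNIV (\<lambda>x::(real^'d)^'n. z u t)" for u t by (rule lipschitz_on_constant)
  obtain x where x_cont: "continuous_on (U \<times> {0..T}) (\<lambda>(u, t). x u t)"
    and x_eq: "\<And>u t. u \<in> U \<Longrightarrow> t \<in> {0..T} \<Longrightarrow> x u t = particles (w u 0) + integral {0..t} (\<lambda>s.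
      let c = particles (w u s) + clamp_ball \<rho> (x u s - particles (w u s)) in drift (join c (z u s)))"
    using tube_solution[OF U less_imp_le[OF T] less_imp_le[OF \<rho>(1)] r_cont zY lip0 subsetD[OF Q'(2) nearQ] x0]
    by blast
  define e where "e u s = x u s - particles (w u s)" for u s
  define W where "W u s = join (particles (w u s) + clamp_ball \<rho> (e u s)) (z u s)" for u s
  have x_eq: "x u t = particles (w u 0) + integral {0..t} (\<lambda>s. drift (W u s))" if "u \<in> U" "t \<in> {0..T}" for u t
    using x_eq[OF that] by (simp add: W_def e_def Let_def)
  have WQ: "W u t \<in> Q'" if "u \<in> U" "t \<in> {0..T}" for u t
    unfolding W_def using \<rho>(1) by (intro nearQ that norm_clamp_ball) simp
  have e_cont: "continuous_on {0..T} (e u)" if "u \<in> U" for u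
    unfolding e_def
    using continuous_on_slice[OF x_cont that] is_family_slice(1)[OF w that] by (intro continuous_intros)
  have W_cont: "continuous_on {0..T} (W u)" if "u \<in> U" for u
    unfolding W_def
    using continuous_on_slice[OF z that] is_family_slice(1)[OF w that] e_cont[OF that] \<rho>(1)
    by (intro continuous_intros) auto
  have e_small: "norm (e u t) \<le> \<rho>" if u: "u \<in> U" and t: "t \<in> {0..T}" for u t
  proof -
    have "norm (e u t) \<le> integral {0..t} (\<lambda>s. L * (norm (e u s) + \<epsilon>))" if t: "t \<in> {0..T}" for t
    proof -
      have cW: "continuous_on {0..t} (\<lambda>s. drift (W u s))"
      proof (rule continuous_on_drift_compose)
        show "continuous_on {0..t} (W u)" using W_cont[OF u] t by (auto elim: continuous_on_subset)
        show "W u s \<in> - diagonals" if "s \<in> {0..t}" for s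
          by (rule subsetD[OF Q'(2) WQ[OF u]]) (use that t in auto)
      qed
      have iw: "(\<lambda>s. drift (w u s)) integrable_on {0..t}"
        using t by (intro is_family_drift_integrable[OF w u]) auto
      have "e u t = integral {0..t} (\<lambda>s. drift (W u s)) - integral {0..t} (\<lambda>s. drift (w u s))"
        using x_eq[OF u t] is_family_eq[OF w u t] by (simp add: e_def)
      also have "\<dots> = integral {0..t} (\<lambda>s. drift (W u s) - drift (w u s))"
        by (intro integral_diff[symmetric] integrable_continuous_real cW iw)
      also have "norm \<dots> \<le> integral {0..t} (\<lambda>s. L * (norm (e u s) + \<epsilon>))"
      proof (rule Henstock_Kurzweil_Integration.integral_norm_bound_integral)
        show "(\<lambda>s. drift (W u s) - drift (w u s)) integrable_on {0..t}"
          by (intro integrable_diff integrable_continuous_real cW iw)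
        show "(\<lambda>s. L * (norm (e u s) + \<epsilon>)) integrable_on {0..t}"
          using e_cont[OF u] t
          by (intro integrable_continuous_real continuous_intros) (auto elim: continuous_on_subset)
        fix s assume "s \<in> {0..t}"
        then have s: "s \<in> {0..T}" using t by auto
        have "W u s - w u s = join (clamp_ball \<rho> (e u s)) (z u s - w u s $ None)"
          using join_diff[of "particles (w u s) + clamp_ball \<rho> (e u s)" "z u s" "particles (w u s)" "w u s $ None"]
          by (simp add: W_def)
        then have "norm (W u s - w u s) \<le> norm (e u s) + \<epsilon>"
          using norm_join_le[of "clamp_ball \<rho> (e u s)" "z u s - w u s $ None"] zy[OF u s]
            norm_clamp_ball_le[of \<rho> "e u s"] \<rho>(1) by simp
        then have "L * norm (W u s - w u s) \<le> L * (norm (e u s) + \<epsilon>)"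
          using \<open>L \<ge> 0\<close> by (rule mult_left_mono)
        moreover have "norm (drift (W u s) - drift (w u s)) \<le> L * norm (W u s - w u s)"
          using lipschitz_onD[OF L WQ[OF u s] Q'I[OF wQ[OF u s], of "w u s"]] \<open>d > 0\<close> by (simp add: dist_norm)
        ultimately show "norm (drift (W u s) - drift (w u s)) \<le> L * (norm (e u s) + \<epsilon>)" by linarith
      qed
      finally show ?thesis .
    qed
    then have "norm (e u t) \<le> \<epsilon> * exp (L * t)"
      using \<open>L \<ge> 0\<close> \<epsilon>(1) t
      by (intro gronwall_integral[of T "\<lambda>t. norm (e u t)"] continuous_on_norm e_cont u) auto
    also have "\<dots> \<le> \<epsilon> * exp (L * T)"
      using t \<open>L \<ge> 0\<close> \<epsilon>(1) by (intro mult_left_mono) (auto intro: mult_left_mono)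
    finally show ?thesis using \<epsilon>(3) by simp
  qed
  have WW: "W u t = join (x u t) (z u t)" if "u \<in> U" "t \<in> {0..T}" for u t
    using clamp_ball_id[OF e_small[OF that]] by (simp add: W_def e_def)
  have W0: "W u 0 = w u 0" if "u \<in> U" for u
    using WW[OF that, of 0] x_eq[OF that, of 0] z0[OF that] T by simp
  have Wcont: "continuous_on (U \<times> {0..T}) (\<lambda>(u, t). W u t)"
  proof -
    have "continuous_on (U \<times> {0..T}) (\<lambda>p. join (x (fst p) (snd p)) (z (fst p) (snd p)))"
      using x_cont z unfolding case_prod_beta by (rule continuous_on_join)
    then show ?thesis by (rule continuous_on_eq) (auto simp: WW)
  qed
  show ?thesis
  proof (rule that[of W z'])
    show "is_family U T W"
      unfolding is_family_def
    proof (intro conjI ballI Wcont)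
      fix u t assume ut: "u \<in> U" "t \<in> {0..T}"
      show "W u t \<in> - diagonals" by (rule subsetD[OF Q'(2) WQ[OF ut]])
      show "particles (W u t) = particles (W u 0) + integral {0..t} (\<lambda>s. drift (W u s))"
        using x_eq[OF ut] by (simp add: W0[OF ut(1)] WW[OF ut])
    qed
    show "W u 0 = w u 0" if "u \<in> U" for u by (rule W0[OF that])
    show "continuous_on (U \<times> {0..T}) (\<lambda>(u, t). z' u t)" by (rule z'_cont)
    fix u t assume ut: "u \<in> U" "t \<in> {0..T}"
    show "norm (W u t - w u t) \<le> \<delta>"
      using near[OF ut norm_clamp_ball[of \<rho> "e u t"]] \<rho> \<epsilon>(2) unfolding W_def by linarith
    show "((\<lambda>s. W u s $ None) has_vector_derivative z' u t) (at t within {0..T})"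
      using z'[OF ut] by (simp add: W_def)
  qed
qed

section \<open>Solutions of the controlled system\<close>

lemma solution_continuous:
  assumes "is_solution K F T a \<zeta> x"
  shows "continuous_on {0..T} x"
proof -
  have "continuous_on {0..T} (\<lambda>t. x t $ k)" for k
    unfolding continuous_on_eq_continuous_within
    using assms unfolding is_solution_def
    by (cases k) (auto intro: has_vector_derivative_continuous)
  then have "continuous_on {0..T} (\<lambda>t. \<chi> k. x t $ k)" by (intro continuous_on_vec_lambda)
  then show ?thesis by simp
qed

text \<open>
  The control cancels in the difference of two solutions, so Gronwall's inequality applies to it.
\<close>

lemma solution_unique:
  assumes x: "is_solution K F T a \<zeta> x" and y: "is_solution K F T a \<zeta> y" and "t \<in> {0..T}"
  shows "x t = y t"
proof -
  define Q where "Q = x ` {0..T} \<union> y ` {0..T}"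
  have "compact Q"
    unfolding Q_def by (intro compact_Un compact_continuous_image solution_continuous[OF x] solution_continuous[OF y]) auto
  have Q_off: "Q \<subseteq> - diagonals"
    using x y unfolding Q_def is_solution_def by blast
  obtain L1 where L1: "L1-lipschitz_on Q drift" by (rule drift_lipschitz_compact[OF \<open>compact Q\<close> Q_off])
  obtain L2 where L2: "L2-lipschitz_on Q (F None)"
    by (rule locally_lipschitz_on_compact[OF F_None_lip \<open>compact Q\<close> Q_off])
  define L where "L = L1 + L2"
  have L_nonneg: "0 \<le> L1" "0 \<le> L2" using L1 L2 by (auto dest: lipschitz_on_nonneg)
  define V where "V w = join (drift w) (F None w)" for w
  define d where "d t = x t - y t" for t
  have d_cont: "continuous_on {0..T} d"
    unfolding d_def by (intro continuous_intros solution_continuous[OF x] solution_continuous[OF y])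
  have V_lip: "norm (V (x s) $ k - V (y s) $ k) \<le> L * norm (d s)" if "s \<in> {0..T}" for s k
  proof -
    have Q: "x s \<in> Q" "y s \<in> Q" using that by (auto simp: Q_def)
    have "norm (V (x s) $ k - V (y s) $ k) \<le> L1 * norm (d s) + L2 * norm (d s)"
    proof (cases k)
      case None
      then show ?thesis
        using lipschitz_onD[OF L2 Q] L_nonneg by (simp add: V_def d_def dist_norm add_increasing)
    next
      case (Some i)
      have "norm (drift (x s) $ i - drift (y s) $ i) \<le> L1 * norm (d s)"
        using lipschitz_onD[OF L1 Q] norm_component_diff_le[of "drift (x s)" i "drift (y s)"]
        by (simp add: d_def dist_norm)
      then show ?thesis
        using Some L_nonneg by (simp add: V_def add_increasing2)
    qed
    then show ?thesis by (simp add: L_def distrib_right)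
  qed
  have der: "((\<lambda>s. d s $ k) has_vector_derivative V (x s) $ k - V (y s) $ k) (at s within {0..T})"
    if "s \<in> {0..T}" for s k
  proof (cases k)
    case None
    have "((\<lambda>s. x s $ None) has_vector_derivative F None (x s) + \<zeta> s) (at s within {0..T})"
      "((\<lambda>s. y s $ None) has_vector_derivative F None (y s) + \<zeta> s) (at s within {0..T})"
      using x y that unfolding is_solution_def by blast+
    from has_vector_derivative_diff[OF this] show ?thesis using None by (simp add: d_def V_def)
  next
    case (Some i)
    have "((\<lambda>s. x s $ Some i) has_vector_derivative drift (x s) $ i) (at s within {0..T})"
      "((\<lambda>s. y s $ Some i) has_vector_derivative drift (y s) $ i) (at s within {0..T})"
      using x y that unfolding is_solution_def drift_nth by blast+
    from has_vector_derivative_diff[OF this] show ?thesis using Some by (simp add: d_def V_def)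
  qed
  have d0: "d 0 = 0" using x y unfolding is_solution_def by (simp add: d_def)
  define N where "N = real CARD('n option)"
  have bound: "norm (d t) \<le> integral {0..t} (\<lambda>s. N * L * (norm (d s) + 0))" if t: "t \<in> {0..T}" for t
  proof -
    have nd: "continuous_on {0..t} (\<lambda>s. norm (d s))"
      using d_cont t by (intro continuous_intros) (auto elim: continuous_on_subset)
    have "norm (d t $ k) \<le> integral {0..t} (\<lambda>s. L * norm (d s))" for k
    proof -
      have i: "((\<lambda>s. V (x s) $ k - V (y s) $ k) has_integral d t $ k - d 0 $ k) {0..t}"
        using t by (intro fundamental_theorem_of_calculus has_vector_derivative_within_subset[OF der]) auto
      then have "norm (integral {0..t} (\<lambda>s. V (x s) $ k - V (y s) $ k)) \<le> integral {0..t} (\<lambda>s. L * norm (d s))"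
        using t V_lip nd
        by (intro Henstock_Kurzweil_Integration.integral_norm_bound_integral[OF has_integral_integrable]
            integrable_continuous_real continuous_on_mult continuous_on_const) auto
      then show ?thesis using integral_unique[OF i] d0 by simp
    qed
    then have "norm (d t) \<le> (\<Sum>k\<in>(UNIV::'n option set). integral {0..t} (\<lambda>s. L * norm (d s)))"
      by (intro order_trans[OF norm_le_sum_components sum_mono])
    then show ?thesis by (simp add: N_def mult.assoc)
  qed
  have "norm (d t) \<le> 0 * exp (N * L * t)"
  proof (rule gronwall_integral[of T "\<lambda>t. norm (d t)" "N * L" 0 t])
    show "continuous_on {0..T} (\<lambda>t. norm (d t))" by (intro continuous_on_norm d_cont)
    show "0 \<le> N * L" using L_nonneg by (simp add: N_def L_def)
  qed (use bound \<open>t \<in> {0..T}\<close> in simp_all)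
  then show ?thesis by (simp add: d_def)
qed

lemma final_state_eq:
  assumes "is_solution K F T a \<zeta> x" "0 \<le> T"
  shows "final_state K F T a \<zeta> = x T"
  unfolding final_state_def
proof (rule the_equality)
  show "\<exists>x'. is_solution K F T a \<zeta> x' \<and> x' T = x T" using assms(1) by blast
  fix y assume "\<exists>x'. is_solution K F T a \<zeta> x' \<and> x' T = y"
  then obtain x' where x': "is_solution K F T a \<zeta> x'" "x' T = y" by blast
  have "x' T = x T" by (rule solution_unique[OF x'(1) assms(1)]) (use \<open>0 \<le> T\<close> in simp)
  with x'(2) show "y = x T" by simp
qed

end

section \<open>Continuous families of controls\<close>

lemma mspace_control_space:
  "\<zeta> \<in> mspace (control_space T) \<longleftrightarrow> \<zeta> \<in> extensional {0..T} \<and> continuous_on {0..T} \<zeta>"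
  unfolding control_space_def
  by (subst compactin_mspace_cfunspace) (auto simp: compactin_subtopology continuous_map_iff_continuous)

lemma mdist_control_space_le:
  assumes "0 \<le> T" "\<zeta> \<in> mspace (control_space T)" "\<xi> \<in> mspace (control_space T)"
  shows "mdist (control_space T) \<zeta> \<xi> \<le> a \<longleftrightarrow> (\<forall>t\<in>{0..T}. dist (\<zeta> t) (\<xi> t) \<le> a)"
  using cfunspace_mdist_le[of \<zeta> "top_of_set {0..T}" euclidean_metric \<xi> a] assms
  by (simp add: control_space_def)

lemma continuous_map_control_space:
  fixes z :: "'u::metric_space \<Rightarrow> real \<Rightarrow> real^'d"
  assumes U: "compact U" and "0 \<le> T" and z: "continuous_on (U \<times> {0..T}) (\<lambda>(u, t). z u t)"
  shows "continuous_map (top_of_set U) (mtopology_of (control_space T)) (\<lambda>u. restrict (z u) {0..T})"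
    and "u \<in> U \<Longrightarrow> restrict (z u) {0..T} \<in> mspace (control_space T)"
proof -
  let ?\<zeta> = "\<lambda>u. restrict (z u) {0..T}"
  show mem: "?\<zeta> u \<in> mspace (control_space T)" if "u \<in> U" for u
    unfolding mspace_control_space
    using continuous_on_eq[OF continuous_on_slice[OF z that], of "?\<zeta> u"] by simp
  interpret M: Metric_space "mspace (control_space T) :: (real \<Rightarrow> real^'d) set" "mdist (control_space T)"
    by (rule Metric_space_mspace_mdist)
  have unif: "uniformly_continuous_on (U \<times> {0..T}) (\<lambda>(u, t). z u t)"
    by (intro compact_uniformly_continuous z compact_Times U) auto
  show "continuous_map (top_of_set U) (mtopology_of (control_space T)) ?\<zeta>"
    unfolding mtopology_of_def M.continuous_map_to_metric
  proof (intro ballI allI impI)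
    fix u and \<epsilon> :: real assume "u \<in> topspace (top_of_set U)" and "\<epsilon> > 0"
    then have u: "u \<in> U" by simp
    obtain d where "d > 0" and d: "\<And>p q. p \<in> U \<times> {0..T} \<Longrightarrow> q \<in> U \<times> {0..T} \<Longrightarrow> dist q p < d \<Longrightarrow>
        dist ((\<lambda>(u, t). z u t) q) ((\<lambda>(u, t). z u t) p) < \<epsilon> / 2"
      using unif \<open>\<epsilon> > 0\<close> unfolding uniformly_continuous_on_def by (meson half_gt_zero)
    show "\<exists>V. openin (top_of_set U) V \<and> u \<in> V \<and> (\<forall>u'\<in>V. ?\<zeta> u' \<in> M.mball (?\<zeta> u) \<epsilon>)"
    proof (intro exI[of _ "U \<inter> ball u d"] conjI ballI)
      show "openin (top_of_set U) (U \<inter> ball u d)" by (intro openin_open_Int) auto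
      show "u \<in> U \<inter> ball u d" using u \<open>d > 0\<close> by simp
      fix u' assume u': "u' \<in> U \<inter> ball u d"
      have "dist (?\<zeta> u t) (?\<zeta> u' t) \<le> \<epsilon> / 2" if "t \<in> {0..T}" for t
        using d[of "(u', t)" "(u, t)"] u u' that by (simp add: dist_Pair_Pair)
      then have "mdist (control_space T) (?\<zeta> u) (?\<zeta> u') \<le> \<epsilon> / 2"
        using mdist_control_space_le[OF \<open>0 \<le> T\<close> mem[OF u] mem[of u']] u' by blast
      then show "?\<zeta> u' \<in> M.mball (?\<zeta> u) \<epsilon>"
        using mem[OF u] mem[of u'] u' \<open>\<epsilon> > 0\<close> by simp
    qed
  qed
qed

context particle_system
begin

lemma is_solution_if_family:
  assumes v: "is_family U T v" and u: "u \<in> U"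
    and der: "\<And>t. t \<in> {0..T} \<Longrightarrow> ((\<lambda>s. v u s $ None) has_vector_derivative z' t) (at t within {0..T})"
    and \<zeta>: "\<And>t. t \<in> {0..T} \<Longrightarrow> \<zeta> t = z' t - F None (v u t)"
  shows "is_solution K F T (v u 0) \<zeta> (v u)"
  unfolding is_solution_def
proof (intro conjI ballI allI)
  fix t assume t: "t \<in> {0..T}"
  show "v u t \<in> - diagonals" by (rule is_family_slice(2)[OF v u t])
  show "((\<lambda>s. v u s $ None) has_vector_derivative F None (v u t) + \<zeta> t) (at t within {0..T})"
    using der[OF t] \<zeta>[OF t] by simp
  fix i
  have "continuous_on {0..T} (\<lambda>s. drift (v u s))"
    by (intro continuous_on_drift_compose is_family_slice[OF v u])
  from integral_has_vector_derivative[OF this t]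
  have "((\<lambda>r. particles (v u 0) + integral {0..r} (\<lambda>s. drift (v u s))) has_vector_derivative drift (v u t)) (at t within {0..T})"
    by (auto intro!: derivative_eq_intros)
  then have "((\<lambda>r. particles (v u r)) has_vector_derivative drift (v u t)) (at t within {0..T})"
    by (rule has_vector_derivative_transform[OF t, rotated]) (rule is_family_eq[OF v u])
  from bounded_linear.has_vector_derivative[OF bounded_linear_vec_nth[of i] this]
  show "((\<lambda>s. v u s $ Some i) has_vector_derivative K i (v u t $ Some i - v u t $ None) + F (Some i) (v u t)) (at t within {0..T})"
    by (simp add: drift_nth)
qed simp

text \<open>
  Smoothing costs another \<open>R / 4\<close> in the distance to the target.
\<close>

lemma control_family:
  assumes a: "a \<in> - diagonals" and c: "c \<in> - diagonals" and T: "T > 0"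
  obtains R \<zeta> v where "R > 0"
    and "\<And>u. u \<in> cball c R \<Longrightarrow> \<zeta> u \<in> mspace (control_space T)"
    and "\<And>u. u \<in> cball c R \<Longrightarrow> is_solution K F T a (\<zeta> u) (v u)"
    and "\<And>u. u \<in> cball c R \<Longrightarrow> norm (v u T - u) \<le> R / 2"
    and "continuous_on (cball c R) (\<lambda>u. v u T)"
    and "continuous_map (top_of_set (cball c R)) (mtopology_of (control_space T)) \<zeta>"
proof -
  obtain R where "R > 0" and st: "steers (cball c R) T (\<lambda>_. a) (\<lambda>u z. norm (z - u) \<le> R / 4)"
    by (rule steering_family[OF a c T])
  let ?U = "cball c R"
  obtain w where w: "is_family ?U T w" "\<And>u. u \<in> ?U \<Longrightarrow> w u 0 = a" "\<And>u. u \<in> ?U \<Longrightarrow> norm (w u T - u) \<le> R / 4"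
    using st unfolding steers_def by blast
  have R4: "0 < R / 4" using \<open>R > 0\<close> by simp
  obtain v z' where v: "is_family ?U T v" and v0: "\<And>u. u \<in> ?U \<Longrightarrow> v u 0 = w u 0"
    and vw: "\<And>u t. u \<in> ?U \<Longrightarrow> t \<in> {0..T} \<Longrightarrow> norm (v u t - w u t) \<le> R / 4"
    and der: "\<And>u t. u \<in> ?U \<Longrightarrow> t \<in> {0..T} \<Longrightarrow> ((\<lambda>s. v u s $ None) has_vector_derivative z' u t) (at t within {0..T})"
    and z'_cont: "continuous_on (?U \<times> {0..T}) (\<lambda>(u, t). z' u t)"
    by (rule smooth_family[OF compact_cball T R4 w(1)]) (rule that)
  define z where "z u t = z' u t - F None (v u t)" for u t
  have v_cont: "continuous_on (?U \<times> {0..T}) (\<lambda>(u, t). v u t)" using v unfolding is_family_def by blast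
  have "(\<lambda>p. v (fst p) (snd p)) ` (?U \<times> {0..T}) \<subseteq> - diagonals"
    by (rule image_subsetI, rule is_family_slice(2)[OF v]) auto
  with v_cont have "continuous_on (?U \<times> {0..T}) (\<lambda>p. F None (v (fst p) (snd p)))"
    unfolding case_prod_beta by (rule continuous_on_compose2[OF F_cont])
  then have z_cont: "continuous_on (?U \<times> {0..T}) (\<lambda>(u, t). z u t)"
    using z'_cont unfolding z_def case_prod_beta by (intro continuous_on_diff)
  note cm = continuous_map_control_space[OF compact_cball less_imp_le[OF T] z_cont]
  have T': "T \<in> {0..T}" using T by simp
  show ?thesis
  proof (rule that[of R "\<lambda>u. restrict (z u) {0..T}" v])
    show "R > 0" by fact
    show "restrict (z u) {0..T} \<in> mspace (control_space T)" if "u \<in> ?U" for u by (rule cm(2)[OF that])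
    show "continuous_on ?U (\<lambda>u. v u T)" by (rule is_family_eval[OF v T'])
    show "continuous_map (top_of_set ?U) (mtopology_of (control_space T)) (\<lambda>u. restrict (z u) {0..T})"
      by (rule cm(1))
    fix u assume u: "u \<in> ?U"
    show "is_solution K F T a (restrict (z u) {0..T}) (v u)"
      using is_solution_if_family[OF v u der[OF u]] v0[OF u] w(2)[OF u] by (simp add: z_def)
    show "norm (v u T - u) \<le> R / 2"
      using norm_triangle_ineq[of "v u T - w u T" "w u T - u"] vw[OF u T'] w(3)[OF u] by simp
  qed
qed

lemma exact_controllability:
  assumes T: "T > 0"
  shows "exactly_controllable K F T"
  unfolding exactly_controllable_def
proof (intro ballI)
  fix a c :: "(real^'d)^('n option)" assume a: "a \<in> - diagonals" and c: "c \<in> - diagonals"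
  obtain R \<zeta> v where R: "R > 0"
    and \<zeta>: "\<And>u. u \<in> cball c R \<Longrightarrow> \<zeta> u \<in> mspace (control_space T)"
    and sol: "\<And>u. u \<in> cball c R \<Longrightarrow> is_solution K F T a (\<zeta> u) (v u)"
    and near: "\<And>u. u \<in> cball c R \<Longrightarrow> norm (v u T - u) \<le> R / 2"
    and v_cont: "continuous_on (cball c R) (\<lambda>u. v u T)"
    by (rule control_family[OF a c T]) (rule that)
  have "c \<in> (\<lambda>u. v u T) ` cball c R"
    using R by (intro brouwer_covering[OF R v_cont near]) auto
  then obtain u where "u \<in> cball c R" "v u T = c" by auto
  then show "\<exists>\<zeta>\<in>mspace (control_space T). \<exists>x. is_solution K F T a \<zeta> x \<and> x T = c"
    using \<zeta> sol by blast
qed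

text \<open>
  The compact set of controls is parametrised continuously by a ball, and in terms of this parameter
  every admissible \<open>\<Phi>\<close> is within \<open>3 * R / 4\<close> of the identity.
\<close>

lemma solid_controllability:
  assumes a: "a \<in> - diagonals" and T: "T > 0"
  shows "solidly_controllable K F T a"
proof -
  obtain R \<zeta> v where R: "R > 0"
    and \<zeta>: "\<And>u. u \<in> cball a R \<Longrightarrow> \<zeta> u \<in> mspace (control_space T)"
    and sol: "\<And>u. u \<in> cball a R \<Longrightarrow> is_solution K F T a (\<zeta> u) (v u)"
    and near: "\<And>u. u \<in> cball a R \<Longrightarrow> norm (v u T - u) \<le> R / 2"
    and "continuous_on (cball a R) (\<lambda>u. v u T)"
    and \<zeta>_cont: "continuous_map (top_of_set (cball a R)) (mtopology_of (control_space T)) \<zeta>"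
    by (rule control_family[OF a a T]) (rule that)
  obtain s where s: "s > 0" "ball a s \<subseteq> - diagonals"
    using open_off_diagonals a by (meson openE)
  define r where "r = min s (R / 4)"
  define C where "C = \<zeta> ` cball a R"
  have "r > 0" using s R by (simp add: r_def)
  moreover have "ball a r \<subseteq> - diagonals" using s(2) by (rule order_trans[rotated]) (auto simp: r_def)
  moreover have "C \<subseteq> admissible_controls K F T a"
    using \<zeta> sol unfolding C_def admissible_controls_def by blast
  moreover have "compactin (mtopology_of (control_space T)) C"
    unfolding C_def by (rule image_compactin[OF _ \<zeta>_cont]) (simp add: compactin_subtopology)
  moreover have "ball a r \<subseteq> \<Phi> ` C"
    if \<Phi>: "continuous_map (subtopology (mtopology_of (control_space T)) C) euclidean \<Phi>"
      and close: "\<forall>\<zeta>\<in>C. norm (\<Phi> \<zeta> - final_state K F T a \<zeta>) \<le> R / 4" for \<Phi>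
  proof
    fix y assume y: "y \<in> ball a r"
    have "continuous_map (top_of_set (cball a R)) (subtopology (mtopology_of (control_space T)) C) \<zeta>"
      by (rule continuous_map_into_subtopology[OF \<zeta>_cont]) (auto simp: C_def)
    from continuous_map_compose[OF this \<Phi>]
    have cont: "continuous_on (cball a R) (\<lambda>u. \<Phi> (\<zeta> u))" by (simp add: o_def)
    have "norm (\<Phi> (\<zeta> u) - u) \<le> 3 * R / 4" if u: "u \<in> cball a R" for u
    proof -
      have "final_state K F T a (\<zeta> u) = v u T"
        by (rule final_state_eq[OF sol[OF u]]) (use T in simp)
      moreover have "\<zeta> u \<in> C" using u unfolding C_def by (rule imageI)
      ultimately have "norm (\<Phi> (\<zeta> u) - v u T) \<le> R / 4" using close by auto
      then show ?thesis
        using near[OF u] norm_triangle_ineq[of "\<Phi> (\<zeta> u) - v u T" "v u T - u"] by simp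
    qed
    moreover have "norm (y - a) + 3 * R / 4 \<le> R"
      using y by (simp add: r_def dist_norm norm_minus_commute)
    ultimately have "y \<in> (\<lambda>u. \<Phi> (\<zeta> u)) ` cball a R" by (rule brouwer_covering[OF R cont])
    then show "y \<in> \<Phi> ` C" unfolding C_def by auto
  qed
  ultimately show ?thesis
    unfolding solidly_controllable_def
    using R by (intro exI[of _ "R / 4"] conjI exI[of _ a] exI[of _ r] exI[of _ C]) auto
qed

end

theorem theorem1p5:
  fixes K :: "'n::finite \<Rightarrow> real^'d \<Rightarrow> real^'d"
    and F :: "'n option \<Rightarrow> (real^'d)^('n option) \<Rightarrow> real^'d"
    and Ft :: "'n \<Rightarrow> (real^'d)^'n \<Rightarrow> real^'d"
    and Fh :: "'n \<Rightarrow> (real^'d)^('n option) \<Rightarrow> real^'d"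
    and A :: "'n \<Rightarrow> real^'d^'d"
    and f :: "'n \<Rightarrow> real \<Rightarrow> real"
    and p :: "'n \<Rightarrow> real"
  assumes "CARD('d) \<ge> 2"
    and "\<And>k. continuous_on (- diagonals) (F k)"
    and "\<And>i. continuous_on (- {0}) (K i)"
    and "\<And>i x. x \<in> - diagonals \<Longrightarrow> F (Some i) x = Ft i (\<chi> j. x $ Some j) + Fh i x"
    and "\<And>i z. z \<noteq> 0 \<Longrightarrow> K i z = f i (norm z) *\<^sub>R ((A i *v z) /\<^sub>R (norm z powr p i))"
    and "\<And>i. locally_lipschitz_on (- diagonals) (Ft i)"
    and "\<And>i. locally_lipschitz_on UNIV (Fh i)"
    and "\<And>i. invertible (A i)"
    and "\<And>i. bounded (f i ` {0..})"
    and "\<And>i. \<exists>L. L-lipschitz_on {0..} (f i)"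
    and "\<And>i. f i 0 \<noteq> 0"
    and "\<And>i. p i > 1"
    and "locally_lipschitz_on (- diagonals) (F None)"
  shows "(\<forall>T>0. exactly_controllable K F T) \<and>
         (\<forall>x\<^sub>i\<^sub>n \<in> - diagonals. \<forall>T>0. solidly_controllable K F T x\<^sub>i\<^sub>n)"
proof -
  interpret particle_system K F Ft Fh A f p
    by (rule particle_system.intro) (fact assms)+
  show ?thesis using exact_controllability solid_controllability by blast
qed

end
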